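(* Let $\bar V_2\le\bar W_2:\mathcal X\times\mathcal X\to[1,\infty)$ be symmetric measurable functions such that: (i) $P$ satisfies $C(2,\bar V_2,\bar W_2)$, and $P^s\bar W_2(x,y)<\infty$ for all $(x,y)\in\mathcal X^2$ and $s\in\{1,2\}$; (ii) $P\bar V_2\le c\bar V_2$ and $P\bar W_2^2\le c\bar W_2^2$ for some finite constant $c$, and $\sup_{\ell,j\ge0}\mathbb E\big(\bar W_2^2(X_\ell,X_j)\big)<\infty$; (iii) there exist measurable functions $\mathcal U_1\le\mathcal V_1:\mathcal X\to[1,\infty)$, a symmetric measurable function $\mathcal U_2:\mathcal X\times\mathcal X\to[1,\infty)$ and a finite constant $c$ such that $P$ satisfies $C(1,\mathcal U_1,\mathcal V_1)$ and, for all $m\ge0$ and all $x_1,x_2,x_3\in\mathcal X$, $$\int P(x_1,dz_1)\int P^m(z_1,dz_2)\big(\bar W_2(z_2,z_1)+\bar W_2(z_2,x_1)\big)\big(\bar W_2(z_2,x_2)+\bar W_2(z_2,x_3)\big)\le c\,\mathcal U_1(x_1)\mathcal U_2(x_2,x_3);$$ furthermore $\sup_{\ell\ge1}\mathbb E\big(\mathcal V_1(X_\ell)\mathcal U_2(X_\ell,X_{\ell-1})\big)<\infty$. Let $\{h_n,n\ge1\}$ be symmetric measurable functions $\mathcal X\times\mathcal X\to\mathbb R$ with $\int\int|h_n|\,d\mu\,d\mu<\infty$ and $\bar h_{n,2}\in\mathcal L_{\bar V_2}$, let $U_n(h_n)=\sum_{\ell=2}^n\sum_{j=1}^{\ell-1}h_n(X_\ell,X_j)$,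 and let $\sigma_{n,1}>0$ and $\sigma_n>0$ be defined by $$\sigma_{n,1}^2=\mathrm{Var}_\mu\big(\bar h_{n,1}(X_0)\big)+2\sum_{\ell\ge1}\mathrm{Cov}_\mu\big(\bar h_{n,1}(X_0),\bar h_{n,1}(X_\ell)\big),\qquad\sigma_n^2=n(n-1)^2\sigma_{n,1}^2.$$ Suppose also that $$|||\bar h_{n,2}|||_{2,\bar V_2}=o\big(n^{1/2}\sigma_{n,1}\big)\quad\text{as }n\to\infty.$$ Then, as $n\to\infty$, $$\frac1{\sigma_n}\Big(U_n(h_n)-\theta_n\binom n2\Big)-\frac1{\sigma_{n,1}\sqrt n}\sum_{\ell=1}^n\bar h_{n,1}(X_\ell)\to0\quad\text{in probability.}$$
   Context: $\{X_n,n\ge0\}$ is a (possibly nonstationary) Markov chain on a measurable space $(\mathcal X,\mathcal B)$ with countably generated sigma-algebra, with transition kernel $P$, invariant probability distribution $\mu$ and initial distribution $\rho$; $\mathbb E$ is expectation for this chain, and $\mathrm{Var}_\mu,\mathrm{Cov}_\mu$ refer to the chain started from $\mu$. $P^0$ is the identity kernel and $P^m$, acting as a kernel on $\mathcal X$, is the $m$-th iterate. For $W:\mathbb T\to[1,\infty)$ and $f:\mathbb T\to\mathbb R$ measurable, $|f|_W:=\sup_x|f(x)|/W(x)$; $\mathcal L_W$ is the set of measurable $f$ with $|f|_W<\infty$; for a finite signed measure $\nu$, $\|\nu\|_W:=\int W\,d|\nu|$. For a bivariate function $h$: $Ph(x,y):=\int P(x,dz)h(z,y)$ (first coordinate) and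 $P^2h(x_1,x_2):=\int P(x_1,dz_1)\int P(x_2,dz_2)h(z_1,z_2)$ (both coordinates). For $p\ge1$ and $V:\mathcal X\times\mathcal X\to[1,\infty)$, $$|||h|||_{p,V}:=\sup_{x,y\in\mathcal X}\frac{\big(\int P(x,dz)|h(z,y)|^p\big)^{1/p}}{V(x,y)}.$$ Condition $C(r,V,W)$, for $r\in\{1,2\}$ and measurable $V\le W:\mathcal X^r\to[1,\infty)$: there is a finite constant $c$ such that for all $(x_1,\dots,x_r)\in\mathcal X^r$, $$\sum_{\ell_1\ge0}\cdots\sum_{\ell_r\ge0}\Big\|\bigotimes_{j=1}^r\big(P^{\ell_j}(x_j,\cdot)-\mu\big)\Big\|_V\le c\,W(x_1,\dots,x_r).$$ $\theta_n:=\int\int h_n(x,y)\mu(dx)\mu(dy)$, $\bar h_{n,1}(x):=\int h_n(x,z)\mu(dz)-\theta_n$, $\bar h_{n,2}(x,y):=h_n(x,y)-\bar h_{n,1}(x)-\bar h_{n,1}(y)-\theta_n$. *)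

theory Defs
  imports "HOL-Probability.Probability"
begin

definition countably_generated_space :: "'a measure \<Rightarrow> bool" where
  "countably_generated_space M \<longleftrightarrow>
     (\<exists>G. countable G \<and> G \<subseteq> Pow (space M) \<and> sets M = sigma_sets (space M) G)"

definition symmetric_on :: "'a set \<Rightarrow> ('a \<times> 'a \<Rightarrow> 'b) \<Rightarrow> bool" where
  "symmetric_on S f \<longleftrightarrow> (\<forall>x\<in>S. \<forall>y\<in>S. f (x, y) = f (y, x))"

primrec kernel_power :: "'a measure \<Rightarrow> ('a \<Rightarrow> 'a measure) \<Rightarrow> nat \<Rightarrow> 'a \<Rightarrow> 'a measure" where
  "kernel_power M P 0 = return M"
| "kernel_power M P (Suc m) = (\<lambda>x. bind (P x) (kernel_power M P m))"

definition invariant_distribution :: "'a measure \<Rightarrow> ('a \<Rightarrow> 'a measure) \<Rightarrow> 'a measure \<Rightarrow> bool" where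
  "invariant_distribution M P \<mu> \<longleftrightarrow> \<mu> \<in> space (prob_algebra M) \<and> bind \<mu> P = \<mu>"

definition natural_filtration ::
  "'w measure \<Rightarrow> 'a measure \<Rightarrow> (nat \<Rightarrow> 'w \<Rightarrow> 'a) \<Rightarrow> nat \<Rightarrow> 'w measure" where
  "natural_filtration \<Omega> M X n =
     vimage_algebra (space \<Omega>) (\<lambda>\<omega>. \<lambda>i\<in>{..n}. X i \<omega>) (Pi\<^sub>M {..n} (\<lambda>_. M))"

definition markov_chain ::
  "'w measure \<Rightarrow> 'a measure \<Rightarrow> ('a \<Rightarrow> 'a measure) \<Rightarrow> 'a measure \<Rightarrow> (nat \<Rightarrow> 'w \<Rightarrow> 'a) \<Rightarrow> bool" where
  "markov_chain \<Omega> M P \<rho> X \<longleftrightarrow>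
     prob_space \<Omega> \<and> (\<forall>n. X n \<in> measurable \<Omega> M) \<and> distr \<Omega> M (X 0) = \<rho> \<and>
     (\<forall>n. \<forall>A\<in>sets M. AE \<omega> in \<Omega>.
        real_cond_exp \<Omega> (natural_filtration \<Omega> M X n) (indicator (X (Suc n) -` A \<inter> space \<Omega>)) \<omega>
          = measure (P (X n \<omega>)) A)"

text \<open>For a bivariate \<open>f\<close>, \<open>Pf\<close> is \<open>kernel_fst P f\<close> and \<open>P\<^sup>2f\<close> is \<open>kernel_both P f\<close>
  (not the second iterate of \<open>kernel_fst P\<close>).\<close>

definition kernel_fst ::
  "('a \<Rightarrow> 'a measure) \<Rightarrow> ('a \<times> 'a \<Rightarrow> ennreal) \<Rightarrow> 'a \<times> 'a \<Rightarrow> ennreal" where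
  "kernel_fst P f = (\<lambda>(x, y). \<integral>\<^sup>+ z. f (z, y) \<partial>P x)"

definition kernel_both ::
  "('a \<Rightarrow> 'a measure) \<Rightarrow> ('a \<times> 'a \<Rightarrow> ennreal) \<Rightarrow> 'a \<times> 'a \<Rightarrow> ennreal" where
  "kernel_both P f = (\<lambda>(x\<^sub>1, x\<^sub>2). \<integral>\<^sup>+ z\<^sub>1. (\<integral>\<^sup>+ z\<^sub>2. f (z\<^sub>1, z\<^sub>2) \<partial>P x\<^sub>2) \<partial>P x\<^sub>1)"

text \<open>A finite signed measure on \<open>M\<close> is given by its set function \<open>\<nu> :: 'a set \<Rightarrow> real\<close>.\<close>

definition total_variation_measure :: "'a measure \<Rightarrow> ('a set \<Rightarrow> real) \<Rightarrow> 'a measure" where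
  "total_variation_measure M \<nu> = measure_of (space M) (sets M)
     (\<lambda>A. SUP D\<in>{D. finite D \<and> disjoint D \<and> D \<subseteq> sets M \<and> \<Union>D \<subseteq> A}. \<Sum>B\<in>D. ennreal \<bar>\<nu> B\<bar>)"

definition signed_measure_norm :: "'a measure \<Rightarrow> ('a \<Rightarrow> real) \<Rightarrow> ('a set \<Rightarrow> real) \<Rightarrow> ennreal" where
  "signed_measure_norm M V \<nu> = (\<integral>\<^sup>+ x. ennreal (V x) \<partial>total_variation_measure M \<nu>)"

definition diff_signed :: "'a measure \<Rightarrow> 'a measure \<Rightarrow> 'a set \<Rightarrow> real" where
  "diff_signed p q = (\<lambda>A. measure p A - measure q A)"

text \<open>The product signed measure \<open>(p\<^sub>1 - q\<^sub>1) \<otimes> (p\<^sub>2 - q\<^sub>2)\<close> for finite measures, expanded by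
  bilinearity; its value on a rectangle \<open>A \<times> B\<close> is
  \<open>diff_signed p\<^sub>1 q\<^sub>1 A * diff_signed p\<^sub>2 q\<^sub>2 B\<close>.\<close>

definition diff_signed_prod ::
  "'a measure \<Rightarrow> 'a measure \<Rightarrow> 'b measure \<Rightarrow> 'b measure \<Rightarrow> ('a \<times> 'b) set \<Rightarrow> real" where
  "diff_signed_prod p\<^sub>1 q\<^sub>1 p\<^sub>2 q\<^sub>2 = (\<lambda>A.
     measure (p\<^sub>1 \<Otimes>\<^sub>M p\<^sub>2) A - measure (p\<^sub>1 \<Otimes>\<^sub>M q\<^sub>2) A - measure (q\<^sub>1 \<Otimes>\<^sub>M p\<^sub>2) A + measure (q\<^sub>1 \<Otimes>\<^sub>M q\<^sub>2) A)"

definition cond_C1 ::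
  "'a measure \<Rightarrow> ('a \<Rightarrow> 'a measure) \<Rightarrow> 'a measure \<Rightarrow> ('a \<Rightarrow> real) \<Rightarrow> ('a \<Rightarrow> real) \<Rightarrow> bool" where
  "cond_C1 M P \<mu> V W \<longleftrightarrow>
     V \<in> borel_measurable M \<and> W \<in> borel_measurable M \<and>
     (\<forall>x\<in>space M. 1 \<le> V x \<and> V x \<le> W x) \<and>
     (\<exists>c::real. \<forall>x\<in>space M.
        (\<Sum>l. signed_measure_norm M V (diff_signed (kernel_power M P l x) \<mu>)) \<le> ennreal (c * W x))"

definition cond_C2 ::
  "'a measure \<Rightarrow> ('a \<Rightarrow> 'a measure) \<Rightarrow> 'a measure \<Rightarrow>
     ('a \<times> 'a \<Rightarrow> real) \<Rightarrow> ('a \<times> 'a \<Rightarrow> real) \<Rightarrow> bool" where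
  "cond_C2 M P \<mu> V W \<longleftrightarrow>
     V \<in> borel_measurable (M \<Otimes>\<^sub>M M) \<and> W \<in> borel_measurable (M \<Otimes>\<^sub>M M) \<and>
     (\<forall>x\<in>space (M \<Otimes>\<^sub>M M). 1 \<le> V x \<and> V x \<le> W x) \<and>
     (\<exists>c::real. \<forall>x\<^sub>1\<in>space M. \<forall>x\<^sub>2\<in>space M.
        (\<Sum>l\<^sub>1. \<Sum>l\<^sub>2. signed_measure_norm (M \<Otimes>\<^sub>M M) V
           (diff_signed_prod (kernel_power M P l\<^sub>1 x\<^sub>1) \<mu> (kernel_power M P l\<^sub>2 x\<^sub>2) \<mu>))
        \<le> ennreal (c * W (x\<^sub>1, x\<^sub>2)))"

definition weighted_sup_norm :: "'a measure \<Rightarrow> ('a \<Rightarrow> real) \<Rightarrow> ('a \<Rightarrow> real) \<Rightarrow> ennreal" where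
  "weighted_sup_norm N W f = (SUP x\<in>space N. ennreal (\<bar>f x\<bar> / W x))"

definition weighted_space :: "'a measure \<Rightarrow> ('a \<Rightarrow> real) \<Rightarrow> ('a \<Rightarrow> real) set" where
  "weighted_space N W = {f \<in> borel_measurable N. weighted_sup_norm N W f < \<infinity>}"

definition ennreal_powr :: "ennreal \<Rightarrow> real \<Rightarrow> ennreal" where
  "ennreal_powr t a = (if t = \<infinity> then \<infinity> else ennreal (enn2real t powr a))"

definition triple_norm ::
  "'a measure \<Rightarrow> ('a \<Rightarrow> 'a measure) \<Rightarrow> real \<Rightarrow> ('a \<times> 'a \<Rightarrow> real) \<Rightarrow> ('a \<times> 'a \<Rightarrow> real) \<Rightarrow> ennreal" where
  "triple_norm M P p V h =
     (SUP x\<in>space M. SUP y\<in>space M.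
        ennreal_powr (\<integral>\<^sup>+ z. ennreal (\<bar>h (z, y)\<bar> powr p) \<partial>P x) (1 / p) / ennreal (V (x, y)))"

definition U_stat :: "nat \<Rightarrow> ('a \<times> 'a \<Rightarrow> real) \<Rightarrow> (nat \<Rightarrow> 'w \<Rightarrow> 'a) \<Rightarrow> 'w \<Rightarrow> real" where
  "U_stat n h X \<omega> = (\<Sum>l=2..n. \<Sum>j=1..l-1. h (X l \<omega>, X j \<omega>))"

definition hoeff_mean :: "'a measure \<Rightarrow> ('a \<times> 'a \<Rightarrow> real) \<Rightarrow> real" where
  "hoeff_mean \<mu> h = (\<integral>y. (\<integral>x. h (x, y) \<partial>\<mu>) \<partial>\<mu>)"

definition hoeff_fst :: "'a measure \<Rightarrow> ('a \<times> 'a \<Rightarrow> real) \<Rightarrow> 'a \<Rightarrow> real" where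
  "hoeff_fst \<mu> h x = (\<integral>z. h (x, z) \<partial>\<mu>) - hoeff_mean \<mu> h"

definition hoeff_snd :: "'a measure \<Rightarrow> ('a \<times> 'a \<Rightarrow> real) \<Rightarrow> 'a \<times> 'a \<Rightarrow> real" where
  "hoeff_snd \<mu> h = (\<lambda>(x, y). h (x, y) - hoeff_fst \<mu> h x - hoeff_fst \<mu> h y - hoeff_mean \<mu> h)"

definition covariance :: "'w measure \<Rightarrow> ('w \<Rightarrow> real) \<Rightarrow> ('w \<Rightarrow> real) \<Rightarrow> real" where
  "covariance \<Omega> f g =
     (\<integral>\<omega>. (f \<omega> - (\<integral>\<omega>'. f \<omega>' \<partial>\<Omega>)) * (g \<omega> - (\<integral>\<omega>'. g \<omega>' \<partial>\<Omega>)) \<partial>\<Omega>)"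

text \<open>The variance-plus-covariance-series formula, as a relation: it holds for \<open>v\<close> only if the
  variance is finite and the series converges.\<close>

definition has_asymptotic_variance ::
  "'w measure \<Rightarrow> (nat \<Rightarrow> 'w \<Rightarrow> 'a) \<Rightarrow> ('a \<Rightarrow> real) \<Rightarrow> real \<Rightarrow> bool" where
  "has_asymptotic_variance \<Omega> Y f v \<longleftrightarrow>
     integrable \<Omega> (\<lambda>\<omega>. (f (Y 0 \<omega>))\<^sup>2) \<and>
     (\<exists>S. (\<lambda>l. covariance \<Omega> (\<lambda>\<omega>. f (Y 0 \<omega>)) (\<lambda>\<omega>. f (Y (Suc l) \<omega>))) sums S \<and>
          v = prob_space.variance \<Omega> (\<lambda>\<omega>. f (Y 0 \<omega>)) + 2 * S)"

definition tendsto_in_prob :: "'w measure \<Rightarrow> (nat \<Rightarrow> 'w \<Rightarrow> real) \<Rightarrow> real \<Rightarrow> bool" where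
  "tendsto_in_prob \<Omega> Z c \<longleftrightarrow>
     (\<forall>\<epsilon>>0. (\<lambda>n. measure \<Omega> {\<omega> \<in> space \<Omega>. \<bar>Z n \<omega> - c\<bar> > \<epsilon>}) \<longlonglongrightarrow> 0)"

end

theory Submission
  imports Defs
begin

text \<open>
  By Hoeffding's decomposition the difference in question is \<open>U\<^sub>n(h)/\<sigma>\<^sub>n\<close> for the degenerate kernel \<open>h\<close>, so with
  \<open>T\<close> its triple norm one needs \<open>U\<^sub>n(h)\<close> to be of order \<open>n T\<close> in probability. Solving the Poisson equation
  \<open>G - PG = h\<close> in the later coordinate turns \<open>U\<^sub>n(h)\<close> into a martingale with differences
  \<open>\<Sum>j<l. G(X\<^sub>l, X\<^sub>j) - PG(X\<^bsub>l-1\<^esub>, X\<^sub>j)\<close> plus a remainder of order \<open>n T\<close>. The pairs with \<open>l - j \<le> \<surd>n\<close> are harmless by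
  a crude second moment bound. For the other pairs \<open>X\<^sub>l\<close> is replaced by an independent variable of law \<open>\<mu>\<close>:
  the mixing condition applied to \<open>f \<otimes> f\<close> bounds \<open>(\<Sum>k. \<parallel>P\<^sup>k(x) - \<mu>\<parallel>)\<^sup>2\<close> by a multiple of \<open>W(x, x)\<close>, and together with the
  second moments of \<open>W\<close> along the chain this bootstraps to an expected total variation distance
  of order \<open>k\<^sup>-\<^sup>3\<close> after \<open>k\<close> steps, which beats the \<open>n\<close> terms for \<open>k \<approx> \<surd>n\<close>. After decoupling, the Poisson
  equation in the earlier coordinate has orthogonal increments, so each conditional variance
  is of order \<open>n T\<^sup>2\<close>.
\<close>

section \<open>Total variation of signed measures\<close>

text \<open>The obstacle is that the triple norm \<open>T\<close> controls \<open>h\<close> only in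
  the mean over one step of \<open>P\<close>, while membership in the weighted space carries a
  constant that may vary arbitrarily with \<open>n\<close>. That constant serves only to make
  integrals exist. Every estimate is arranged so that \<open>h\<close> is averaged first: Jensen's
  inequality bounds Ph by T V, the mixing condition is applied to Ph, and the unaveraged term of a
  Poisson solution is split off and kept in second moment. Under mu the missing step comes from mu P
  = mu. The Poisson solutions are cut at a finite horizon that shrinks with time, so the telescoping
  is exact. The second obstacle is that total variation compares expectations of bounded functions
  only, and the conditional variances have no known bound. They are cut off at a level of the order
  of sigma_n squared: exceeding it is improbable, and below it the error is the level times the
  distance. Relative to sigma_n squared, \<open>n\<close> such errors at lag k near sqrt n sum to n
  k^-3, of order 1 / sqrt n; a decay k^-2 would leave an error of order 1, which is why the rate has
  to be bootstrapped.\<close>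

definition countably_additive_real :: "'a measure \<Rightarrow> ('a set \<Rightarrow> real) \<Rightarrow> bool" where
  "countably_additive_real M \<nu> \<longleftrightarrow>
     (\<forall>A::nat \<Rightarrow> 'a set. range A \<subseteq> sets M \<longrightarrow> disjoint_family A \<longrightarrow> (\<lambda>i. \<nu> (A i)) sums \<nu> (\<Union>i. A i))"

lemma countably_additive_real_empty:
  assumes "countably_additive_real M \<nu>"
  shows "\<nu> {} = 0"
proof -
  have "(\<lambda>i::nat. \<nu> {}) sums \<nu> (\<Union>i::nat. {})"
    using assms[unfolded countably_additive_real_def, rule_format, of "\<lambda>_. {}"]
    by (simp add: disjoint_family_on_def)
  then have "summable (\<lambda>i::nat. \<nu> {})" by (rule sums_summable)
  then show ?thesis
    by (simp add: summable_const_iff)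
qed

context
  fixes M :: "'a measure" and \<nu> :: "'a set \<Rightarrow> real"
  assumes ca: "countably_additive_real M \<nu>"
begin

abbreviation (input) "tvparts A \<equiv> {D. finite D \<and> disjoint D \<and> D \<subseteq> sets M \<and> \<Union>D \<subseteq> A}"
abbreviation (input) "tvsup A \<equiv> (SUP D\<in>tvparts A. \<Sum>B\<in>D. ennreal \<bar>\<nu> B\<bar>)"

lemma tvsup_ge:
  "A \<in> sets M \<Longrightarrow> ennreal \<bar>\<nu> A\<bar> \<le> tvsup A"
  by (rule SUP_upper2[where i="{A}"]) (auto simp: disjoint_def)

text \<open>Partitions of the two pieces combine into a partition inside the union, and in
  \<open>ennreal\<close> the sum of two suprema over non-empty sets is the supremum of the
  sums.\<close>

lemma tvsup_Un:
  assumes "A \<inter> B = {}"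
  shows "tvsup A + tvsup B \<le> tvsup (A \<union> B)"
proof -
  have e: "{} \<in> tvparts A" for A :: "'a set" by simp
  have ne: "tvparts A \<noteq> {}" "tvparts B \<noteq> {}"
    using e[of A] e[of B] by (metis empty_iff)+
  have "tvsup A + tvsup B =
      (SUP D\<in>tvparts A. SUP E\<in>tvparts B. (\<Sum>B\<in>D. ennreal \<bar>\<nu> B\<bar>) + (\<Sum>B\<in>E. ennreal \<bar>\<nu> B\<bar>))"
    by (simp only: ennreal_SUP_add_left[OF ne(1), symmetric] ennreal_SUP_add_right[OF ne(2), symmetric])
  also have "\<dots> \<le> tvsup (A \<union> B)"
  proof (intro SUP_least)
    fix D E assume D: "D \<in> tvparts A" and E: "E \<in> tvparts B"
    \<comment> \<open>The empty set may belong to both partitions. It is the only possible common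
      member and has value zero.\<close>
    have DE: "D \<inter> E \<subseteq> {{}}" using D E assms by blast
    have "(\<Sum>B\<in>D. ennreal \<bar>\<nu> B\<bar>) + (\<Sum>B\<in>E. ennreal \<bar>\<nu> B\<bar>) = (\<Sum>B\<in>D \<union> E. ennreal \<bar>\<nu> B\<bar>)"
    proof -
      have "(\<Sum>B\<in>D \<inter> E. ennreal \<bar>\<nu> B\<bar>) = 0"
        using DE countably_additive_real_empty[OF ca] by (intro sum.neutral) auto
      then show ?thesis using sum.union_inter[of D E "\<lambda>B. ennreal \<bar>\<nu> B\<bar>"] D E by simp
    qed
    also have "\<dots> \<le> tvsup (A \<union> B)"
    proof (rule SUP_upper)
      have "disjoint (D \<union> E)"
      proof (rule disjoint_union)
        have "\<Union>D \<subseteq> A" "\<Union>E \<subseteq> B" using D E by auto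
        then show "\<Union>D \<inter> \<Union>E = {}" using assms by blast
      qed (use D E in auto)
      then show "D \<union> E \<in> tvparts (A \<union> B)" using D E by auto
    qed
    finally show "(\<Sum>B\<in>D. ennreal \<bar>\<nu> B\<bar>) + (\<Sum>B\<in>E. ennreal \<bar>\<nu> B\<bar>) \<le> tvsup (A \<union> B)" .
  qed
  finally show ?thesis .
qed

lemma tvsup_countable_superadditive:
  fixes A :: "nat \<Rightarrow> 'a set"
  assumes "disjoint_family A"
  shows "(\<Sum>i. tvsup (A i)) \<le> tvsup (\<Union>i. A i)"
proof -
  have fin: "(\<Sum>i<n. tvsup (A i)) \<le> tvsup (\<Union>i<n. A i)" for n
  proof (induction n)
    case (Suc n)
    have "A i \<inter> A n = {}" if "i < n" for i
      using disjoint_family_onD[OF assms, of i n] that by simp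
    then have "(\<Union>i<n. A i) \<inter> A n = {}" by blast
    then have "tvsup (\<Union>i<n. A i) + tvsup (A n) \<le> tvsup ((\<Union>i<n. A i) \<union> A n)"
      by (rule tvsup_Un)
    also have "(\<Union>i<n. A i) \<union> A n = (\<Union>i<Suc n. A i)"
      by (auto simp: less_Suc_eq)
    finally have "tvsup (\<Union>i<n. A i) + tvsup (A n) \<le> tvsup (\<Union>i<Suc n. A i)" .
    then show ?case unfolding sum.lessThan_Suc by (rule order_trans[OF add_right_mono[OF Suc.IH]])
  qed simp
  have "(\<Sum>i<n. tvsup (A i)) \<le> tvsup (\<Union>i. A i)" for n
  proof (rule order_trans[OF fin SUP_subset_mono])
    have "(\<Union>i<n. A i) \<subseteq> (\<Union>i. A i)" by blast
    then show "tvparts (\<Union>i<n. A i) \<subseteq> tvparts (\<Union>i. A i)"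
      by (intro Collect_mono impI) (metis order_trans)
  qed simp
  then show ?thesis
    by (simp add: suminf_eq_SUP SUP_least)
qed

text \<open>Each member of a partition of the union is cut along the pieces \<open>A i\<close>;
  countable additivity of the signed function recovers its value from the traces.\<close>

lemma tvsup_countable_subadditive:
  fixes A :: "nat \<Rightarrow> 'a set"
  assumes A: "range A \<subseteq> sets M" "disjoint_family A"
  shows "tvsup (\<Union>i. A i) \<le> (\<Sum>i. tvsup (A i))"
proof (rule SUP_least)
  fix D assume D: "D \<in> tvparts (\<Union>i. A i)"
  have "(\<Sum>B\<in>D. ennreal \<bar>\<nu> B\<bar>) \<le> (\<Sum>B\<in>D. \<Sum>i. ennreal \<bar>\<nu> (B \<inter> A i)\<bar>)"
  proof (rule sum_mono)
    fix B assume B: "B \<in> D"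
    have "(\<lambda>i. \<nu> (B \<inter> A i)) sums \<nu> (\<Union>i. B \<inter> A i)"
      using ca A B D unfolding countably_additive_real_def
      by (elim allE[of _ "\<lambda>i. B \<inter> A i"]) (auto simp: disjoint_family_on_def)
    also have "(\<Union>i. B \<inter> A i) = B" using B D by auto
    finally have s: "(\<lambda>i. \<nu> (B \<inter> A i)) sums \<nu> B" .
    show "ennreal \<bar>\<nu> B\<bar> \<le> (\<Sum>i. ennreal \<bar>\<nu> (B \<inter> A i)\<bar>)"
    proof (rule LIMSEQ_le_const2)
      show "(\<lambda>n. ennreal \<bar>\<Sum>i<n. \<nu> (B \<inter> A i)\<bar>) \<longlonglongrightarrow> ennreal \<bar>\<nu> B\<bar>"
        using s unfolding sums_def by (intro tendsto_intros) auto
      have "ennreal \<bar>\<Sum>i<n. \<nu> (B \<inter> A i)\<bar> \<le> (\<Sum>i. ennreal \<bar>\<nu> (B \<inter> A i)\<bar>)" for n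
      proof -
        have "ennreal \<bar>\<Sum>i<n. \<nu> (B \<inter> A i)\<bar> \<le> ennreal (\<Sum>i<n. \<bar>\<nu> (B \<inter> A i)\<bar>)"
          by (rule ennreal_leI) (rule sum_abs)
        also have "\<dots> = (\<Sum>i<n. ennreal \<bar>\<nu> (B \<inter> A i)\<bar>)" by simp
        also have "\<dots> \<le> (\<Sum>i. ennreal \<bar>\<nu> (B \<inter> A i)\<bar>)" by (rule sum_le_suminf) auto
        finally show ?thesis .
      qed
      then show "\<exists>N. \<forall>n\<ge>N. ennreal \<bar>\<Sum>i<n. \<nu> (B \<inter> A i)\<bar> \<le> (\<Sum>i. ennreal \<bar>\<nu> (B \<inter> A i)\<bar>)" by blast
    qed
  qed
  also have "\<dots> = (\<Sum>i. \<Sum>B\<in>D. ennreal \<bar>\<nu> (B \<inter> A i)\<bar>)"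
    by (rule suminf_sum[symmetric]) auto
  also have "\<dots> \<le> (\<Sum>i. tvsup (A i))"
  proof (rule suminf_le)
    fix i
    let ?E = "(\<lambda>B. B \<inter> A i) ` D"
    have "(\<Sum>B\<in>D. ennreal \<bar>\<nu> (B \<inter> A i)\<bar>) = (\<Sum>B\<in>?E. ennreal \<bar>\<nu> B\<bar>)"
    \<comment> \<open>Different members of \<open>D\<close> may have the same trace on
      \<open>A i\<close>, but only when that trace is empty.\<close>
    proof (rule sum.reindex_nontrivial[symmetric, unfolded comp_def])
      show "finite D" using D by simp
      fix B C assume "B \<in> D" "C \<in> D" "B \<noteq> C" "B \<inter> A i = C \<inter> A i"
      then have "B \<inter> A i = {}" using D unfolding disjoint_def by blast
      then show "ennreal \<bar>\<nu> (B \<inter> A i)\<bar> = 0"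
        using countably_additive_real_empty[OF ca] by simp
    qed
    also have "\<dots> \<le> tvsup (A i)"
    proof (rule SUP_upper)
      have "disjoint ?E" using D unfolding disjoint_def by blast
      then show "?E \<in> tvparts (A i)" using D A by auto
    qed
    finally show "(\<Sum>B\<in>D. ennreal \<bar>\<nu> (B \<inter> A i)\<bar>) \<le> tvsup (A i)" .
  qed auto
  finally show "(\<Sum>B\<in>D. ennreal \<bar>\<nu> B\<bar>) \<le> (\<Sum>i. tvsup (A i))" .
qed

text \<open>\<open>measure_of\<close> yields the zero measure when its set function is not countably
  additive, so this lemma is what gives the weighted norm of the definitions its intended
  meaning.\<close>

lemma emeasure_total_variation_measure:
  assumes A: "A \<in> sets M"
  shows "emeasure (total_variation_measure M \<nu>) A = tvsup A"
  unfolding total_variation_measure_def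
proof (rule emeasure_measure_of_sigma)
  show "sigma_algebra (space M) (sets M)" by (rule sets.sigma_algebra_axioms)
  show "positive (sets M) (\<lambda>A. tvsup A)"
  proof -
    have "(\<Sum>B\<in>D. ennreal \<bar>\<nu> B\<bar>) = 0" if "D \<in> tvparts {}" for D
      using that countably_additive_real_empty[OF ca] by (intro sum.neutral) auto
    then have "tvsup {} \<le> 0" by (intro SUP_least) auto
    then show ?thesis unfolding positive_def by (simp add: le_zero_eq)
  qed
  show "countably_additive (sets M) (\<lambda>A. tvsup A)"
    unfolding countably_additive_def
    using tvsup_countable_superadditive tvsup_countable_subadditive by (blast intro: antisym)
qed fact

lemma emeasure_total_variation_measure_ge:
  assumes A: "A \<in> sets M"
  shows "ennreal \<bar>\<nu> A\<bar> \<le> emeasure (total_variation_measure M \<nu>) A"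
  using tvsup_ge[OF A] emeasure_total_variation_measure[OF A] by simp

end

lemma sets_total_variation_measure [simp, measurable_cong]:
  "sets (total_variation_measure M \<nu>) = sets M"
  by (simp add: total_variation_measure_def)

lemma countably_additive_real_measure:
  assumes "finite_measure p" "sets p = sets M"
  shows "countably_additive_real M (measure p)"
proof -
  interpret finite_measure p by fact
  show ?thesis unfolding countably_additive_real_def
    using finite_measure_UNION assms(2) by auto
qed

lemma countably_additive_real_add:
  "countably_additive_real M a \<Longrightarrow> countably_additive_real M b \<Longrightarrow>
    countably_additive_real M (\<lambda>A. a A + b A)"
  unfolding countably_additive_real_def by (auto intro!: sums_add)

lemma countably_additive_real_diff:
  "countably_additive_real M a \<Longrightarrow> countably_additive_real M b \<Longrightarrow>
    countably_additive_real M (\<lambda>A. a A - b A)"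
  unfolding countably_additive_real_def by (auto intro!: sums_diff)

text \<open>Additions on both sides stand for the signed inequality a - b - c + d <= t, since
  subtraction in \<open>ennreal\<close> is truncated. The four slots match the four product measures
  in \<open>diff_signed_prod\<close>; when fewer are involved, null measures fill the
  others.\<close>

lemma nn_integral_measure_add_mono:
  assumes [measurable_cong]: "sets a = sets M" "sets b = sets M" "sets c = sets M" "sets d = sets M" "sets t = sets M"
    and le: "\<And>A. A \<in> sets M \<Longrightarrow> emeasure a A + emeasure d A \<le> emeasure b A + emeasure c A + emeasure t A"
    and f: "f \<in> borel_measurable M"
  shows "(\<integral>\<^sup>+x. f x \<partial>a) + (\<integral>\<^sup>+x. f x \<partial>d) \<le> (\<integral>\<^sup>+x. f x \<partial>b) + (\<integral>\<^sup>+x. f x \<partial>c) + (\<integral>\<^sup>+x. f x \<partial>t)"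
  using f
proof (induction rule: borel_measurable_induct)
  case (cong f g)
  have sp: "space a = space M" "space b = space M" "space c = space M" "space d = space M" "space t = space M"
    using assms(1-5) by (auto dest: sets_eq_imp_space_eq)
  have "(\<integral>\<^sup>+x. g x \<partial>m) = (\<integral>\<^sup>+x. f x \<partial>m)" if "space m = space M" for m
    by (rule nn_integral_cong) (use cong that in auto)
  then show ?case using cong sp by simp
next
  case (set A)
  then show ?case using le[of A] assms(1-5) by simp
next
  case (mult u r)
  have [measurable]: "u \<in> borel_measurable M" by fact
  have "r * ((\<integral>\<^sup>+x. u x \<partial>a) + (\<integral>\<^sup>+x. u x \<partial>d)) \<le> r * ((\<integral>\<^sup>+x. u x \<partial>b) + (\<integral>\<^sup>+x. u x \<partial>c) + (\<integral>\<^sup>+x. u x \<partial>t))"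
    using mult by (intro mult_left_mono) auto
  then show ?case by (simp add: nn_integral_cmult distrib_left)
next
  case (add u v)
  have [measurable]: "u \<in> borel_measurable M" "v \<in> borel_measurable M" by fact+
  show ?case using add_mono[OF add.IH]
    by (simp add: nn_integral_add ac_simps)
next
  case (seq U)
  note [measurable] = seq(1)
  have lim: "(\<integral>\<^sup>+x. Sup (range U) x \<partial>m) = (SUP i. \<integral>\<^sup>+x. U i x \<partial>m)" if "sets m = sets M" for m
    using \<open>incseq U\<close> that seq(1) unfolding Sup_apply image_image
    by (intro nn_integral_monotone_convergence_SUP) (auto cong: measurable_cong_sets)
  have inc: "incseq (\<lambda>i. \<integral>\<^sup>+x. U i x \<partial>m)" for m
    using \<open>incseq U\<close> by (auto simp: incseq_def le_fun_def intro!: nn_integral_mono)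
  have le': "(\<integral>\<^sup>+x. U i x \<partial>m) \<le> (\<integral>\<^sup>+x. Sup (range U) x \<partial>m)" for i m
    by (rule nn_integral_mono) (auto simp: Sup_apply image_image intro!: SUP_upper)
  have "(\<integral>\<^sup>+x. Sup (range U) x \<partial>a) + (\<integral>\<^sup>+x. Sup (range U) x \<partial>d) =
      (SUP i. (\<integral>\<^sup>+x. U i x \<partial>a) + (\<integral>\<^sup>+x. U i x \<partial>d))"
    using lim assms(1-5) inc by (simp add: ennreal_SUP_add)
  also have "\<dots> \<le> (\<integral>\<^sup>+x. Sup (range U) x \<partial>b) + (\<integral>\<^sup>+x. Sup (range U) x \<partial>c) + (\<integral>\<^sup>+x. Sup (range U) x \<partial>t)"
    by (intro SUP_least order_trans[OF seq.IH] add_mono le')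
  finally show ?case .
qed

text \<open>The signed measure and its negative are both bounded by the variation on every set. This
  gives two inequalities between positive measures, which pass to integrals of non-negative
  functions; the positive and negative parts of \<open>f\<close> are then treated
  separately.\<close>

lemma diff_signed_prod_integral_bound:
  assumes p: "prob_space p" "sets p = sets M" and q: "prob_space q" "sets q = sets M"
    and p': "prob_space p'" "sets p' = sets N" and q': "prob_space q'" "sets q' = sets N"
    and f [measurable]: "f \<in> borel_measurable (M \<Otimes>\<^sub>M N)" and w [measurable]: "w \<in> borel_measurable (M \<Otimes>\<^sub>M N)"
    and le: "\<And>z. z \<in> space (M \<Otimes>\<^sub>M N) \<Longrightarrow> \<bar>f z\<bar> \<le> w z"
    and int: "integrable (p \<Otimes>\<^sub>M p') f" "integrable (p \<Otimes>\<^sub>M q') f" "integrable (q \<Otimes>\<^sub>M p') f" "integrable (q \<Otimes>\<^sub>M q') f"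
  shows "ennreal \<bar>(\<integral>z. f z \<partial>(p \<Otimes>\<^sub>M p')) - (\<integral>z. f z \<partial>(p \<Otimes>\<^sub>M q')) - (\<integral>z. f z \<partial>(q \<Otimes>\<^sub>M p')) + (\<integral>z. f z \<partial>(q \<Otimes>\<^sub>M q'))\<bar>
     \<le> signed_measure_norm (M \<Otimes>\<^sub>M N) w (diff_signed_prod p q p' q')"
proof -
  define \<nu> where "\<nu> = diff_signed_prod p q p' q'"
  define T where "T = total_variation_measure (M \<Otimes>\<^sub>M N) \<nu>"
  let ?a = "p \<Otimes>\<^sub>M p'" let ?b = "p \<Otimes>\<^sub>M q'" let ?c = "q \<Otimes>\<^sub>M p'" let ?d = "q \<Otimes>\<^sub>M q'"
  have ps: "prob_space ?a" "prob_space ?b" "prob_space ?c" "prob_space ?d"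
    using p q p' q' by (auto intro: prob_space_pair)
  interpret a: prob_space ?a by fact
  interpret b: prob_space ?b by fact
  interpret c: prob_space ?c by fact
  interpret d: prob_space ?d by fact
  have st: "sets ?a = sets (M \<Otimes>\<^sub>M N)" "sets ?b = sets (M \<Otimes>\<^sub>M N)" "sets ?c = sets (M \<Otimes>\<^sub>M N)" "sets ?d = sets (M \<Otimes>\<^sub>M N)"
    using p q p' q' by (auto intro!: sets_pair_measure_cong)
  have sT [simp, measurable_cong]: "sets T = sets (M \<Otimes>\<^sub>M N)" by (simp add: T_def)
  have ca: "countably_additive_real (M \<Otimes>\<^sub>M N) \<nu>"
    unfolding \<nu>_def diff_signed_prod_def
    by (intro countably_additive_real_add countably_additive_real_diff countably_additive_real_measure
        a.finite_measure_axioms b.finite_measure_axioms c.finite_measure_axioms d.finite_measure_axioms st)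
  have ge: "ennreal \<bar>\<nu> A\<bar> \<le> emeasure T A" if "A \<in> sets (M \<Otimes>\<^sub>M N)" for A
    unfolding T_def by (rule emeasure_total_variation_measure_ge[OF ca that])
  have le1: "emeasure ?a A + emeasure ?d A \<le> emeasure ?b A + emeasure ?c A + emeasure T A"
    if A: "A \<in> sets (M \<Otimes>\<^sub>M N)" for A
  proof -
    have "emeasure ?a A + emeasure ?d A = ennreal (measure ?a A + measure ?d A)"
      by (simp add: a.emeasure_eq_measure d.emeasure_eq_measure)
    also have "\<dots> \<le> ennreal (measure ?b A + measure ?c A + \<bar>\<nu> A\<bar>)"
      by (rule ennreal_leI) (simp add: \<nu>_def diff_signed_prod_def)
    also have "\<dots> = emeasure ?b A + emeasure ?c A + ennreal \<bar>\<nu> A\<bar>"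
      by (simp add: b.emeasure_eq_measure c.emeasure_eq_measure)
    finally show ?thesis using ge[OF A] by (meson add_left_mono order_trans)
  qed
  have le2: "emeasure ?b A + emeasure ?c A \<le> emeasure ?a A + emeasure ?d A + emeasure T A"
    if A: "A \<in> sets (M \<Otimes>\<^sub>M N)" for A
  proof -
    have "emeasure ?b A + emeasure ?c A = ennreal (measure ?b A + measure ?c A)"
      by (simp add: b.emeasure_eq_measure c.emeasure_eq_measure)
    also have "\<dots> \<le> ennreal (measure ?a A + measure ?d A + \<bar>\<nu> A\<bar>)"
      by (rule ennreal_leI) (simp add: \<nu>_def diff_signed_prod_def)
    also have "\<dots> = emeasure ?a A + emeasure ?d A + ennreal \<bar>\<nu> A\<bar>"
      by (simp add: a.emeasure_eq_measure d.emeasure_eq_measure)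
    finally show ?thesis using ge[OF A] by (meson add_left_mono order_trans)
  qed
  have nn: "\<bar>(\<integral>z. g z \<partial>?a) - (\<integral>z. g z \<partial>?b) - (\<integral>z. g z \<partial>?c) + (\<integral>z. g z \<partial>?d)\<bar> \<le> enn2real (\<integral>\<^sup>+z. ennreal (g z) \<partial>T)"
    if g [measurable]: "g \<in> borel_measurable (M \<Otimes>\<^sub>M N)" and g0: "\<And>z. 0 \<le> g z"
      and i: "integrable ?a g" "integrable ?b g" "integrable ?c g" "integrable ?d g"
      and fin: "(\<integral>\<^sup>+z. ennreal (g z) \<partial>T) < \<infinity>" for g
  proof -
    note e = nn_integral_eq_integral[OF i(1)] nn_integral_eq_integral[OF i(2)]
       nn_integral_eq_integral[OF i(3)] nn_integral_eq_integral[OF i(4)]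
    obtain t where t: "(\<integral>\<^sup>+z. ennreal (g z) \<partial>T) = ennreal t" "0 \<le> t"
      using fin by (metis ennreal_cases infinity_ennreal_def less_irrefl)
    have nn: "0 \<le> (\<integral>z. g z \<partial>m)" for m :: "('a \<times> 'b) measure"
      using g0 by (intro integral_nonneg_AE) auto
    have "ennreal (\<integral>z. g z \<partial>?a) + ennreal (\<integral>z. g z \<partial>?d) \<le> ennreal (\<integral>z. g z \<partial>?b) + ennreal (\<integral>z. g z \<partial>?c) + ennreal t"
      using nn_integral_measure_add_mono[OF st(1,2,3,4) sT le1, of "\<lambda>z. ennreal (g z)"] g0 e t by simp
    then have 1: "(\<integral>z. g z \<partial>?a) + (\<integral>z. g z \<partial>?d) \<le> (\<integral>z. g z \<partial>?b) + (\<integral>z. g z \<partial>?c) + t"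
      using nn t by (simp flip: ennreal_plus)
    have "ennreal (\<integral>z. g z \<partial>?b) + ennreal (\<integral>z. g z \<partial>?c) \<le> ennreal (\<integral>z. g z \<partial>?a) + ennreal (\<integral>z. g z \<partial>?d) + ennreal t"
      using nn_integral_measure_add_mono[OF st(2,1,4,3) sT le2, of "\<lambda>z. ennreal (g z)"] g0 e t by simp
    then have 2: "(\<integral>z. g z \<partial>?b) + (\<integral>z. g z \<partial>?c) \<le> (\<integral>z. g z \<partial>?a) + (\<integral>z. g z \<partial>?d) + t"
      using nn t by (simp flip: ennreal_plus)
    show ?thesis using 1 2 t by simp
  qed
  have sp: "space T = space (M \<Otimes>\<^sub>M N)" using sT by (rule sets_eq_imp_space_eq)
  \<comment> \<open>The variation integrals of the two parts add up to that of the absolute value,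
    so splitting \<open>f\<close> costs no factor 2.\<close>
  have tot: "(\<integral>\<^sup>+z. ennreal (max 0 (f z)) \<partial>T) + (\<integral>\<^sup>+z. ennreal (max 0 (- f z)) \<partial>T) \<le> (\<integral>\<^sup>+z. ennreal (w z) \<partial>T)"
  proof -
    have "(\<integral>\<^sup>+z. ennreal (max 0 (f z)) \<partial>T) + (\<integral>\<^sup>+z. ennreal (max 0 (- f z)) \<partial>T)
       = (\<integral>\<^sup>+z. ennreal (max 0 (f z)) + ennreal (max 0 (- f z)) \<partial>T)"
      by (rule nn_integral_add[symmetric]) auto
    also have "\<dots> = (\<integral>\<^sup>+z. ennreal \<bar>f z\<bar> \<partial>T)"
      by (intro nn_integral_cong) (auto simp: max_def abs_if simp flip: ennreal_plus)
    also have "\<dots> \<le> (\<integral>\<^sup>+z. ennreal (w z) \<partial>T)"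
      using le sp by (intro nn_integral_mono ennreal_leI) auto
    finally show ?thesis .
  qed
  show ?thesis
  proof (cases "(\<integral>\<^sup>+z. ennreal (w z) \<partial>T) = \<infinity>")
    case True
    then show ?thesis unfolding signed_measure_norm_def T_def \<nu>_def by simp
  next
    case False
    define tp tm where "tp = (\<integral>\<^sup>+z. ennreal (max 0 (f z)) \<partial>T)" "tm = (\<integral>\<^sup>+z. ennreal (max 0 (- f z)) \<partial>T)"
    have lt: "(\<integral>\<^sup>+z. ennreal (w z) \<partial>T) < \<infinity>" using False by (simp add: less_top)
    have "tp + tm < \<infinity>"
      using le_less_trans[OF tot lt] by (simp add: tp_tm_def)
    then have fin: "tp < \<infinity>" "tm < \<infinity>" by auto
    have d: "(\<integral>z. f z \<partial>m) = (\<integral>z. max 0 (f z) \<partial>m) - (\<integral>z. max 0 (- f z) \<partial>m)" if "integrable m f" for m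
    proof -
      have "(\<integral>z. max 0 (f z) \<partial>m) - (\<integral>z. max 0 (- f z) \<partial>m) = (\<integral>z. max 0 (f z) - max 0 (- f z) \<partial>m)"
        using that by (intro Bochner_Integration.integral_diff[symmetric]) auto
      also have "\<dots> = (\<integral>z. f z \<partial>m)" by (intro Bochner_Integration.integral_cong) auto
      finally show ?thesis by simp
    qed
    have "\<bar>(\<integral>z. max 0 (f z) \<partial>?a) - (\<integral>z. max 0 (f z) \<partial>?b) - (\<integral>z. max 0 (f z) \<partial>?c) + (\<integral>z. max 0 (f z) \<partial>?d)\<bar> \<le> enn2real tp"
      unfolding tp_tm_def(1) by (rule nn) (use int fin in \<open>auto simp: tp_tm_def\<close>)
    moreover have "\<bar>(\<integral>z. max 0 (- f z) \<partial>?a) - (\<integral>z. max 0 (- f z) \<partial>?b) - (\<integral>z. max 0 (- f z) \<partial>?c) + (\<integral>z. max 0 (- f z) \<partial>?d)\<bar> \<le> enn2real tm"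
      unfolding tp_tm_def(2) by (rule nn) (use int fin in \<open>auto simp: tp_tm_def\<close>)
    ultimately have "\<bar>(\<integral>z. f z \<partial>?a) - (\<integral>z. f z \<partial>?b) - (\<integral>z. f z \<partial>?c) + (\<integral>z. f z \<partial>?d)\<bar> \<le> enn2real tp + enn2real tm"
      unfolding d[OF int(1)] d[OF int(2)] d[OF int(3)] d[OF int(4)] by linarith
    then have "ennreal \<bar>(\<integral>z. f z \<partial>?a) - (\<integral>z. f z \<partial>?b) - (\<integral>z. f z \<partial>?c) + (\<integral>z. f z \<partial>?d)\<bar> \<le> ennreal (enn2real tp + enn2real tm)"
      by (rule ennreal_leI)
    also have "\<dots> = tp + tm" using fin by simp
    also have "\<dots> \<le> (\<integral>\<^sup>+z. ennreal (w z) \<partial>T)" using tot by (simp add: tp_tm_def)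
    finally show ?thesis by (simp add: signed_measure_norm_def T_def \<nu>_def)
  qed
qed

section \<open>Markov kernels\<close>

text \<open>Positive and negative parts reduce the claim to the non-negative integral. Integrability
  under the mixture passes to \<open>N x\<close> for almost every \<open>x\<close> only; the values
  of the inner Bochner integral on the exceptional null set do not affect the outer one.\<close>

lemma integral_bind_prob_algebra:
  fixes f :: "'b \<Rightarrow> real"
  assumes N [measurable]: "N \<in> m \<rightarrow>\<^sub>M prob_algebra B" and int: "integrable (m \<bind> N) f"
    and f [measurable]: "f \<in> borel_measurable B"
  shows "(\<integral>y. f y \<partial>(m \<bind> N)) = (\<integral>x. (\<integral>y. f y \<partial>N x) \<partial>m)"
proof -
  have Ns [measurable]: "N \<in> m \<rightarrow>\<^sub>M subprob_algebra B" by (rule measurable_prob_algebraD[OF N])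
  have setsN: "sets (N x) = sets B" if "x \<in> space m" for x
    by (rule sets_kernel[OF Ns that])
  have key: "(\<integral>y. g y \<partial>(m \<bind> N)) = (\<integral>x. (\<integral>y. g y \<partial>N x) \<partial>m) \<and> integrable m (\<lambda>x. \<integral>y. g y \<partial>N x)
      \<and> (AE x in m. integrable (N x) g)"
    if g [measurable]: "g \<in> borel_measurable B" and g0: "\<And>y. 0 \<le> g y" and gi: "integrable (m \<bind> N) g" for g :: "'b \<Rightarrow> real"
  proof -
    have e: "(\<integral>\<^sup>+x. (\<integral>\<^sup>+y. ennreal (g y) \<partial>N x) \<partial>m) = ennreal (\<integral>y. g y \<partial>(m \<bind> N))"
      using nn_integral_bind[OF _ Ns, of "\<lambda>y. ennreal (g y)"] nn_integral_eq_integral[OF gi] g0 by simp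
    have "AE x in m. (\<integral>\<^sup>+y. ennreal (g y) \<partial>N x) \<noteq> \<infinity>"
      by (rule nn_integral_PInf_AE) (auto simp: e)
    then have ae: "AE x in m. integrable (N x) g"
    proof (rule AE_mp, intro AE_I2 impI)
      fix x assume x: "x \<in> space m" and "(\<integral>\<^sup>+y. ennreal (g y) \<partial>N x) \<noteq> \<infinity>"
      then show "integrable (N x) g"
        using g0 setsN[OF x] g by (intro integrableI_nonneg) (auto simp: less_top cong: measurable_cong_sets)
    qed
    have "(\<integral>\<^sup>+x. ennreal (\<integral>y. g y \<partial>N x) \<partial>m) = (\<integral>\<^sup>+x. (\<integral>\<^sup>+y. ennreal (g y) \<partial>N x) \<partial>m)"
      by (rule nn_integral_cong_AE, rule AE_mp[OF ae]) (auto simp: nn_integral_eq_integral g0)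
    then have "has_bochner_integral m (\<lambda>x. \<integral>y. g y \<partial>N x) (\<integral>y. g y \<partial>(m \<bind> N))"
      using g0 e by (intro has_bochner_integral_nn_integral) auto
    then show ?thesis using ae by (auto simp: has_bochner_integral_iff)
  qed
  have ip: "integrable (m \<bind> N) (\<lambda>y. max 0 (f y))" and im: "integrable (m \<bind> N) (\<lambda>y. max 0 (- f y))"
    using int by auto
  note p = key[OF _ _ ip, simplified] and m = key[OF _ _ im, simplified]
  have dec: "(\<integral>y. f y \<partial>m') = (\<integral>y. max 0 (f y) \<partial>m') - (\<integral>y. max 0 (- f y) \<partial>m')"
    if "integrable m' (\<lambda>y. max 0 (f y))" "integrable m' (\<lambda>y. max 0 (- f y))" for m'
  proof -
    have "(\<integral>y. max 0 (f y) \<partial>m') - (\<integral>y. max 0 (- f y) \<partial>m') = (\<integral>y. max 0 (f y) - max 0 (- f y) \<partial>m')"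
      using that by (rule Bochner_Integration.integral_diff[symmetric])
    also have "\<dots> = (\<integral>y. f y \<partial>m')" by (intro Bochner_Integration.integral_cong) auto
    finally show ?thesis by simp
  qed
  have "AE x in m. (\<integral>y. f y \<partial>N x) = (\<integral>y. max 0 (f y) \<partial>N x) - (\<integral>y. max 0 (- f y) \<partial>N x)"
    using p m by (auto intro: dec elim!: AE_mp)
  then have "(\<integral>x. (\<integral>y. f y \<partial>N x) \<partial>m) = (\<integral>x. (\<integral>y. max 0 (f y) \<partial>N x) - (\<integral>y. max 0 (- f y) \<partial>N x) \<partial>m)"
    by (intro integral_cong_AE) measurable
  also have "\<dots> = (\<integral>x. (\<integral>y. max 0 (f y) \<partial>N x) \<partial>m) - (\<integral>x. (\<integral>y. max 0 (- f y) \<partial>N x) \<partial>m)"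
    using p m by (intro Bochner_Integration.integral_diff) auto
  also have "\<dots> = (\<integral>y. f y \<partial>(m \<bind> N))"
    using p m by (simp add: dec[OF ip im])
  finally show ?thesis by simp
qed

text \<open>A measurable function is constant on such an atom \<open>A\<close>, and \<open>\<bar>\<delta>\<^sub>x - \<mu>\<bar>\<close> charges it with mass
  \<open>1 - \<mu> A\<close>; this makes weighted integrability hold at every \<open>x\<close> and not just almost everywhere.\<close>

lemma countably_generated_atom:
  assumes "countably_generated_space M" and x: "x \<in> space M"
  obtains A where "A \<in> sets M" "x \<in> A" "\<And>B. B \<in> sets M \<Longrightarrow> x \<in> B \<Longrightarrow> A \<subseteq> B"
proof -
  obtain G where G: "countable G" "G \<subseteq> Pow (space M)" "sets M = sigma_sets (space M) G"
    using assms unfolding countably_generated_space_def by blast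
  \<comment> \<open>This is the intersection, over the generators, of whichever of \<open>g\<close>
    and its complement contains \<open>x\<close>; countability of \<open>G\<close> makes it
    measurable.\<close>
  define A where "A = space M - (\<Union>g\<in>G. if x \<in> g then space M - g else g)"
  have "g \<in> sets M" if "g \<in> G" for g using G that by auto
  then have "(if x \<in> g then space M - g else g) \<in> sets M" if "g \<in> G" for g using that by auto
  then have A: "A \<in> sets M"
    unfolding A_def using G(1) by (intro sets.Diff sets.top sets.countable_UN') (blast | assumption)+
  have xA: "x \<in> A" using x by (auto simp: A_def)
  \<comment> \<open>The sets that either contain \<open>A\<close> or miss it are stable under
    complement and countable union, and include the generators by construction.\<close>
  have "A \<subseteq> B \<or> A \<inter> B = {}" if "B \<in> sigma_sets (space M) G" for B
    using that
  proof (induction B)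
    case (Basic a)
    then show ?case by (auto simp: A_def split: if_splits)
  next
    case (Compl a)
    moreover have "A \<subseteq> space M" by (auto simp: A_def)
    ultimately show ?case by blast
  qed blast+
  then show thesis using that[OF A xA] xA G(3) by blast
qed

locale markov_kernel =
  fixes M :: "'a measure" and P :: "'a \<Rightarrow> 'a measure" and \<mu> :: "'a measure"
  assumes P [measurable]: "P \<in> M \<rightarrow>\<^sub>M prob_algebra M"
    and inv: "invariant_distribution M P \<mu>"
begin

abbreviation "K \<equiv> kernel_power M P"

lemma K_measurable [measurable]: "K n \<in> M \<rightarrow>\<^sub>M prob_algebra M"
  by (induction n) (auto intro: measurable_bind_prob_space)

lemma K_measurable_subprob [measurable]: "K n \<in> M \<rightarrow>\<^sub>M subprob_algebra M"
  by (rule measurable_prob_algebraD) measurable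

lemma P_measurable_subprob [measurable]: "P \<in> M \<rightarrow>\<^sub>M subprob_algebra M"
  by (rule measurable_prob_algebraD) measurable

lemma prob_K: "x \<in> space M \<Longrightarrow> prob_space (K n x)"
  using measurable_space[OF K_measurable] by (auto simp: space_prob_algebra)

lemma sets_K [simp]: "x \<in> space M \<Longrightarrow> sets (K n x) = sets M"
  using measurable_space[OF K_measurable] by (auto simp: space_prob_algebra)

lemma space_K [simp]: "x \<in> space M \<Longrightarrow> space (K n x) = space M"
  by (rule sets_eq_imp_space_eq) simp

lemma prob_P: "x \<in> space M \<Longrightarrow> prob_space (P x)"
  using measurable_space[OF P] by (auto simp: space_prob_algebra)

lemma sets_P [simp]: "x \<in> space M \<Longrightarrow> sets (P x) = sets M"
  using measurable_space[OF P] by (auto simp: space_prob_algebra)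

lemma space_P [simp]: "x \<in> space M \<Longrightarrow> space (P x) = space M"
  by (rule sets_eq_imp_space_eq) simp

lemma prob_mu: "prob_space \<mu>" and sets_mu [simp, measurable_cong]: "sets \<mu> = sets M" and mu_P: "\<mu> \<bind> P = \<mu>"
  using inv by (auto simp: invariant_distribution_def space_prob_algebra)

lemma space_mu [simp]: "space \<mu> = space M"
  by (rule sets_eq_imp_space_eq) simp

lemma K_1: "x \<in> space M \<Longrightarrow> K (Suc 0) x = P x"
  by (simp add: bind_return'')

lemma K_add: "x \<in> space M \<Longrightarrow> K (m + n) x = K m x \<bind> K n"
proof (induction m arbitrary: x)
  case 0
  then show ?case by (simp add: bind_return[where N=M])
next
  case (Suc m)
  have "P x \<bind> K (m + n) = P x \<bind> (\<lambda>y. K m y \<bind> K n)"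
    using Suc by (intro bind_cong) auto
  also have "\<dots> = P x \<bind> K m \<bind> K n"
    using Suc by (intro bind_assoc[where N=M and R=M, symmetric]) (auto cong: measurable_cong_sets)
  finally show ?case by simp
qed

lemma K_Suc: "x \<in> space M \<Longrightarrow> K (Suc m) x = K m x \<bind> P"
  using K_add[of x m "Suc 0"] bind_cong[of "K m x" "K m x" "K (Suc 0)" P] K_1 by (simp del: kernel_power.simps)

lemma mu_K: "\<mu> \<bind> K n = \<mu>"
proof (induction n)
  case (Suc n)
  have "\<mu> \<bind> K (Suc n) = \<mu> \<bind> P \<bind> K n"
    unfolding kernel_power.simps by (rule bind_assoc[where N=M and R=M, symmetric]) measurable
  then show ?case using Suc by (simp add: mu_P)
qed (simp add: bind_return'')

lemma nn_integral_K_Suc: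
  assumes "x \<in> space M" and [measurable]: "f \<in> borel_measurable M"
  shows "(\<integral>\<^sup>+z. f z \<partial>K (Suc m) x) = (\<integral>\<^sup>+y. (\<integral>\<^sup>+z. f z \<partial>P y) \<partial>K m x)"
  unfolding K_Suc[OF assms(1)]
  using assms by (intro nn_integral_bind[where B=M]) (auto cong: measurable_cong_sets)

lemma nn_integral_mu_P:
  assumes [measurable]: "f \<in> borel_measurable M"
  shows "(\<integral>\<^sup>+y. (\<integral>\<^sup>+z. f z \<partial>P y) \<partial>\<mu>) = (\<integral>\<^sup>+z. f z \<partial>\<mu>)"
  by (subst (2) mu_P[symmetric], rule nn_integral_bind[where B=M, symmetric]) auto

lemma integral_K_add:
  fixes f :: "'a \<Rightarrow> real"
  assumes "x \<in> space M" "f \<in> borel_measurable M" "integrable (K (m + n) x) f"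
  shows "(\<integral>z. f z \<partial>K (m + n) x) = (\<integral>y. (\<integral>z. f z \<partial>K n y) \<partial>K m x)"
  using assms unfolding K_add[OF assms(1)]
  by (intro integral_bind_prob_algebra[where B=M]) (auto cong: measurable_cong_sets)

lemma integral_K_Suc:
  fixes f :: "'a \<Rightarrow> real"
  assumes "x \<in> space M" "f \<in> borel_measurable M" "integrable (K (Suc m) x) f"
  shows "(\<integral>z. f z \<partial>K (Suc m) x) = (\<integral>y. (\<integral>z. f z \<partial>P y) \<partial>K m x)"
  using assms unfolding K_Suc[OF assms(1)]
  by (intro integral_bind_prob_algebra[where B=M]) (auto cong: measurable_cong_sets)

lemma integral_K_Suc':
  fixes f :: "'a \<Rightarrow> real"
  assumes "x \<in> space M" "f \<in> borel_measurable M" "integrable (K (Suc m) x) f"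
  shows "(\<integral>z. f z \<partial>K (Suc m) x) = (\<integral>y. (\<integral>z. f z \<partial>K m y) \<partial>P x)"
  using assms unfolding kernel_power.simps
  by (intro integral_bind_prob_algebra[where B=M]) (auto cong: measurable_cong_sets)

lemma integral_mu_P:
  fixes f :: "'a \<Rightarrow> real"
  assumes "f \<in> borel_measurable M" "integrable \<mu> f"
  shows "(\<integral>y. (\<integral>z. f z \<partial>P y) \<partial>\<mu>) = (\<integral>z. f z \<partial>\<mu>)"
  using integral_bind_prob_algebra[of P \<mu> M f] assms by (simp add: mu_P)

end

section \<open>Integrability of the weight\<close>

locale product_ergodic_kernel = markov_kernel +
  fixes V W :: "'a \<times> 'a \<Rightarrow> real" and c c' :: real
  assumes cg: "countably_generated_space M"
    and V [measurable]: "V \<in> borel_measurable (M \<Otimes>\<^sub>M M)" and W [measurable]: "W \<in> borel_measurable (M \<Otimes>\<^sub>M M)"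
    and V_sym: "x \<in> space M \<Longrightarrow> y \<in> space M \<Longrightarrow> V (x, y) = V (y, x)"
    and V_ge_1: "x \<in> space M \<Longrightarrow> y \<in> space M \<Longrightarrow> 1 \<le> V (x, y)"
    and V_le_W: "x \<in> space M \<Longrightarrow> y \<in> space M \<Longrightarrow> V (x, y) \<le> W (x, y)"
    and c_ge_1: "1 \<le> c"
    and C2: "x \<in> space M \<Longrightarrow> y \<in> space M \<Longrightarrow>
        (\<Sum>k. \<Sum>i. signed_measure_norm (M \<Otimes>\<^sub>M M) V (diff_signed_prod (kernel_power M P k x) \<mu> (kernel_power M P i y) \<mu>))
        \<le> ennreal (c * W (x, y))"
    and PV: "x \<in> space M \<Longrightarrow> y \<in> space M \<Longrightarrow> (\<integral>\<^sup>+z. ennreal (V (z, y)) \<partial>P x) \<le> ennreal (c' * V (x, y))"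
begin

lemma norm_finite:
  assumes "x \<in> space M" "y \<in> space M"
  shows "signed_measure_norm (M \<Otimes>\<^sub>M M) V (diff_signed_prod (K k x) \<mu> (K i y) \<mu>) < \<infinity>"
proof -
  let ?n = "\<lambda>k i. signed_measure_norm (M \<Otimes>\<^sub>M M) V (diff_signed_prod (K k x) \<mu> (K i y) \<mu>)"
  have "?n k i \<le> (\<Sum>i. ?n k i)"
    using sum_le_suminf[of "?n k" "{i}"] by simp
  also have "\<dots> \<le> (\<Sum>k. \<Sum>i. ?n k i)"
    using sum_le_suminf[of "\<lambda>k. \<Sum>i. ?n k i" "{k}"] by simp
  finally have "?n k i \<le> ennreal (c * W (x, y))" using C2[OF assms] by (rule order_trans)
  then show ?thesis by (rule le_less_trans) simp
qed

text \<open>For \<open>k = i = 0\<close> the mixing condition bounds the norm of the product of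
  delta_x - mu with itself. On \<open>A\<close> times a subset of the complement this product is -(1
  - mu A) times mu of that subset; on the square of the complement it is the product of mu with
  itself, because delta_x vanishes there. On these regions the variation therefore dominates a
  multiple of mu, respectively mu times mu.\<close>

lemma nn_integral_V_finite_of_atom:
  assumes x: "x \<in> space M" and A: "A \<in> sets M" "x \<in> A" "\<And>B. B \<in> sets M \<Longrightarrow> x \<in> B \<Longrightarrow> A \<subseteq> B"
  shows "(\<integral>\<^sup>+w. ennreal (V (x, w)) * indicator (space M - A) w \<partial>\<mu>) < \<infinity>"
    and "(\<integral>\<^sup>+z. ennreal (V z) * indicator ((space M - A) \<times> (space M - A)) z \<partial>(\<mu> \<Otimes>\<^sub>M \<mu>)) < \<infinity>"
proof -
  interpret mu: prob_space \<mu> by (rule prob_mu)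
  interpret mm: pair_prob_space \<mu> \<mu> ..
  let ?r = "return M x"
  interpret r: prob_space ?r by (rule prob_space_return[OF x])
  interpret rr: pair_prob_space ?r ?r ..
  interpret rm: pair_prob_space ?r \<mu> ..
  interpret mr: pair_prob_space \<mu> ?r ..
  define \<nu> where "\<nu> = diff_signed_prod ?r \<mu> ?r \<mu>"
  define T where "T = total_variation_measure (M \<Otimes>\<^sub>M M) \<nu>"
  let ?B = "space M - A"
  have B [measurable]: "?B \<in> sets M" using A by auto
  note [measurable] = A(1)
  have sT [simp, measurable_cong]: "sets T = sets (M \<Otimes>\<^sub>M M)" by (simp add: T_def)
  have spT: "space T = space (M \<Otimes>\<^sub>M M)" using sT by (rule sets_eq_imp_space_eq)
  have st [measurable_cong]: "sets (?r \<Otimes>\<^sub>M ?r) = sets (M \<Otimes>\<^sub>M M)" "sets (?r \<Otimes>\<^sub>M \<mu>) = sets (M \<Otimes>\<^sub>M M)"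
    "sets (\<mu> \<Otimes>\<^sub>M ?r) = sets (M \<Otimes>\<^sub>M M)" "sets (\<mu> \<Otimes>\<^sub>M \<mu>) = sets (M \<Otimes>\<^sub>M M)"
    by (auto intro!: sets_pair_measure_cong)
  have ca: "countably_additive_real (M \<Otimes>\<^sub>M M) \<nu>"
    unfolding \<nu>_def diff_signed_prod_def
    by (intro countably_additive_real_add countably_additive_real_diff countably_additive_real_measure
        rr.finite_measure_axioms rm.finite_measure_axioms mr.finite_measure_axioms mm.finite_measure_axioms st)
  have ge: "ennreal \<bar>\<nu> E\<bar> \<le> emeasure T E" if "E \<in> sets (M \<Otimes>\<^sub>M M)" for E
    unfolding T_def by (rule emeasure_total_variation_measure_ge[OF ca that])
  have fin: "(\<integral>\<^sup>+z. ennreal (V z) \<partial>T) < \<infinity>"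
    using norm_finite[OF x x, of 0 0] unfolding signed_measure_norm_def T_def \<nu>_def by simp
  have m_times: "measure (p \<Otimes>\<^sub>M q) (C \<times> D) = measure p C * measure q D"
    if "prob_space q" "C \<in> sets p" "D \<in> sets q" for p q :: "'a measure" and C D
  proof -
    interpret prob_space q by fact
    show ?thesis using that by (simp add: measure_def emeasure_pair_measure_Times enn2real_mult)
  qed
  have const: "g z = g x" if g: "g \<in> borel_measurable M" and "z \<in> A" for g :: "'a \<Rightarrow> real" and z
  proof -
    have "{w \<in> space M. g w = g x} \<in> sets M" using g by measurable
    then show ?thesis using A(3)[of "{w \<in> space M. g w = g x}"] x that by auto
  qed
  have Aspace: "A \<subseteq> space M" using A(1) by (rule sets.sets_into_space)
  have xB: "x \<notin> ?B" using A by simp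
  show "(\<integral>\<^sup>+w. ennreal (V (x, w)) * indicator ?B w \<partial>\<mu>) < \<infinity>"
  \<comment> \<open>If mu A = 1 the factor 1 - mu A gives no information, but then the complement of
    the atom is a null set.\<close>
  proof (cases "measure \<mu> A = 1")
    case True
    then have "AE w in \<mu>. w \<in> A" using A by (simp add: mu.prob_eq_1)
    then have "(\<integral>\<^sup>+w. ennreal (V (x, w)) * indicator ?B w \<partial>\<mu>) = (\<integral>\<^sup>+w. 0 \<partial>\<mu>)"
      by (intro nn_integral_cong_AE) (auto elim!: AE_mp)
    then show ?thesis by simp
  next
    case False
    define \<alpha> where "\<alpha> = 1 - measure \<mu> A"
    have \<alpha>: "0 < \<alpha>" using False mu.prob_le_1[of A] unfolding \<alpha>_def by linarith
    \<comment> \<open>\<open>T'\<close> is the second marginal of the variation restricted to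
      \<open>A\<close> times the complement, and it dominates \<open>m'\<close>. Passing to the
      marginal loses nothing because \<open>V\<close> does not depend on its first argument inside
      \<open>A\<close>.\<close>
    define T' where "T' = distr (density T (indicator (A \<times> ?B))) M snd"
    define m' where "m' = density \<mu> (\<lambda>w. ennreal \<alpha> * indicator ?B w)"
    have le: "emeasure m' C + emeasure (null_measure M) C \<le> emeasure (null_measure M) C + emeasure (null_measure M) C + emeasure T' C"
      if C: "C \<in> sets M" for C
    proof -
      have "emeasure m' C = ennreal \<alpha> * emeasure \<mu> (?B \<inter> C)"
      proof -
        have "emeasure m' C = (\<integral>\<^sup>+w. ennreal \<alpha> * indicator (?B \<inter> C) w \<partial>\<mu>)"
          unfolding m'_def using C
          by (subst emeasure_density) (auto intro!: nn_integral_cong split: split_indicator)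
        also have "\<dots> = ennreal \<alpha> * emeasure \<mu> (?B \<inter> C)"
          using C by (intro nn_integral_cmult_indicator) auto
        finally show ?thesis .
      qed
      also have "\<dots> = ennreal \<bar>\<nu> (A \<times> (?B \<inter> C))\<bar>"
      proof -
        have i: "indicator (?B \<inter> C) x = (0::real)" using xB by (auto split: split_indicator)
        have "\<nu> (A \<times> (?B \<inter> C)) = - (\<alpha> * measure \<mu> (?B \<inter> C))"
          unfolding \<nu>_def diff_signed_prod_def
          using C A by (simp add: m_times prob_mu r.prob_space_axioms measure_return i algebra_simps \<alpha>_def)
        then show ?thesis using \<alpha> by (simp add: mu.emeasure_eq_measure abs_mult ennreal_mult)
      qed
      also have "\<dots> \<le> emeasure T (A \<times> (?B \<inter> C))" using C by (intro ge) auto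
      also have "\<dots> = emeasure T' C"
      proof -
        have "emeasure T' C = emeasure (density T (indicator (A \<times> ?B))) (snd -` C \<inter> space (M \<Otimes>\<^sub>M M))"
          unfolding T'_def using C by (subst emeasure_distr) (auto simp: spT cong: measurable_cong_sets)
        also have "\<dots> = (\<integral>\<^sup>+z. indicator (A \<times> ?B) z * indicator (snd -` C \<inter> space (M \<Otimes>\<^sub>M M)) z \<partial>T)"
          using C measurable_sets[OF measurable_snd[of M M] C] by (subst emeasure_density) auto
        also have "\<dots> = (\<integral>\<^sup>+z. indicator (A \<times> (?B \<inter> C)) z \<partial>T)"
          using Aspace by (intro nn_integral_cong) (auto simp: space_pair_measure split: split_indicator)
        finally show ?thesis using C by simp
      qed
      finally show ?thesis by simp
    qed
    have "ennreal \<alpha> * (\<integral>\<^sup>+w. ennreal (V (x, w)) * indicator ?B w \<partial>\<mu>) = (\<integral>\<^sup>+w. ennreal (V (x, w)) \<partial>m')"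
    proof -
      have "(\<integral>\<^sup>+w. ennreal (V (x, w)) \<partial>m') = (\<integral>\<^sup>+w. (ennreal \<alpha> * indicator ?B w) * ennreal (V (x, w)) \<partial>\<mu>)"
        unfolding m'_def using x by (subst nn_integral_density) auto
      then show ?thesis using x by (simp add: nn_integral_cmult[symmetric] ac_simps)
    qed
    also have "\<dots> \<le> (\<integral>\<^sup>+w. ennreal (V (x, w)) \<partial>T')"
      using nn_integral_measure_add_mono[OF _ _ _ _ _ le, where f="\<lambda>w. ennreal (V (x, w))"] x
      by (simp add: m'_def T'_def)
    also have "\<dots> = (\<integral>\<^sup>+z. indicator (A \<times> ?B) z * ennreal (V (x, snd z)) \<partial>T)"
      unfolding T'_def using x
      by (subst nn_integral_distr, simp_all cong: measurable_cong_sets) (subst nn_integral_density, auto cong: measurable_cong_sets)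
    also have "\<dots> \<le> (\<integral>\<^sup>+z. ennreal (V z) \<partial>T)"
    proof (rule nn_integral_mono)
      fix z assume "z \<in> space T"
      then have z: "fst z \<in> space M" "snd z \<in> space M" by (auto simp: spT space_pair_measure)
      have "V (fst z, snd z) = V (x, snd z)" if "fst z \<in> A"
        using const[of "\<lambda>u. V (u, snd z)" "fst z"] that z by simp
      then show "indicator (A \<times> ?B) z * ennreal (V (x, snd z)) \<le> ennreal (V z)"
        by (cases z) (auto split: split_indicator)
    qed
    finally have *: "ennreal \<alpha> * (\<integral>\<^sup>+w. ennreal (V (x, w)) * indicator ?B w \<partial>\<mu>) < \<infinity>"
      using fin by (rule le_less_trans)
    show ?thesis
    proof (rule ccontr)
      assume "\<not> ?thesis"
      then have "(\<integral>\<^sup>+w. ennreal (V (x, w)) * indicator ?B w \<partial>\<mu>) = top" by (metis top.not_eq_extremum infinity_ennreal_def)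
      then show False using * \<alpha> by (simp add: ennreal_mult_top)
    qed
  qed
  show "(\<integral>\<^sup>+z. ennreal (V z) * indicator (?B \<times> ?B) z \<partial>(\<mu> \<Otimes>\<^sub>M \<mu>)) < \<infinity>"
  proof -
    define N where "N = density (\<mu> \<Otimes>\<^sub>M \<mu>) (indicator (?B \<times> ?B))"
    have le: "emeasure N E + emeasure (null_measure (M \<Otimes>\<^sub>M M)) E \<le>
        emeasure (null_measure (M \<Otimes>\<^sub>M M)) E + emeasure (null_measure (M \<Otimes>\<^sub>M M)) E + emeasure T E"
      if E: "E \<in> sets (M \<Otimes>\<^sub>M M)" for E
    proof -
      let ?E = "E \<inter> ?B \<times> ?B"
      have E' [measurable]: "?E \<in> sets (M \<Otimes>\<^sub>M M)" using E by auto
      have "emeasure N E = emeasure (\<mu> \<Otimes>\<^sub>M \<mu>) ?E"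
      proof -
        have "emeasure N E = (\<integral>\<^sup>+z. indicator (?B \<times> ?B) z * indicator E z \<partial>(\<mu> \<Otimes>\<^sub>M \<mu>))"
          unfolding N_def using E st by (intro emeasure_density) (auto cong: measurable_cong_sets)
        also have "\<dots> = (\<integral>\<^sup>+z. indicator ?E z \<partial>(\<mu> \<Otimes>\<^sub>M \<mu>))"
          by (intro nn_integral_cong) (auto split: split_indicator)
        also have "\<dots> = emeasure (\<mu> \<Otimes>\<^sub>M \<mu>) ?E" using st E' by (intro nn_integral_indicator) auto
        finally show ?thesis .
      qed
      also have "\<dots> = ennreal \<bar>\<nu> ?E\<bar>"
      proof -
        have z1: "measure (?r \<Otimes>\<^sub>M ?r) ?E = 0"
        proof -
          have "measure (?r \<Otimes>\<^sub>M ?r) ?E \<le> measure (?r \<Otimes>\<^sub>M ?r) (?B \<times> ?B)"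
            using E st by (intro rr.finite_measure_mono) auto
          also have "\<dots> = 0" using xB by (simp add: m_times r.prob_space_axioms measure_return)
          finally show ?thesis by (simp add: measure_le_0_iff)
        qed
        have z2: "measure (?r \<Otimes>\<^sub>M \<mu>) ?E = 0"
        proof -
          have "measure (?r \<Otimes>\<^sub>M \<mu>) ?E \<le> measure (?r \<Otimes>\<^sub>M \<mu>) (?B \<times> ?B)"
            using E st by (intro rm.finite_measure_mono) auto
          also have "\<dots> = 0" using xB by (simp add: m_times prob_mu measure_return)
          finally show ?thesis by (simp add: measure_le_0_iff)
        qed
        have z3: "measure (\<mu> \<Otimes>\<^sub>M ?r) ?E = 0"
        proof -
          have "measure (\<mu> \<Otimes>\<^sub>M ?r) ?E \<le> measure (\<mu> \<Otimes>\<^sub>M ?r) (?B \<times> ?B)"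
            using E st by (intro mr.finite_measure_mono) auto
          also have "\<dots> = 0" using xB by (simp add: m_times r.prob_space_axioms measure_return)
          finally show ?thesis by (simp add: measure_le_0_iff)
        qed
        show ?thesis unfolding \<nu>_def diff_signed_prod_def z1 z2 z3
          by (simp add: mm.emeasure_eq_measure)
      qed
      also have "\<dots> \<le> emeasure T ?E" by (rule ge[OF E'])
      also have "\<dots> \<le> emeasure T E" using E by (intro emeasure_mono) auto
      finally show ?thesis by simp
    qed
    have "(\<integral>\<^sup>+z. ennreal (V z) * indicator (?B \<times> ?B) z \<partial>(\<mu> \<Otimes>\<^sub>M \<mu>)) = (\<integral>\<^sup>+z. ennreal (V z) \<partial>N)"
      unfolding N_def by (subst nn_integral_density) (auto simp: ac_simps)
    also have "\<dots> \<le> (\<integral>\<^sup>+z. ennreal (V z) \<partial>T)"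
      using nn_integral_measure_add_mono[OF _ _ _ _ _ le, where f="\<lambda>z. ennreal (V z)"]
      by (simp add: N_def st)
    finally show ?thesis using fin by (rule le_less_trans)
  qed
qed

end

context product_ergodic_kernel
begin

lemma space_not_empty: "space M \<noteq> {}"
  using prob_space.not_empty[OF prob_mu] by simp

lemma nn_integral_V_mu_finite:
  assumes x: "x \<in> space M"
  shows "(\<integral>\<^sup>+w. ennreal (V (x, w)) \<partial>\<mu>) < \<infinity>"
proof -
  interpret mu: prob_space \<mu> by (rule prob_mu)
  obtain A where A: "A \<in> sets M" "x \<in> A" "\<And>B. B \<in> sets M \<Longrightarrow> x \<in> B \<Longrightarrow> A \<subseteq> B"
    using countably_generated_atom[OF cg x] by blast
  note [measurable] = A(1) x
  have sec: "V (x, w) = V (x, x)" if "w \<in> A" for w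
  proof -
    have "{w \<in> space M. V (x, w) = V (x, x)} \<in> sets M" by measurable
    then show ?thesis using A(3)[of "{w \<in> space M. V (x, w) = V (x, x)}"] x that by auto
  qed
  have "(\<integral>\<^sup>+w. ennreal (V (x, w)) \<partial>\<mu>) \<le>
      (\<integral>\<^sup>+w. ennreal (V (x, w)) * indicator (space M - A) w + ennreal (V (x, x)) \<partial>\<mu>)"
    using sec by (intro nn_integral_mono) (auto split: split_indicator)
  also have "\<dots> = (\<integral>\<^sup>+w. ennreal (V (x, w)) * indicator (space M - A) w \<partial>\<mu>) + ennreal (V (x, x))"
    using mu.emeasure_space_1 by (subst nn_integral_add) simp_all
  also have "\<dots> < \<infinity>"
    using nn_integral_V_finite_of_atom(1)[OF x A]
    unfolding infinity_ennreal_def ennreal_add_less_top by (intro conjI ennreal_less_top)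
  finally show ?thesis .
qed

text \<open>One atom suffices. When either argument lies in \<open>A\<close>, constancy on the atom
  and symmetry reduce \<open>V\<close> to its section at \<open>x\<close>; when neither does, the
  second claim of \<open>nn_integral_V_finite_of_atom\<close> applies.\<close>

lemma nn_integral_V_mu_mu_finite: "(\<integral>\<^sup>+z. ennreal (V z) \<partial>(\<mu> \<Otimes>\<^sub>M \<mu>)) < \<infinity>"
proof -
  interpret mu: prob_space \<mu> by (rule prob_mu)
  interpret mm: pair_prob_space \<mu> \<mu> ..
  obtain x where x [measurable]: "x \<in> space M" using space_not_empty by blast
  obtain A where A: "A \<in> sets M" "x \<in> A" "\<And>B. B \<in> sets M \<Longrightarrow> x \<in> B \<Longrightarrow> A \<subseteq> B"
    using countably_generated_atom[OF cg x] by blast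
  note [measurable] = A(1)
  let ?B = "space M - A"
  have st [measurable_cong]: "sets (\<mu> \<Otimes>\<^sub>M \<mu>) = sets (M \<Otimes>\<^sub>M M)"
    by (auto intro!: sets_pair_measure_cong)
  have sec: "V (z, w) = V (x, w)" if "z \<in> A" "w \<in> space M" for z w
  proof -
    have [measurable]: "w \<in> space M" by fact
    have "{u \<in> space M. V (u, w) = V (x, w)} \<in> sets M" by measurable
    then show ?thesis using A(3)[of "{u \<in> space M. V (u, w) = V (x, w)}"] x that by auto
  qed
  have "(\<integral>\<^sup>+z. ennreal (V z) \<partial>(\<mu> \<Otimes>\<^sub>M \<mu>)) \<le>
      (\<integral>\<^sup>+z. ennreal (V z) * indicator (?B \<times> ?B) z + (ennreal (V (x, snd z)) + ennreal (V (x, fst z))) \<partial>(\<mu> \<Otimes>\<^sub>M \<mu>))"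
  proof (intro nn_integral_mono)
    fix z assume "z \<in> space (\<mu> \<Otimes>\<^sub>M \<mu>)"
    then obtain u w where z: "z = (u, w)" "u \<in> space M" "w \<in> space M" by (cases z) (auto simp: space_pair_measure)
    consider "u \<in> A" | "w \<in> A" | "u \<in> ?B" "w \<in> ?B" using z by blast
    then show "ennreal (V z) \<le> ennreal (V z) * indicator (?B \<times> ?B) z + (ennreal (V (x, snd z)) + ennreal (V (x, fst z)))"
    proof cases
      case 1
      then show ?thesis using sec[of u w] z by (auto simp: add_increasing)
    next
      case 2
      then have "V (u, w) = V (x, u)" using sec[of w u] V_sym[of u w] z by simp
      then show ?thesis using z by (auto simp: add_increasing)
    next
      case 3
      then show ?thesis using z by (auto simp: add_increasing2)
    qed
  qed
  also have "\<dots> = (\<integral>\<^sup>+z. ennreal (V z) * indicator (?B \<times> ?B) z \<partial>(\<mu> \<Otimes>\<^sub>M \<mu>)) +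
      ((\<integral>\<^sup>+z. ennreal (V (x, snd z)) \<partial>(\<mu> \<Otimes>\<^sub>M \<mu>)) + (\<integral>\<^sup>+z. ennreal (V (x, fst z)) \<partial>(\<mu> \<Otimes>\<^sub>M \<mu>)))"
    by (simp add: nn_integral_add)
  also have "(\<integral>\<^sup>+z. ennreal (V (x, snd z)) \<partial>(\<mu> \<Otimes>\<^sub>M \<mu>)) = (\<integral>\<^sup>+w. ennreal (V (x, w)) \<partial>\<mu>)"
    using mu.emeasure_space_1 by (subst mu.nn_integral_fst[symmetric]) simp_all
  also have "(\<integral>\<^sup>+z. ennreal (V (x, fst z)) \<partial>(\<mu> \<Otimes>\<^sub>M \<mu>)) = (\<integral>\<^sup>+w. ennreal (V (x, w)) \<partial>\<mu>)"
    using mu.emeasure_space_1 by (subst mu.nn_integral_fst[symmetric]) simp_all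
  also have "(\<integral>\<^sup>+z. ennreal (V z) * indicator (?B \<times> ?B) z \<partial>(\<mu> \<Otimes>\<^sub>M \<mu>)) +
      ((\<integral>\<^sup>+w. ennreal (V (x, w)) \<partial>\<mu>) + (\<integral>\<^sup>+w. ennreal (V (x, w)) \<partial>\<mu>)) < \<infinity>"
    using nn_integral_V_finite_of_atom(2)[OF x A] nn_integral_V_mu_finite[OF x]
    unfolding infinity_ennreal_def ennreal_add_less_top by (intro conjI)
  finally show ?thesis .
qed

text \<open>The bound is geometric in \<open>k\<close> and serves qualitative purposes, namely
  integrability and domination for each fixed \<open>k\<close>. Bounds uniform in \<open>k\<close>
  come from the mixing condition.\<close>

lemma nn_integral_V_K:
  assumes x: "x \<in> space M" and y [measurable]: "y \<in> space M"
  shows "(\<integral>\<^sup>+z. ennreal (V (z, y)) \<partial>K k x) \<le> ennreal c' ^ k * ennreal (V (x, y))"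
  using x
proof (induction k arbitrary: x)
  case 0
  then show ?case by (simp add: nn_integral_return)
next
  case (Suc k)
  have "(\<integral>\<^sup>+z. ennreal (V (z, y)) \<partial>K (Suc k) x) = (\<integral>\<^sup>+z. (\<integral>\<^sup>+u. ennreal (V (u, y)) \<partial>P z) \<partial>K k x)"
    using Suc.prems by (intro nn_integral_K_Suc) auto
  also have "\<dots> \<le> (\<integral>\<^sup>+z. ennreal c' * ennreal (V (z, y)) \<partial>K k x)"
  proof (intro nn_integral_mono)
    fix z assume "z \<in> space (K k x)"
    then have z: "z \<in> space M" using Suc.prems by simp
    then have "0 \<le> V (z, y)" using V_ge_1[OF z y] by simp
    then show "(\<integral>\<^sup>+u. ennreal (V (u, y)) \<partial>P z) \<le> ennreal c' * ennreal (V (z, y))"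
      using PV[OF z y] by (simp add: ennreal_mult'')
  qed
  also have "\<dots> = ennreal c' * (\<integral>\<^sup>+z. ennreal (V (z, y)) \<partial>K k x)"
    using Suc.prems by (intro nn_integral_cmult) (auto cong: measurable_cong_sets)
  also have "\<dots> \<le> ennreal c' * (ennreal c' ^ k * ennreal (V (x, y)))"
    using Suc by (intro mult_left_mono) auto
  finally show ?case by (simp add: ac_simps)
qed

lemma nn_integral_V_K':
  assumes x: "x \<in> space M" and y: "y \<in> space M"
  shows "(\<integral>\<^sup>+w. ennreal (V (x, w)) \<partial>K i y) \<le> ennreal c' ^ i * ennreal (V (x, y))"
proof -
  have "(\<integral>\<^sup>+w. ennreal (V (x, w)) \<partial>K i y) = (\<integral>\<^sup>+w. ennreal (V (w, x)) \<partial>K i y)"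
    using assms by (intro nn_integral_cong) (simp add: V_sym)
  then show ?thesis using nn_integral_V_K[OF y x, of i] V_sym[OF x y] by simp
qed

text \<open>Membership in the weighted space of \<open>V\<close>. The constant is hidden on purpose:
  it guarantees that integrals exist and does not appear in the final bounds.\<close>

definition dominated :: "('a \<times> 'a \<Rightarrow> real) \<Rightarrow> bool" where
  "dominated g \<longleftrightarrow> g \<in> borel_measurable (M \<Otimes>\<^sub>M M) \<and>
     (\<exists>C\<ge>0. \<forall>x\<in>space M. \<forall>y\<in>space M. \<bar>g (x, y)\<bar> \<le> C * V (x, y))"

lemma dominatedI:
  assumes "g \<in> borel_measurable (M \<Otimes>\<^sub>M M)" "\<And>x y. x \<in> space M \<Longrightarrow> y \<in> space M \<Longrightarrow> \<bar>g (x, y)\<bar> \<le> C * V (x, y)"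
  shows "dominated g"
proof -
  have "\<bar>g (x, y)\<bar> \<le> max 0 C * V (x, y)" if "x \<in> space M" "y \<in> space M" for x y
  proof -
    have "C * V (x, y) \<le> max 0 C * V (x, y)" using V_ge_1[OF that] by (intro mult_right_mono) auto
    then show ?thesis using assms(2)[OF that] by linarith
  qed
  moreover have "0 \<le> max 0 C" by simp
  ultimately show ?thesis unfolding dominated_def using assms(1) by blast
qed

lemma dominated_measurable [measurable_dest]: "dominated g \<Longrightarrow> g \<in> borel_measurable (M \<Otimes>\<^sub>M M)"
  by (simp add: dominated_def)

lemma dominated_integrable:
  assumes g: "dominated g" and f [measurable]: "f \<in> m \<rightarrow>\<^sub>M M \<Otimes>\<^sub>M M"
    and fin: "(\<integral>\<^sup>+z. ennreal (V (f z)) \<partial>m) < \<infinity>"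
  shows "integrable m (\<lambda>z. g (f z))"
proof (rule integrableI_bounded)
  note [measurable] = dominated_measurable[OF g]
  show "(\<lambda>z. g (f z)) \<in> borel_measurable m" by measurable
  obtain C where C: "0 \<le> C" "\<And>x y. x \<in> space M \<Longrightarrow> y \<in> space M \<Longrightarrow> \<bar>g (x, y)\<bar> \<le> C * V (x, y)"
    using g by (auto simp: dominated_def)
  have "(\<integral>\<^sup>+z. ennreal (norm (g (f z))) \<partial>m) \<le> (\<integral>\<^sup>+z. ennreal C * ennreal (V (f z)) \<partial>m)"
  proof (intro nn_integral_mono)
    fix z assume "z \<in> space m"
    then have "f z \<in> space (M \<Otimes>\<^sub>M M)" using measurable_space[OF f] by simp
    then have "norm (g (f z)) \<le> C * V (f z)" using C(2) by (cases "f z") (auto simp: space_pair_measure)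
    then show "ennreal (norm (g (f z))) \<le> ennreal C * ennreal (V (f z))"
      using C(1) by (simp add: ennreal_mult'[symmetric] ennreal_leI)
  qed
  also have "\<dots> = ennreal C * (\<integral>\<^sup>+z. ennreal (V (f z)) \<partial>m)" by (rule nn_integral_cmult) measurable
  also have "\<dots> < \<infinity>" using fin by (simp add: ennreal_mult_less_top)
  finally show "(\<integral>\<^sup>+z. ennreal (norm (g (f z))) \<partial>m) < \<infinity>" .
qed

lemma dominated_integrable_K:
  assumes "dominated g" "x \<in> space M" "y \<in> space M"
  shows "integrable (K k x) (\<lambda>z. g (z, y))" "integrable (K k y) (\<lambda>w. g (x, w))"
proof -
  have "(\<integral>\<^sup>+z. ennreal (V (z, y)) \<partial>K k x) < \<infinity>" "(\<integral>\<^sup>+z. ennreal (V (x, z)) \<partial>K k y) < \<infinity>"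
    by (rule le_less_trans[OF nn_integral_V_K[OF assms(2,3)]], simp add: ennreal_mult_less_top power_less_top_ennreal,
        rule le_less_trans[OF nn_integral_V_K'[OF assms(2,3)]], simp add: ennreal_mult_less_top power_less_top_ennreal)
  then show "integrable (K k x) (\<lambda>z. g (z, y))" "integrable (K k y) (\<lambda>w. g (x, w))"
    using assms by (auto intro!: dominated_integrable cong: measurable_cong_sets)
qed

lemma dominated_integrable_P:
  assumes "dominated g" "x \<in> space M" "y \<in> space M"
  shows "integrable (P x) (\<lambda>z. g (z, y))" "integrable (P y) (\<lambda>w. g (x, w))"
  using dominated_integrable_K[OF assms, of "Suc 0"] K_1 assms by (simp_all del: kernel_power.simps)

lemma dominated_integrable_mu:
  assumes "dominated g" "x \<in> space M"
  shows "integrable \<mu> (\<lambda>w. g (x, w))" "integrable \<mu> (\<lambda>z. g (z, x))"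
proof -
  have "(\<integral>\<^sup>+z. ennreal (V (z, x)) \<partial>\<mu>) = (\<integral>\<^sup>+z. ennreal (V (x, z)) \<partial>\<mu>)"
    using assms by (intro nn_integral_cong) (simp add: V_sym)
  then show "integrable \<mu> (\<lambda>w. g (x, w))" "integrable \<mu> (\<lambda>z. g (z, x))"
    using nn_integral_V_mu_finite[OF assms(2)] assms
    by (auto intro!: dominated_integrable cong: measurable_cong_sets)
qed

lemma dominated_integrable_pair:
  assumes g: "dominated g" and x: "x \<in> space M" and y: "y \<in> space M"
  shows "integrable (K k x \<Otimes>\<^sub>M K i y) g" "integrable (K k x \<Otimes>\<^sub>M \<mu>) g" "integrable (\<mu> \<Otimes>\<^sub>M K i y) g" "integrable (\<mu> \<Otimes>\<^sub>M \<mu>) g"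
proof -
  interpret mu: prob_space \<mu> by (rule prob_mu)
  interpret Kx: prob_space "K k x" by (rule prob_K[OF x])
  interpret Ky: prob_space "K i y" by (rule prob_K[OF y])
  interpret Kmu: pair_prob_space "K k x" \<mu> ..
  interpret muK: pair_prob_space \<mu> "K i y" ..
  have st [measurable_cong]: "sets (\<mu> \<Otimes>\<^sub>M \<mu>) = sets (M \<Otimes>\<^sub>M M)" "sets (K k x \<Otimes>\<^sub>M K i y) = sets (M \<Otimes>\<^sub>M M)"
     "sets (K k x \<Otimes>\<^sub>M \<mu>) = sets (M \<Otimes>\<^sub>M M)" "sets (\<mu> \<Otimes>\<^sub>M K i y) = sets (M \<Otimes>\<^sub>M M)"
    using x y by (auto intro!: sets_pair_measure_cong)
  have I: "integrable m g" if "sets m = sets (M \<Otimes>\<^sub>M M)" "(\<integral>\<^sup>+z. ennreal (V z) \<partial>m) < \<infinity>" for m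
    using dominated_integrable[OF g, of "\<lambda>z. z" m] that by (simp cong: measurable_cong_sets)
  show "integrable (\<mu> \<Otimes>\<^sub>M \<mu>) g" using nn_integral_V_mu_mu_finite by (rule I[OF st(1)])
  have "(\<integral>\<^sup>+z. ennreal (V z) \<partial>(K k x \<Otimes>\<^sub>M K i y)) = (\<integral>\<^sup>+z. (\<integral>\<^sup>+w. ennreal (V (z, w)) \<partial>K i y) \<partial>K k x)"
    by (rule Ky.nn_integral_fst[symmetric]) measurable
  also have "\<dots> \<le> (\<integral>\<^sup>+z. ennreal c' ^ i * ennreal (V (z, y)) \<partial>K k x)"
    using x y by (intro nn_integral_mono nn_integral_V_K') auto
  also have "\<dots> = ennreal c' ^ i * (\<integral>\<^sup>+z. ennreal (V (z, y)) \<partial>K k x)"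
    using x y by (intro nn_integral_cmult) (auto cong: measurable_cong_sets)
  also have "\<dots> \<le> ennreal c' ^ i * (ennreal c' ^ k * ennreal (V (x, y)))"
    using x y by (intro mult_left_mono nn_integral_V_K) auto
  also have "\<dots> < \<infinity>" by (simp add: ennreal_mult_less_top power_less_top_ennreal)
  finally show "integrable (K k x \<Otimes>\<^sub>M K i y) g" by (rule I[OF st(2)])
  \<comment> \<open>The coordinate under \<open>K k x\<close> is integrated first: the drift bound
    then leaves the section \<open>V (x, w)\<close>, whose mu-integral is finite. The other order
    would leave a function of \<open>z\<close> whose integral under \<open>K k x\<close> is not
    controlled.\<close>
  have "(\<integral>\<^sup>+z. ennreal (V z) \<partial>(K k x \<Otimes>\<^sub>M \<mu>)) = (\<integral>\<^sup>+w. (\<integral>\<^sup>+z. ennreal (V (z, w)) \<partial>K k x) \<partial>\<mu>)"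
    by (intro Kmu.nn_integral_snd[symmetric, where f="\<lambda>z. ennreal (V z)"], subst measurable_cong_sets[OF st(3) refl]) measurable
  also have "\<dots> \<le> (\<integral>\<^sup>+w. ennreal c' ^ k * ennreal (V (x, w)) \<partial>\<mu>)"
    using x y by (intro nn_integral_mono nn_integral_V_K) auto
  also have "\<dots> = ennreal c' ^ k * (\<integral>\<^sup>+w. ennreal (V (x, w)) \<partial>\<mu>)"
    using x y by (intro nn_integral_cmult) (auto cong: measurable_cong_sets)
  also have "\<dots> < \<infinity>" using nn_integral_V_mu_finite[OF x] by (simp add: ennreal_mult_less_top power_less_top_ennreal)
  finally show "integrable (K k x \<Otimes>\<^sub>M \<mu>) g" by (rule I[OF st(3)])
  have "(\<integral>\<^sup>+z. ennreal (V z) \<partial>(\<mu> \<Otimes>\<^sub>M K i y)) = (\<integral>\<^sup>+z. (\<integral>\<^sup>+w. ennreal (V (z, w)) \<partial>K i y) \<partial>\<mu>)"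
    by (rule Ky.nn_integral_fst[symmetric]) measurable
  also have "\<dots> \<le> (\<integral>\<^sup>+z. ennreal c' ^ i * ennreal (V (y, z)) \<partial>\<mu>)"
    using nn_integral_V_K'[OF _ y, of _ i] V_sym[OF y] by (intro nn_integral_mono) auto
  also have "\<dots> = ennreal c' ^ i * (\<integral>\<^sup>+w. ennreal (V (y, w)) \<partial>\<mu>)"
    using x y by (intro nn_integral_cmult) (auto cong: measurable_cong_sets)
  also have "\<dots> < \<infinity>" using nn_integral_V_mu_finite[OF y] by (simp add: ennreal_mult_less_top power_less_top_ennreal)
  finally show "integrable (\<mu> \<Otimes>\<^sub>M K i y) g" by (rule I[OF st(4)])
qed

end

section \<open>Iterates of a degenerate kernel\<close>

declare kernel_power.simps(2) [simp del]

text \<open>Parameters with a non-integrable section are harmless: they form a measurable set,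
  detected by the integral of the absolute value, and on it the Bochner integral equals 0.\<close>

lemma integral_measurable_kernel:
  fixes f :: "'b \<Rightarrow> 'c \<Rightarrow> real"
  assumes f [measurable]: "(\<lambda>(u, z). f u z) \<in> borel_measurable (N \<Otimes>\<^sub>M M)"
    and L [measurable]: "L \<in> N \<rightarrow>\<^sub>M subprob_algebra M"
  shows "(\<lambda>u. \<integral>z. f u z \<partial>L u) \<in> borel_measurable N"
proof -
  have [measurable]: "(\<lambda>u. \<integral>\<^sup>+z. F u z \<partial>L u) \<in> borel_measurable N"
    if "(\<lambda>(u, z). F u z) \<in> borel_measurable (N \<Otimes>\<^sub>M M)" for F :: "'b \<Rightarrow> 'c \<Rightarrow> ennreal"
    by (rule nn_integral_measurable_subprob_algebra2[OF that L])
  have "(\<lambda>u. if (\<integral>\<^sup>+z. ennreal \<bar>f u z\<bar> \<partial>L u) < \<infinity>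
      then enn2real (\<integral>\<^sup>+z. ennreal (f u z) \<partial>L u) - enn2real (\<integral>\<^sup>+z. ennreal (- f u z) \<partial>L u) else 0) \<in> borel_measurable N"
    by measurable
  moreover have "(\<integral>z. f u z \<partial>L u) = (if (\<integral>\<^sup>+z. ennreal \<bar>f u z\<bar> \<partial>L u) < \<infinity>
      then enn2real (\<integral>\<^sup>+z. ennreal (f u z) \<partial>L u) - enn2real (\<integral>\<^sup>+z. ennreal (- f u z) \<partial>L u) else 0)"
    if u: "u \<in> space N" for u
  proof -
    have "f u \<in> borel_measurable (L u)"
      using u sets_kernel[OF L u] by (simp cong: measurable_cong_sets)
    then have "integrable (L u) (f u) \<longleftrightarrow> (\<integral>\<^sup>+z. ennreal \<bar>f u z\<bar> \<partial>L u) < \<infinity>"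
      by (simp add: integrable_iff_bounded)
    then show ?thesis
      using real_lebesgue_integral_def[of "L u" "f u"] not_integrable_integral_eq[of "L u" "f u"] by metis
  qed
  ultimately show ?thesis by (simp cong: measurable_cong)
qed

context product_ergodic_kernel
begin

definition Q :: "nat \<Rightarrow> nat \<Rightarrow> ('a \<times> 'a \<Rightarrow> real) \<Rightarrow> 'a \<times> 'a \<Rightarrow> real" where
  "Q k i g = (\<lambda>(x, y). \<integral>z. g z \<partial>(K k x \<Otimes>\<^sub>M K i y))"

definition P_fst :: "('a \<times> 'a \<Rightarrow> real) \<Rightarrow> 'a \<times> 'a \<Rightarrow> real" where
  "P_fst g = (\<lambda>(x, y). \<integral>z. g (z, y) \<partial>P x)"

definition P_snd :: "('a \<times> 'a \<Rightarrow> real) \<Rightarrow> 'a \<times> 'a \<Rightarrow> real" where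
  "P_snd g = (\<lambda>(x, y). \<integral>w. g (x, w) \<partial>P y)"

text \<open>Complete degeneracy, demanded at every point and not just almost everywhere, since
  \<open>K k x\<close> may charge mu-null sets.\<close>

definition canonical :: "('a \<times> 'a \<Rightarrow> real) \<Rightarrow> bool" where
  "canonical g \<longleftrightarrow> (\<forall>x\<in>space M. (\<integral>w. g (x, w) \<partial>\<mu>) = 0 \<and> (\<integral>z. g (z, x) \<partial>\<mu>) = 0)"

lemma integral_measurable_P [measurable]:
  assumes [measurable]: "(\<lambda>(u, z). f u z) \<in> borel_measurable (N \<Otimes>\<^sub>M M)" "a \<in> N \<rightarrow>\<^sub>M M"
  shows "(\<lambda>u. \<integral>z. f u z \<partial>P (a u) :: real) \<in> borel_measurable N"
  by (rule integral_measurable_kernel[where M=M]) measurable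

lemma integral_measurable_K [measurable]:
  assumes [measurable]: "(\<lambda>(u, z). f u z) \<in> borel_measurable (N \<Otimes>\<^sub>M M)" "a \<in> N \<rightarrow>\<^sub>M M"
  shows "(\<lambda>u. \<integral>z. f u z \<partial>K k (a u) :: real) \<in> borel_measurable N"
  by (rule integral_measurable_kernel[where M=M]) measurable

lemma Q_eq:
  assumes g: "dominated g" and x: "x \<in> space M" and y: "y \<in> space M"
  shows "Q k i g (x, y) = (\<integral>z. (\<integral>w. g (z, w) \<partial>K i y) \<partial>K k x)"
    and "Q k i g (x, y) = (\<integral>w. (\<integral>z. g (z, w) \<partial>K k x) \<partial>K i y)"
proof -
  interpret Kx: prob_space "K k x" by (rule prob_K[OF x])
  interpret Ky: prob_space "K i y" by (rule prob_K[OF y])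
  interpret KK: pair_prob_space "K k x" "K i y" ..
  show "Q k i g (x, y) = (\<integral>z. (\<integral>w. g (z, w) \<partial>K i y) \<partial>K k x)"
    unfolding Q_def using KK.integral_fst'[OF dominated_integrable_pair(1)[OF g x y]] by simp
  show "Q k i g (x, y) = (\<integral>w. (\<integral>z. g (z, w) \<partial>K k x) \<partial>K i y)"
    unfolding Q_def using KK.integral_snd[of "\<lambda>x y. g (x, y)"] dominated_integrable_pair(1)[OF g x y] by simp
qed

lemma Q_0:
  assumes g: "dominated g" and x: "x \<in> space M" and y [measurable]: "y \<in> space M"
  shows "Q 0 0 g (x, y) = g (x, y)"
proof -
  note [measurable] = dominated_measurable[OF g]
  have "Q 0 0 g (x, y) = (\<integral>z. (\<integral>w. g (z, w) \<partial>return M y) \<partial>return M x)"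
    by (simp add: Q_eq(1)[OF g x y])
  also have "\<dots> = (\<integral>z. g (z, y) \<partial>return M x)"
    using y by (intro Bochner_Integration.integral_cong) (auto simp: integral_return)
  finally show ?thesis using x by (simp add: integral_return)
qed

lemma Q_measurable:
  assumes g: "dominated g"
  shows "Q k i g \<in> borel_measurable (M \<Otimes>\<^sub>M M)"
proof -
  note [measurable] = dominated_measurable[OF g]
  have "(\<lambda>u. \<integral>z. (\<integral>w. g (z, w) \<partial>K i (snd u)) \<partial>K k (fst u)) \<in> borel_measurable (M \<Otimes>\<^sub>M M)"
    by measurable
  then show ?thesis
    by (rule measurable_cong[THEN iffD1, rotated]) (auto simp: space_pair_measure Q_eq(1)[OF g])
qed

lemma dominated_Q:
  assumes g: "dominated g"
  shows "dominated (Q k i g)"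
proof -
  obtain C where C: "0 \<le> C" "\<And>x y. x \<in> space M \<Longrightarrow> y \<in> space M \<Longrightarrow> \<bar>g (x, y)\<bar> \<le> C * V (x, y)"
    using g by (auto simp: dominated_def)
  note [measurable] = dominated_measurable[OF g]
  define d where "d = max 0 c'"
  have d: "ennreal c' = ennreal d" "0 \<le> d" by (auto simp: d_def max_def ennreal_neg)
  show ?thesis
  proof (rule dominatedI[OF Q_measurable[OF g]])
    fix x y assume x: "x \<in> space M" and y: "y \<in> space M"
    interpret Ky: prob_space "K i y" by (rule prob_K[OF y])
    have st [measurable_cong]: "sets (K k x \<Otimes>\<^sub>M K i y) = sets (M \<Otimes>\<^sub>M M)"
      using x y by (auto intro!: sets_pair_measure_cong)
    have V0: "0 \<le> V (x, y)" using V_ge_1[OF x y] by simp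
    have "ennreal \<bar>Q k i g (x, y)\<bar> \<le> (\<integral>\<^sup>+z. ennreal \<bar>g z\<bar> \<partial>(K k x \<Otimes>\<^sub>M K i y))"
      unfolding Q_def using integral_norm_bound_ennreal[OF dominated_integrable_pair(1)[OF g x y]] by simp
    also have "\<dots> = (\<integral>\<^sup>+z. (\<integral>\<^sup>+w. ennreal \<bar>g (z, w)\<bar> \<partial>K i y) \<partial>K k x)"
      by (rule Ky.nn_integral_fst[symmetric]) measurable
    also have "\<dots> \<le> (\<integral>\<^sup>+z. (\<integral>\<^sup>+w. ennreal C * ennreal (V (z, w)) \<partial>K i y) \<partial>K k x)"
      using x y C by (intro nn_integral_mono) (simp add: ennreal_mult'[symmetric] ennreal_leI)
    also have "\<dots> = (\<integral>\<^sup>+z. ennreal C * (\<integral>\<^sup>+w. ennreal (V (z, w)) \<partial>K i y) \<partial>K k x)"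
      using x y by (intro nn_integral_cong nn_integral_cmult) (auto cong: measurable_cong_sets)
    also have "\<dots> \<le> (\<integral>\<^sup>+z. (ennreal C * ennreal d ^ i) * ennreal (V (z, y)) \<partial>K k x)"
      using x y nn_integral_V_K'[OF _ y] unfolding d(1) mult.assoc
      by (intro nn_integral_mono mult_left_mono) auto
    also have "\<dots> = (ennreal C * ennreal d ^ i) * (\<integral>\<^sup>+z. ennreal (V (z, y)) \<partial>K k x)"
      using x y by (intro nn_integral_cmult) (auto cong: measurable_cong_sets)
    also have "\<dots> \<le> (ennreal C * ennreal d ^ i) * (ennreal d ^ k * ennreal (V (x, y)))"
      using nn_integral_V_K[OF x y] unfolding d(1) by (intro mult_left_mono) auto
    also have "\<dots> = ennreal (C * d ^ i * d ^ k * V (x, y))"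
      using C(1) d(2) V0 by (simp add: ennreal_mult ennreal_power ac_simps)
    finally show "\<bar>Q k i g (x, y)\<bar> \<le> C * d ^ i * d ^ k * V (x, y)"
      using C(1) d(2) V0 by (subst (asm) ennreal_le_iff) auto
  qed
qed

lemma P_fst_eq_Q: "dominated g \<Longrightarrow> x \<in> space M \<Longrightarrow> y \<in> space M \<Longrightarrow> P_fst g (x, y) = Q (Suc 0) 0 g (x, y)"
proof -
  assume g: "dominated g" and x: "x \<in> space M" and y: "y \<in> space M"
  note [measurable] = dominated_measurable[OF g]
  have "Q (Suc 0) 0 g (x, y) = (\<integral>z. (\<integral>w. g (z, w) \<partial>K 0 y) \<partial>P x)"
    unfolding Q_eq(1)[OF g x y] K_1[OF x] ..
  also have "\<dots> = (\<integral>z. g (z, y) \<partial>P x)"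
    using x y by (intro Bochner_Integration.integral_cong) (auto simp: integral_return)
  finally show ?thesis by (simp add: P_fst_def)
qed

lemma dominated_cong:
  "dominated f \<Longrightarrow> (\<And>x y. x \<in> space M \<Longrightarrow> y \<in> space M \<Longrightarrow> f (x, y) = g (x, y)) \<Longrightarrow> dominated g"
proof -
  assume f: "dominated f" and eq: "\<And>x y. x \<in> space M \<Longrightarrow> y \<in> space M \<Longrightarrow> f (x, y) = g (x, y)"
  have "f \<in> borel_measurable (M \<Otimes>\<^sub>M M) \<longleftrightarrow> g \<in> borel_measurable (M \<Otimes>\<^sub>M M)"
    by (rule measurable_cong) (auto simp: space_pair_measure eq)
  then show "dominated g" using f eq unfolding dominated_def by simp
qed

lemma dominated_P_fst: "dominated g \<Longrightarrow> dominated (P_fst g)"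
  using dominated_cong[OF dominated_Q[of g "Suc 0" 0]] P_fst_eq_Q[of g] by simp

text \<open>The last step is absorbed into the kernel, so that sums over positive powers of
  \<open>P\<close> become sums of \<open>Q\<close> at \<open>P_fst g\<close>, which may satisfy a
  better pointwise bound than \<open>g\<close>. In contrast \<open>integral_P_Q_fst\<close> adds a
  step at the start, as a martingale compensator requires.\<close>

lemma Q_Suc_fst:
  assumes g: "dominated g" and x: "x \<in> space M" and y: "y \<in> space M"
  shows "Q (Suc k) i g (x, y) = Q k i (P_fst g) (x, y)"
proof -
  note [measurable] = dominated_measurable[OF g]
  have "(\<integral>z. g (z, w) \<partial>K (Suc k) x) = (\<integral>z. P_fst g (z, w) \<partial>K k x)" if w: "w \<in> space M" for w
    unfolding P_fst_def using w dominated_integrable_K(1)[OF g x w]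
    by (subst integral_K_Suc[OF x]) auto
  then show ?thesis
    unfolding Q_eq(2)[OF g x y] Q_eq(2)[OF dominated_P_fst[OF g] x y]
    using y by (intro Bochner_Integration.integral_cong[OF refl, of "K i y"]) simp
qed

lemma integral_P_Q_fst:
  assumes g: "dominated g" and x: "x \<in> space M" and y: "y \<in> space M"
  shows "(\<integral>z. Q k i g (z, y) \<partial>P x) = Q (Suc k) i g (x, y)"
proof -
  note [measurable] = dominated_measurable[OF g]
  interpret Kx: prob_space "K (Suc k) x" by (rule prob_K[OF x])
  interpret Ky: prob_space "K i y" by (rule prob_K[OF y])
  interpret KK: pair_prob_space "K (Suc k) x" "K i y" ..
  have "integrable (K (Suc k) x) (\<lambda>z. \<integral>w. g (z, w) \<partial>K i y)"
    using KK.integrable_fst'[OF dominated_integrable_pair(1)[OF g x y]] .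
  moreover have "(\<lambda>z. \<integral>w. g (z, w) \<partial>K i y) \<in> borel_measurable M"
    using y by measurable
  ultimately have "Q (Suc k) i g (x, y) = (\<integral>u. (\<integral>z. (\<integral>w. g (z, w) \<partial>K i y) \<partial>K k u) \<partial>P x)"
    unfolding Q_eq(1)[OF g x y] by (intro integral_K_Suc' x)
  also have "\<dots> = (\<integral>u. Q k i g (u, y) \<partial>P x)"
    using x y by (intro Bochner_Integration.integral_cong) (auto simp: Q_eq(1)[OF g])
  finally show ?thesis by simp
qed

lemma integral_P_Q_snd:
  assumes g: "dominated g" and x: "x \<in> space M" and y: "y \<in> space M"
  shows "(\<integral>w. Q k i g (x, w) \<partial>P y) = Q k (Suc i) g (x, y)"
proof -
  note [measurable] = dominated_measurable[OF g]
  interpret Kx: prob_space "K k x" by (rule prob_K[OF x])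
  interpret Ky: prob_space "K (Suc i) y" by (rule prob_K[OF y])
  interpret KK: pair_prob_space "K k x" "K (Suc i) y" ..
  have "integrable (K (Suc i) y) (\<lambda>w. \<integral>z. g (z, w) \<partial>K k x)"
    using KK.integrable_snd[of "\<lambda>x y. g (x, y)"] dominated_integrable_pair(1)[OF g x y] by simp
  moreover have "(\<lambda>w. \<integral>z. g (z, w) \<partial>K k x) \<in> borel_measurable M"
    using x by measurable
  ultimately have "Q k (Suc i) g (x, y) = (\<integral>u. (\<integral>w. (\<integral>z. g (z, w) \<partial>K k x) \<partial>K i u) \<partial>P y)"
    unfolding Q_eq(2)[OF g x y] by (intro integral_K_Suc' y)
  also have "\<dots> = (\<integral>u. Q k i g (x, u) \<partial>P y)"
    using x y by (intro Bochner_Integration.integral_cong) (auto simp: Q_eq(2)[OF g])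
  finally show ?thesis by simp
qed

definition swap_args :: "('a \<times> 'a \<Rightarrow> real) \<Rightarrow> 'a \<times> 'a \<Rightarrow> real" where
  "swap_args g = (\<lambda>(x, y). g (y, x))"

lemma dominated_swap: "dominated g \<Longrightarrow> dominated (swap_args g)"
proof -
  assume g: "dominated g"
  note [measurable] = dominated_measurable[OF g]
  obtain C where C: "\<And>x y. x \<in> space M \<Longrightarrow> y \<in> space M \<Longrightarrow> \<bar>g (x, y)\<bar> \<le> C * V (x, y)"
    using g by (auto simp: dominated_def)
  show ?thesis
  proof (rule dominatedI)
    show "swap_args g \<in> borel_measurable (M \<Otimes>\<^sub>M M)" unfolding swap_args_def by measurable
    show "\<bar>swap_args g (x, y)\<bar> \<le> C * V (x, y)" if "x \<in> space M" "y \<in> space M" for x y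
      using C[OF that(2,1)] V_sym[OF that] by (simp add: swap_args_def)
  qed
qed

lemma canonical_swap: "canonical g \<Longrightarrow> canonical (swap_args g)"
  unfolding canonical_def swap_args_def by auto

lemma dominated_P_snd: assumes "dominated g" shows "dominated (P_snd g)"
proof -
  have "P_snd g = swap_args (P_fst (swap_args g))" by (auto simp: P_snd_def P_fst_def swap_args_def)
  then show ?thesis using assms by (simp add: dominated_swap dominated_P_fst)
qed

lemma Q_Suc_snd:
  assumes g: "dominated g" and x: "x \<in> space M" and y: "y \<in> space M"
  shows "Q k (Suc i) g (x, y) = Q k i (P_snd g) (x, y)"
proof -
  note [measurable] = dominated_measurable[OF g]
  have "(\<integral>w. g (z, w) \<partial>K (Suc i) y) = (\<integral>w. P_snd g (z, w) \<partial>K i y)" if z: "z \<in> space M" for z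
    unfolding P_snd_def using z dominated_integrable_K(2)[OF g z y]
    by (subst integral_K_Suc[OF y]) auto
  then show ?thesis
    unfolding Q_eq(1)[OF g x y] Q_eq(1)[OF dominated_P_snd[OF g] x y]
    using x by (intro Bochner_Integration.integral_cong[OF refl, of "K k x"]) simp
qed

text \<open>In the untouched coordinate, integration against mu commutes with \<open>P\<close> by
  Fubini; in the other one invariance of mu applies.\<close>

lemma canonical_P_fst:
  assumes g: "dominated g" and can: "canonical g"
  shows "canonical (P_fst g)"
  unfolding canonical_def
proof (intro ballI conjI)
  note [measurable] = dominated_measurable[OF g]
  fix x assume x [measurable]: "x \<in> space M"
  interpret mu: prob_space \<mu> by (rule prob_mu)
  interpret Kx: prob_space "K (Suc 0) x" by (rule prob_K[OF x])
  interpret KK: pair_prob_space "K (Suc 0) x" \<mu> ..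
  have "(\<integral>w. P_fst g (x, w) \<partial>\<mu>) = (\<integral>w. (\<integral>z. g (z, w) \<partial>K (Suc 0) x) \<partial>\<mu>)"
    unfolding P_fst_def K_1[OF x] by simp
  also have "\<dots> = (\<integral>z. (\<integral>w. g (z, w) \<partial>\<mu>) \<partial>K (Suc 0) x)"
    using KK.Fubini_integral[of "\<lambda>x y. g (x, y)"] dominated_integrable_pair(2)[OF g x x] by simp
  also have "\<dots> = (\<integral>z. 0 \<partial>K (Suc 0) x)"
    using can x by (intro Bochner_Integration.integral_cong) (auto simp: canonical_def simp del: kernel_power.simps)
  finally show "(\<integral>w. P_fst g (x, w) \<partial>\<mu>) = 0" by simp
  show "(\<integral>z. P_fst g (z, x) \<partial>\<mu>) = 0"
    unfolding P_fst_def using can x integral_mu_P[of "\<lambda>z. g (z, x)"] dominated_integrable_mu[OF g x]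
    by (simp add: canonical_def)
qed

lemma canonical_P_snd:
  assumes "dominated g" "canonical g"
  shows "canonical (P_snd g)"
proof -
  have "P_snd g = swap_args (P_fst (swap_args g))" by (auto simp: P_snd_def P_fst_def swap_args_def)
  then show ?thesis using assms by (simp add: canonical_swap dominated_swap canonical_P_fst)
qed

text \<open>Degeneracy makes the three products involving mu integrate \<open>g\<close> to 0, so
  \<open>Q k i g\<close> is the integral of \<open>g\<close> against the product of P^k(x) - mu and
  P^i(y) - mu. The double series of the mixing condition then bounds all partial sums at once, with
  \<open>C\<close> as the only trace of \<open>g\<close>.\<close>

lemma sum_Q_le:
  assumes g: "dominated g" and can: "canonical g" and x: "x \<in> space M" and y: "y \<in> space M"
    and C: "0 \<le> C" "\<And>x y. x \<in> space M \<Longrightarrow> y \<in> space M \<Longrightarrow> \<bar>g (x, y)\<bar> \<le> C * V (x, y)"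
  shows "(\<Sum>k<N. \<Sum>i<b. \<bar>Q k i g (x, y)\<bar>) \<le> C * (c * W (x, y))"
proof -
  note [measurable] = dominated_measurable[OF g]
  let ?n = "\<lambda>k i. signed_measure_norm (M \<Otimes>\<^sub>M M) V (diff_signed_prod (K k x) \<mu> (K i y) \<mu>)"
  interpret mu: prob_space \<mu> by (rule prob_mu)
  interpret mm: pair_prob_space \<mu> \<mu> ..
  have b: "ennreal \<bar>Q k i g (x, y)\<bar> \<le> ennreal C * ?n k i" for k i
  proof -
    interpret Kx: prob_space "K k x" by (rule prob_K[OF x])
    interpret Ky: prob_space "K i y" by (rule prob_K[OF y])
    interpret Km: pair_prob_space "K k x" \<mu> ..
    interpret mK: pair_prob_space \<mu> "K i y" ..
    note int = dominated_integrable_pair[OF g x y]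
    have z: "(\<integral>w. g (u, w) \<partial>\<mu>) = 0" "(\<integral>w. g (w, u) \<partial>\<mu>) = 0" if "u \<in> space M" for u
      using can that by (auto simp: canonical_def)
    have 1: "(\<integral>z. g z \<partial>(K k x \<Otimes>\<^sub>M \<mu>)) = 0"
    proof -
      have "(\<integral>z. g z \<partial>(K k x \<Otimes>\<^sub>M \<mu>)) = (\<integral>u. (\<integral>w. g (u, w) \<partial>\<mu>) \<partial>K k x)"
        by (rule Km.integral_fst'[OF int(2), symmetric])
      also have "\<dots> = (\<integral>u. 0 \<partial>K k x)"
        using x by (intro Bochner_Integration.integral_cong[OF refl, of "K k x"]) (simp add: z)
      finally show ?thesis by simp
    qed
    have 2: "(\<integral>z. g z \<partial>(\<mu> \<Otimes>\<^sub>M K i y)) = 0"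
    proof -
      have "(\<integral>z. g z \<partial>(\<mu> \<Otimes>\<^sub>M K i y)) = (\<integral>w. (\<integral>u. g (u, w) \<partial>\<mu>) \<partial>K i y)"
        using mK.integral_snd[of "\<lambda>x y. g (x, y)"] int(3) by simp
      also have "\<dots> = (\<integral>u. 0 \<partial>K i y)"
        using y by (intro Bochner_Integration.integral_cong[OF refl, of "K i y"]) (simp add: z)
      finally show ?thesis by simp
    qed
    have 3: "(\<integral>z. g z \<partial>(\<mu> \<Otimes>\<^sub>M \<mu>)) = 0"
    proof -
      have "(\<integral>z. g z \<partial>(\<mu> \<Otimes>\<^sub>M \<mu>)) = (\<integral>u. (\<integral>w. g (u, w) \<partial>\<mu>) \<partial>\<mu>)"
        by (rule mm.integral_fst'[OF int(4), symmetric])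
      also have "\<dots> = (\<integral>u. 0 \<partial>\<mu>)"
        by (intro Bochner_Integration.integral_cong[OF refl, of \<mu>]) (simp add: z)
      finally show ?thesis by simp
    qed
    have "ennreal \<bar>Q k i g (x, y)\<bar> \<le> signed_measure_norm (M \<Otimes>\<^sub>M M) (\<lambda>z. C * V z) (diff_signed_prod (K k x) \<mu> (K i y) \<mu>)"
      using diff_signed_prod_integral_bound[OF prob_K[OF x] sets_K[OF x] prob_mu sets_mu prob_K[OF y] sets_K[OF y] prob_mu sets_mu,
          of g "\<lambda>z. C * V z" k i] int C(2) 1 2 3
      by (auto simp: Q_def space_pair_measure)
    also have "\<dots> = ennreal C * ?n k i"
      unfolding signed_measure_norm_def using C(1)
      by (subst nn_integral_cmult[symmetric]) (auto simp: ennreal_mult')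
    finally show ?thesis .
  qed
  have "ennreal (\<Sum>k<N. \<Sum>i<b. \<bar>Q k i g (x, y)\<bar>) = (\<Sum>k<N. \<Sum>i<b. ennreal \<bar>Q k i g (x, y)\<bar>)"
    by (simp add: sum_nonneg)
  also have "\<dots> \<le> (\<Sum>k<N. \<Sum>i<b. ennreal C * ?n k i)"
    by (intro sum_mono b)
  also have "\<dots> = ennreal C * (\<Sum>k<N. \<Sum>i<b. ?n k i)"
    by (simp add: sum_distrib_left)
  also have "\<dots> \<le> ennreal C * ennreal (c * W (x, y))"
  proof (intro mult_left_mono)
    have "(\<Sum>k<N. \<Sum>i<b. ?n k i) \<le> (\<Sum>k<N. \<Sum>i. ?n k i)"
      by (intro sum_mono sum_le_suminf) auto
    also have "\<dots> \<le> (\<Sum>k. \<Sum>i. ?n k i)"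
      by (intro sum_le_suminf) auto
    also have "\<dots> \<le> ennreal (c * W (x, y))" by (rule C2[OF x y])
    finally show "(\<Sum>k<N. \<Sum>i<b. ?n k i) \<le> ennreal (c * W (x, y))" .
  qed simp
  also have "\<dots> = ennreal (C * (c * W (x, y)))"
    using C(1) by (simp add: ennreal_mult')
  finally show ?thesis
    using V_ge_1[OF x y] V_le_W[OF x y] c_ge_1 C(1)
    by (subst (asm) ennreal_le_iff) (auto intro!: mult_nonneg_nonneg)
qed

end

section \<open>Decay of the total variation distance\<close>

context markov_kernel
begin

lemma bounded_integrable_K:
  fixes f :: "'a \<Rightarrow> real"
  assumes "f \<in> borel_measurable M" "\<And>z. z \<in> space M \<Longrightarrow> \<bar>f z\<bar> \<le> b" "x \<in> space M"
  shows "integrable (K k x) f"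
proof -
  interpret prob_space "K k x" by (rule prob_K) fact
  show ?thesis using assms by (intro integrable_const_bound[of _ b]) (auto cong: measurable_cong_sets)
qed

lemma bounded_integrable_mu:
  fixes f :: "'a \<Rightarrow> real"
  assumes "f \<in> borel_measurable M" "\<And>z. z \<in> space M \<Longrightarrow> \<bar>f z\<bar> \<le> b"
  shows "integrable \<mu> f"
proof -
  interpret prob_space \<mu> by (rule prob_mu)
  show ?thesis using assms by (intro integrable_const_bound[of _ b]) (auto cong: measurable_cong_sets)
qed

lemma abs_integral_K_le:
  fixes f :: "'a \<Rightarrow> real"
  assumes "f \<in> borel_measurable M" "\<And>z. z \<in> space M \<Longrightarrow> \<bar>f z\<bar> \<le> b" "x \<in> space M"
  shows "\<bar>\<integral>z. f z \<partial>K k x\<bar> \<le> b"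
proof -
  interpret prob_space "K k x" by (rule prob_K) fact
  have "\<bar>\<integral>z. f z \<partial>K k x\<bar> \<le> (\<integral>z. \<bar>f z\<bar> \<partial>K k x)" by (rule integral_abs_bound)
  also have "\<dots> \<le> b"
    using bounded_integrable_K[OF assms] assms by (intro integral_le_const) auto
  finally show ?thesis .
qed

lemma abs_integral_mu_le:
  fixes f :: "'a \<Rightarrow> real"
  assumes "f \<in> borel_measurable M" "\<And>z. z \<in> space M \<Longrightarrow> \<bar>f z\<bar> \<le> b"
  shows "\<bar>\<integral>z. f z \<partial>\<mu>\<bar> \<le> b"
proof -
  interpret prob_space \<mu> by (rule prob_mu)
  have "\<bar>\<integral>z. f z \<partial>\<mu>\<bar> \<le> (\<integral>z. \<bar>f z\<bar> \<partial>\<mu>)" by (rule integral_abs_bound)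
  also have "\<dots> \<le> b"
    using bounded_integrable_mu[OF assms] assms by (intro integral_le_const) auto
  finally show ?thesis .
qed

lemma integral_mu_K:
  fixes f :: "'a \<Rightarrow> real"
  assumes "f \<in> borel_measurable M" "integrable \<mu> f"
  shows "(\<integral>y. (\<integral>z. f z \<partial>K n y) \<partial>\<mu>) = (\<integral>z. f z \<partial>\<mu>)"
  using integral_bind_prob_algebra[of "K n" \<mu> M f] assms by (simp add: mu_K)

end

context product_ergodic_kernel
begin

text \<open>The norm of a product of two signed measures on \<open>f \<otimes> f\<close> factorises, so the double series in
  the mixing condition controls a square.\<close>

lemma ergodic_rate:
  fixes f :: "'a \<Rightarrow> real"
  assumes f [measurable]: "f \<in> borel_measurable M" and f1: "\<And>z. z \<in> space M \<Longrightarrow> \<bar>f z\<bar> \<le> 1" and x: "x \<in> space M"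
  shows "(real (Suc N))\<^sup>2 * ((\<integral>z. f z \<partial>K N x) - (\<integral>z. f z \<partial>\<mu>))\<^sup>2 \<le> c * W (x, x)"
proof -
  define e where "e = (\<integral>z. f z \<partial>K N x) - (\<integral>z. f z \<partial>\<mu>)"
  \<comment> \<open>With the test function P^(N-k) f, the integral under P^k equals that of
    \<open>f\<close> under P^N for every \<open>k\<close> up to \<open>N\<close>. Hence each of the
    (N+1)^2 terms of the mixing series with indices up to \<open>N\<close> is at least the same
    square.\<close>
  define F where "F k z = (\<integral>w. f w \<partial>K (N - k) z)" for k z
  let ?n = "\<lambda>k i. signed_measure_norm (M \<Otimes>\<^sub>M M) V (diff_signed_prod (K k x) \<mu> (K i x) \<mu>)"
  have Fm [measurable]: "F k \<in> borel_measurable M" for k unfolding F_def by measurable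
  have F1: "\<bar>F k z\<bar> \<le> 1" if "z \<in> space M" for k z
    unfolding F_def by (rule abs_integral_K_le) (use f1 that in auto)
  have FK: "(\<integral>z. F k z \<partial>K k x) = (\<integral>z. f z \<partial>K N x)" if "k \<le> N" for k
    using integral_K_add[OF x f, of k "N - k"] bounded_integrable_K[OF f f1 x] that by (simp add: F_def)
  have Fmu: "(\<integral>z. F k z \<partial>\<mu>) = (\<integral>z. f z \<partial>\<mu>)" for k
    unfolding F_def by (rule integral_mu_K[OF f bounded_integrable_mu[OF f f1]])
  have b: "ennreal (e\<^sup>2) \<le> ?n k i" if k: "k \<le> N" and i: "i \<le> N" for k i
  proof -
    define g where "g = (\<lambda>(z, w). F k z * F i w)"
    have gm [measurable]: "g \<in> borel_measurable (M \<Otimes>\<^sub>M M)" unfolding g_def by measurable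
    have g1: "\<bar>g (z, w)\<bar> \<le> 1" if "z \<in> space M" "w \<in> space M" for z w
      using mult_mono[OF F1[OF that(1), of k] F1[OF that(2), of i]] by (simp add: g_def abs_mult)
    have dg: "dominated g"
    proof (rule dominatedI[OF gm])
      show "\<bar>g (z, w)\<bar> \<le> 1 * V (z, w)" if "z \<in> space M" "w \<in> space M" for z w
        using g1[OF that] V_ge_1[OF that] by simp
    qed
    note int = dominated_integrable_pair[OF dg x x]
    have pr: "(\<integral>z. g z \<partial>(p \<Otimes>\<^sub>M q)) = (\<integral>z. F k z \<partial>p) * (\<integral>z. F i z \<partial>q)"
      if "prob_space p" "prob_space q" "integrable (p \<Otimes>\<^sub>M q) g" for p q
    proof -
      interpret p: prob_space p by fact
      interpret q: prob_space q by fact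
      interpret pq: pair_prob_space p q ..
      show ?thesis using pq.integral_fst'[OF that(3)] by (simp add: g_def)
    qed
    have "\<bar>(\<integral>z. g z \<partial>(K k x \<Otimes>\<^sub>M K i x)) - (\<integral>z. g z \<partial>(K k x \<Otimes>\<^sub>M \<mu>)) - (\<integral>z. g z \<partial>(\<mu> \<Otimes>\<^sub>M K i x)) + (\<integral>z. g z \<partial>(\<mu> \<Otimes>\<^sub>M \<mu>))\<bar> = e\<^sup>2"
    proof -
      let ?a = "\<integral>z. f z \<partial>K N x" and ?m = "\<integral>z. f z \<partial>\<mu>"
      have "(\<integral>z. g z \<partial>(K k x \<Otimes>\<^sub>M K i x)) = ?a * ?a" "(\<integral>z. g z \<partial>(K k x \<Otimes>\<^sub>M \<mu>)) = ?a * ?m"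
        "(\<integral>z. g z \<partial>(\<mu> \<Otimes>\<^sub>M K i x)) = ?m * ?a" "(\<integral>z. g z \<partial>(\<mu> \<Otimes>\<^sub>M \<mu>)) = ?m * ?m"
        using pr[OF prob_K[OF x] prob_K[OF x] int(1)] pr[OF prob_K[OF x] prob_mu int(2)]
          pr[OF prob_mu prob_K[OF x] int(3)] pr[OF prob_mu prob_mu int(4)] FK[OF k] FK[OF i] Fmu
        by simp_all
      moreover have "?a * ?a - ?a * ?m - ?m * ?a + ?m * ?m = e\<^sup>2"
        unfolding e_def power2_eq_square by (simp add: algebra_simps)
      ultimately show ?thesis by simp
    qed
    moreover have "ennreal \<bar>(\<integral>z. g z \<partial>(K k x \<Otimes>\<^sub>M K i x)) - (\<integral>z. g z \<partial>(K k x \<Otimes>\<^sub>M \<mu>)) - (\<integral>z. g z \<partial>(\<mu> \<Otimes>\<^sub>M K i x)) + (\<integral>z. g z \<partial>(\<mu> \<Otimes>\<^sub>M \<mu>))\<bar> \<le> ?n k i"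
    proof (rule diff_signed_prod_integral_bound[OF prob_K[OF x] sets_K[OF x] prob_mu sets_mu prob_K[OF x] sets_K[OF x] prob_mu sets_mu gm V _ int])
      fix u assume "u \<in> space (M \<Otimes>\<^sub>M M)"
      then obtain z w where u: "u = (z, w)" and "z \<in> space M" "w \<in> space M" by (auto simp: space_pair_measure)
      then show "\<bar>g u\<bar> \<le> V u" using g1[of z w] V_ge_1[of z w] by simp
    qed
    ultimately show ?thesis by simp
  qed
  have "ennreal ((real (Suc N))\<^sup>2 * e\<^sup>2) = (\<Sum>k<Suc N. \<Sum>i<Suc N. ennreal (e\<^sup>2))"
  proof -
    have "(\<Sum>k<Suc N. \<Sum>i<Suc N. ennreal (e\<^sup>2)) = ennreal (\<Sum>k<Suc N. \<Sum>i<Suc N. e\<^sup>2)"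
      by (simp only: sum_ennreal sum_nonneg zero_le_power2)
    also have "(\<Sum>k<Suc N. \<Sum>i<Suc N. e\<^sup>2) = (real (Suc N))\<^sup>2 * e\<^sup>2"
      by (simp only: sum_constant card_lessThan) (simp only: power2_eq_square mult.assoc)
    finally show ?thesis by simp
  qed
  also have "\<dots> \<le> (\<Sum>k<Suc N. \<Sum>i<Suc N. ?n k i)"
    by (intro sum_mono b) auto
  also have "\<dots> \<le> (\<Sum>k<Suc N. \<Sum>i. ?n k i)"
    by (intro sum_mono sum_le_suminf) auto
  also have "\<dots> \<le> (\<Sum>k. \<Sum>i. ?n k i)"
    by (intro sum_le_suminf) auto
  also have "\<dots> \<le> ennreal (c * W (x, x))" by (rule C2[OF x x])
  finally show ?thesis
    using V_ge_1[OF x x] V_le_W[OF x x] c_ge_1 unfolding e_def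
    by (subst (asm) ennreal_le_iff) (auto intro!: mult_nonneg_nonneg)
qed

text \<open>By \<open>ergodic_rate\<close> with \<open>N = 2\<^sup>i\<close>, the deviation is at most \<open>1/16\<close> off \<open>Bad i\<close>.\<close>

definition Bad :: "nat \<Rightarrow> 'a set" where
  "Bad i = {x \<in> space M. 4 ^ i / 256 < c * W (x, x)}"

text \<open>A recursion for the deviation after 2^i steps, started at the trivial bound 2 for test
  functions bounded by 1. Doubling the time gains a factor 1/16 off \<open>Bad i\<close>; on that
  set the deviation is at most 2, and it is weighed both under \<open>K (2 ^ i) x\<close> and under
  mu. The gain has to be better than 1/8 for the decay 8^-i that is aimed at.\<close>

primrec tv_rate :: "nat \<Rightarrow> 'a \<Rightarrow> real" where
  "tv_rate 0 x = 2"
| "tv_rate (Suc i) x = tv_rate i x / 16 + 2 * measure (K (2 ^ i) x) (Bad i) + 2 * measure \<mu> (Bad i)"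

lemma Bad_measurable [measurable]: "Bad i \<in> sets M"
  unfolding Bad_def by measurable

lemma tv_rate_nonneg: "0 \<le> tv_rate i x"
  by (induction i) auto

lemma tv_rate_measurable [measurable]: "tv_rate i \<in> borel_measurable M"
proof (induction i)
  case (Suc i)
  have "(\<lambda>x. measure (K (2 ^ i) x) (Bad i)) \<in> borel_measurable M"
    by (rule measurable_compose[OF K_measurable_subprob measurable_measure_subprob_algebra]) measurable
  then show ?case using Suc by (auto intro!: borel_measurable_add borel_measurable_divide)
qed simp

text \<open>Let \<open>G\<close> be the deviation after 2^i steps as a function of the starting
  point. Invariance gives mu G = 0, so the deviation of \<open>f\<close> after 2^(i+1) steps is that
  of \<open>G\<close> after 2^i. Off the bad set 16 G is again an admissible test function, which is
  why the induction ranges over all \<open>f\<close>.\<close>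

lemma tv_rate_bound:
  fixes f :: "'a \<Rightarrow> real"
  assumes "f \<in> borel_measurable M" "\<And>z. z \<in> space M \<Longrightarrow> \<bar>f z\<bar> \<le> 1" "x \<in> space M"
  shows "\<bar>(\<integral>z. f z \<partial>K (2 ^ i) x) - (\<integral>z. f z \<partial>\<mu>)\<bar> \<le> tv_rate i x"
  using assms
proof (induction i arbitrary: f)
  case 0
  then show ?case
    using abs_integral_K_le[OF 0, of "2 ^ 0"] abs_integral_mu_le[OF 0(1,2)] by fastforce
next
  case (Suc i)
  note [measurable] = Suc.prems(1)
  note x = Suc.prems(3)
  let ?m = "\<integral>z. f z \<partial>\<mu>" and ?k = "2 ^ i :: nat"
  define G where "G z = (\<integral>w. f w \<partial>K ?k z) - ?m" for z
  have [measurable]: "G \<in> borel_measurable M" unfolding G_def by measurable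
  have G2: "\<bar>G z\<bar> \<le> 2" if "z \<in> space M" for z
    using abs_integral_K_le[OF Suc.prems(1,2) that, of ?k] abs_integral_mu_le[OF Suc.prems(1,2)] by (simp add: G_def)
  have Gs: "\<bar>G z\<bar> \<le> 1 / 16" if z: "z \<in> space M" "z \<notin> Bad i" for z
  proof -
    have "4 ^ i * (G z)\<^sup>2 \<le> (real (Suc ?k))\<^sup>2 * (G z)\<^sup>2"
    proof (intro mult_right_mono)
      have "(2 ^ i :: real)\<^sup>2 \<le> (real (Suc ?k))\<^sup>2" by (intro power_mono) auto
      then show "4 ^ i \<le> (real (Suc ?k))\<^sup>2" by (simp add: power2_eq_square flip: power_mult_distrib)
    qed simp
    also have "\<dots> \<le> c * W (z, z)" unfolding G_def by (rule ergodic_rate[OF Suc.prems(1,2) z(1)])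
    also have "\<dots> \<le> 4 ^ i / 256" using z by (auto simp: Bad_def not_less)
    finally have "4 ^ i * (G z)\<^sup>2 \<le> 4 ^ i * (1 / 16)\<^sup>2" by (simp add: power2_eq_square)
    then have "(G z)\<^sup>2 \<le> (1 / 16)\<^sup>2" by (subst (asm) mult_le_cancel_left_pos) auto
    then have "\<bar>G z\<bar> \<le> \<bar>1 / 16\<bar>" unfolding abs_le_square_iff .
    then show ?thesis by simp
  qed
  define H where "H z = 16 * (G z * indicator (space M - Bad i) z)" for z
  define R where "R z = G z * indicator (Bad i) z" for z
  have [measurable]: "H \<in> borel_measurable M" "R \<in> borel_measurable M" unfolding H_def R_def by measurable
  have H1: "\<bar>H z\<bar> \<le> 1" if "z \<in> space M" for z
    using Gs[OF that] that by (auto simp: H_def split: split_indicator)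
  have R2: "\<bar>R z\<bar> \<le> 2 * indicator (Bad i) z" if "z \<in> space M" for z
    using G2[OF that] by (auto simp: R_def split: split_indicator)
  have R2': "\<bar>R z\<bar> \<le> 2" if "z \<in> space M" for z
    using R2[OF that] by (auto split: split_indicator_asm)
  have GHR: "G z = H z / 16 + R z" if "z \<in> space M" for z
    using that by (auto simp: H_def R_def split: split_indicator)
  have iH: "integrable (K ?k x) H" "integrable \<mu> H" and iR: "integrable (K ?k x) R" "integrable \<mu> R"
    by (rule bounded_integrable_K[OF _ H1 x], measurable, rule bounded_integrable_mu[OF _ H1], measurable,
        rule bounded_integrable_K[OF _ R2' x], measurable, rule bounded_integrable_mu[OF _ R2'], measurable)
  interpret mu: prob_space \<mu> by (rule prob_mu)
  interpret Kx: prob_space "K ?k x" by (rule prob_K[OF x])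
  have f_int: "integrable (K k x) f" "integrable \<mu> f" for k
    using bounded_integrable_K[OF Suc.prems] bounded_integrable_mu[OF Suc.prems(1,2)] by auto
  have KG: "(\<integral>z. f z \<partial>K (2 ^ Suc i) x) - ?m = (\<integral>z. G z \<partial>K ?k x)"
  proof -
    have "(\<integral>z. f z \<partial>K (2 ^ Suc i) x) = (\<integral>z. (\<integral>w. f w \<partial>K ?k z) \<partial>K ?k x)"
      using integral_K_add[OF x Suc.prems(1) f_int(1), of ?k ?k] by (simp add: mult_2)
    moreover have "integrable (K ?k x) (\<lambda>z. \<integral>w. f w \<partial>K ?k z)"
      by (rule bounded_integrable_K[OF _ abs_integral_K_le[OF Suc.prems(1,2)] x]) auto
    ultimately show ?thesis
      using Kx.prob_space x unfolding G_def by (subst Bochner_Integration.integral_diff) auto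
  qed
  have muG: "(\<integral>z. G z \<partial>\<mu>) = 0"
  proof -
    have "integrable \<mu> (\<lambda>z. \<integral>w. f w \<partial>K ?k z)"
      by (rule bounded_integrable_mu[OF _ abs_integral_K_le[OF Suc.prems(1,2)]]) auto
    then show ?thesis
      using mu.prob_space integral_mu_K[OF Suc.prems(1) f_int(2), of ?k]
      unfolding G_def by (subst Bochner_Integration.integral_diff) auto
  qed
  have K_dec: "(\<integral>z. G z \<partial>K ?k x) = (\<integral>z. H z \<partial>K ?k x) / 16 + (\<integral>z. R z \<partial>K ?k x)"
  proof -
    have "(\<integral>z. G z \<partial>K ?k x) = (\<integral>z. H z / 16 + R z \<partial>K ?k x)"
      using x by (intro Bochner_Integration.integral_cong[OF refl, of "K ?k x"]) (simp add: GHR)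
    then show ?thesis using iH iR by simp
  qed
  have mu_dec: "(\<integral>z. G z \<partial>\<mu>) = (\<integral>z. H z \<partial>\<mu>) / 16 + (\<integral>z. R z \<partial>\<mu>)"
  proof -
    have "(\<integral>z. G z \<partial>\<mu>) = (\<integral>z. H z / 16 + R z \<partial>\<mu>)"
      by (intro Bochner_Integration.integral_cong[OF refl, of \<mu>]) (simp add: GHR)
    then show ?thesis using iH iR by simp
  qed
  have "\<bar>\<integral>z. R z \<partial>K ?k x\<bar> \<le> (\<integral>z. 2 * indicator (Bad i) z \<partial>K ?k x)"
    using x R2 iR by (intro order_trans[OF integral_abs_bound] integral_mono) (auto simp: Kx.emeasure_eq_measure)
  then have RK: "\<bar>\<integral>z. R z \<partial>K ?k x\<bar> \<le> 2 * measure (K ?k x) (Bad i)"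
    using x by simp
  have "\<bar>\<integral>z. R z \<partial>\<mu>\<bar> \<le> (\<integral>z. 2 * indicator (Bad i) z \<partial>\<mu>)"
    using R2 iR by (intro order_trans[OF integral_abs_bound] integral_mono) (auto simp: mu.emeasure_eq_measure)
  then have Rmu: "\<bar>\<integral>z. R z \<partial>\<mu>\<bar> \<le> 2 * measure \<mu> (Bad i)"
    by simp
  have "\<bar>(\<integral>z. H z \<partial>K ?k x) - (\<integral>z. H z \<partial>\<mu>)\<bar> \<le> tv_rate i x"
    by (rule Suc.IH) (use H1 x in auto)
  then show ?case
    using KG muG K_dec mu_dec RK Rmu unfolding tv_rate.simps by linarith
qed

text \<open>The rate is a parameter, so that both the slow bound \<open>ergodic_rate'\<close> and
  the fast one \<open>tv_rate_bound\<close> can be inserted. Dividing by \<open>a\<close> makes the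
  bounded function an admissible test function.\<close>

lemma nn_integral_K_le_mu:
  fixes \<phi> :: "'a \<Rightarrow> ennreal"
  assumes [measurable]: "\<phi> \<in> borel_measurable M" and le: "\<And>z. z \<in> space M \<Longrightarrow> \<phi> z \<le> ennreal a"
    and x: "x \<in> space M" and rate: "\<And>f :: 'a \<Rightarrow> real. f \<in> borel_measurable M \<Longrightarrow> (\<And>z. z \<in> space M \<Longrightarrow> \<bar>f z\<bar> \<le> 1) \<Longrightarrow>
       \<bar>(\<integral>z. f z \<partial>K k x) - (\<integral>z. f z \<partial>\<mu>)\<bar> \<le> r"
  shows "(\<integral>\<^sup>+z. \<phi> z \<partial>K k x) \<le> (\<integral>\<^sup>+z. \<phi> z \<partial>\<mu>) + ennreal (a * r)"
    and "(\<integral>\<^sup>+z. \<phi> z \<partial>\<mu>) \<le> (\<integral>\<^sup>+z. \<phi> z \<partial>K k x) + ennreal (a * r)"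
proof -
  have "(\<integral>\<^sup>+z. \<phi> z \<partial>K k x) \<le> (\<integral>\<^sup>+z. \<phi> z \<partial>\<mu>) + ennreal (a * r) \<and>
      (\<integral>\<^sup>+z. \<phi> z \<partial>\<mu>) \<le> (\<integral>\<^sup>+z. \<phi> z \<partial>K k x) + ennreal (a * r)"
  proof (cases "0 < a")
    case False
    then have z: "\<phi> z = 0" if "z \<in> space M" for z
      using le[OF that] by (simp add: ennreal_neg)
    have "(\<integral>\<^sup>+z. \<phi> z \<partial>K k x) = (\<integral>\<^sup>+z. 0 \<partial>K k x)" using x z by (intro nn_integral_cong) simp
    moreover have "(\<integral>\<^sup>+z. \<phi> z \<partial>\<mu>) = (\<integral>\<^sup>+z. 0 \<partial>\<mu>)" using z by (intro nn_integral_cong) simp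
    ultimately show ?thesis by simp
  next
    case True
    define f where "f z = enn2real (\<phi> z) / a" for z
    have [measurable]: "f \<in> borel_measurable M" unfolding f_def by measurable
    have \<phi>f: "\<phi> z = ennreal (a * f z)" and f1: "\<bar>f z\<bar> \<le> 1" if "z \<in> space M" for z
    proof -
      have lt: "\<phi> z < top" using le[OF that] by (rule le_less_trans) simp
      then show "\<phi> z = ennreal (a * f z)" using True by (simp add: f_def)
      have "enn2real (\<phi> z) \<le> a" using le[OF that] True by (simp add: enn2real_leI)
      then show "\<bar>f z\<bar> \<le> 1" using True by (simp add: f_def)
    qed
    have f0: "0 \<le> f z" for z using True by (simp add: f_def)
    have I: "(\<integral>\<^sup>+z. \<phi> z \<partial>m) = ennreal (a * (\<integral>z. f z \<partial>m))" if "space m = space M" "integrable m f" for m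
    proof -
      have "(\<integral>\<^sup>+z. \<phi> z \<partial>m) = (\<integral>\<^sup>+z. ennreal (a * f z) \<partial>m)" using that \<phi>f by (intro nn_integral_cong) simp
      also have "\<dots> = ennreal (\<integral>z. a * f z \<partial>m)" using that f0 True by (intro nn_integral_eq_integral) auto
      finally show ?thesis by simp
    qed
    have "\<bar>(\<integral>z. f z \<partial>K k x) - (\<integral>z. f z \<partial>\<mu>)\<bar> \<le> r" by (rule rate) (use f1 in auto)
    then have "a * \<bar>(\<integral>z. f z \<partial>K k x) - (\<integral>z. f z \<partial>\<mu>)\<bar> \<le> a * r" using True by (intro mult_left_mono) auto
    moreover have "a * \<bar>(\<integral>z. f z \<partial>K k x) - (\<integral>z. f z \<partial>\<mu>)\<bar> = \<bar>a * (\<integral>z. f z \<partial>K k x) - a * (\<integral>z. f z \<partial>\<mu>)\<bar>"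
      using True by (simp add: abs_mult flip: right_diff_distrib)
    moreover have "0 \<le> a * (\<integral>z. f z \<partial>K k x)" "0 \<le> a * (\<integral>z. f z \<partial>\<mu>)"
      using True f0 by (auto intro!: mult_nonneg_nonneg)
    moreover have "(\<integral>\<^sup>+z. \<phi> z \<partial>K k x) = ennreal (a * (\<integral>z. f z \<partial>K k x))" "(\<integral>\<^sup>+z. \<phi> z \<partial>\<mu>) = ennreal (a * (\<integral>z. f z \<partial>\<mu>))"
      by (rule I[OF space_K[OF x] bounded_integrable_K[OF _ f1 x]], measurable, rule I[OF space_mu bounded_integrable_mu[OF _ f1]], measurable)
    ultimately show ?thesis by (auto intro!: ennreal_leI simp flip: ennreal_plus)
  qed
  then show "(\<integral>\<^sup>+z. \<phi> z \<partial>K k x) \<le> (\<integral>\<^sup>+z. \<phi> z \<partial>\<mu>) + ennreal (a * r)"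
    and "(\<integral>\<^sup>+z. \<phi> z \<partial>\<mu>) \<le> (\<integral>\<^sup>+z. \<phi> z \<partial>K k x) + ennreal (a * r)" by auto
qed

lemma W_ge_1: "x \<in> space M \<Longrightarrow> y \<in> space M \<Longrightarrow> 1 \<le> W (x, y)"
  using V_ge_1[of x y] V_le_W[of x y] by linarith

text \<open>The natural dependence is on the square root of \<open>W\<close>. It is weakened to a
  square, using that \<open>W\<close> and \<open>c\<close> are at least 1, because the second moment
  of \<open>W\<close> is what is controlled along the chain.\<close>

lemma ergodic_rate':
  fixes f :: "'a \<Rightarrow> real"
  assumes f: "f \<in> borel_measurable M" "\<And>z. z \<in> space M \<Longrightarrow> \<bar>f z\<bar> \<le> 1" and x: "x \<in> space M"
  shows "\<bar>(\<integral>z. f z \<partial>K N x) - (\<integral>z. f z \<partial>\<mu>)\<bar> \<le> c * (W (x, x))\<^sup>2 / real (Suc N)"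
proof -
  let ?e = "(\<integral>z. f z \<partial>K N x) - (\<integral>z. f z \<partial>\<mu>)"
  have w: "1 \<le> W (x, x)" "1 \<le> c" using W_ge_1[OF x x] c_ge_1 by auto
  have "(real (Suc N) * ?e)\<^sup>2 \<le> c * W (x, x)" using ergodic_rate[OF f x, of N] by (simp add: power_mult_distrib)
  also have "\<dots> \<le> (c * (W (x, x))\<^sup>2)\<^sup>2"
  proof -
    have "1 \<le> c * (W (x, x))\<^sup>2" using w by (simp add: one_le_power mult_ge1_I)
    then have "c * (W (x, x))\<^sup>2 \<le> (c * (W (x, x))\<^sup>2)\<^sup>2" by (rule self_le_power) simp
    moreover have "c * W (x, x) \<le> c * (W (x, x))\<^sup>2" using w by (intro mult_left_mono self_le_power) auto
    ultimately show ?thesis by linarith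
  qed
  finally have "\<bar>real (Suc N) * ?e\<bar> \<le> \<bar>c * (W (x, x))\<^sup>2\<bar>" unfolding abs_le_square_iff .
  then have "real (Suc N) * \<bar>?e\<bar> \<le> c * (W (x, x))\<^sup>2" using w by (simp add: abs_mult)
  then show ?thesis by (simp add: pos_le_divide_eq mult.commute)
qed

end

section \<open>Markov chains and martingale differences\<close>

text \<open>No integrability is assumed: if \<open>F\<close> is not square integrable, the right-hand side is infinite.\<close>

lemma power2_drift_le:
  fixes F :: "'a \<Rightarrow> real"
  assumes p: "prob_space p" and F [measurable]: "F \<in> borel_measurable p"
  shows "(\<integral>\<^sup>+z. ennreal ((s + (F z - (\<integral>z. F z \<partial>p)))\<^sup>2) \<partial>p) \<le> ennreal (s\<^sup>2) + (\<integral>\<^sup>+z. ennreal ((F z)\<^sup>2) \<partial>p)"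
proof (cases "(\<integral>\<^sup>+z. ennreal ((F z)\<^sup>2) \<partial>p) = \<infinity>")
  case False
  interpret prob_space p by fact
  have i2: "integrable p (\<lambda>z. (F z)\<^sup>2)"
    using False by (intro integrableI_nonneg) (auto simp: top.not_eq_extremum)
  have i: "integrable p F" by (rule square_integrable_imp_integrable[OF F i2])
  let ?m = "\<integral>z. F z \<partial>p"
  have e: "(s + (F z - ?m))\<^sup>2 = (s - ?m)\<^sup>2 + 2 * (s - ?m) * F z + (F z)\<^sup>2" for z
    by (simp add: power2_eq_square algebra_simps)
  have "(\<integral>\<^sup>+z. ennreal ((s + (F z - ?m))\<^sup>2) \<partial>p) = ennreal (\<integral>z. (s + (F z - ?m))\<^sup>2 \<partial>p)"
  proof (rule nn_integral_eq_integral)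
    show "integrable p (\<lambda>z. (s + (F z - ?m))\<^sup>2)" unfolding e using i i2 by simp
  qed simp
  also have "(\<integral>z. (s + (F z - ?m))\<^sup>2 \<partial>p) = (s - ?m)\<^sup>2 + 2 * (s - ?m) * ?m + (\<integral>z. (F z)\<^sup>2 \<partial>p)"
    unfolding e using i i2 prob_space by simp
  also have "\<dots> = s\<^sup>2 - ?m\<^sup>2 + (\<integral>z. (F z)\<^sup>2 \<partial>p)"
    by (simp add: power2_eq_square algebra_simps)
  also have "ennreal \<dots> \<le> ennreal (s\<^sup>2 + (\<integral>z. (F z)\<^sup>2 \<partial>p))"
    by (intro ennreal_leI) simp
  also have "\<dots> = ennreal (s\<^sup>2) + (\<integral>\<^sup>+z. ennreal ((F z)\<^sup>2) \<partial>p)"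
    using i2 by (simp add: nn_integral_eq_integral)
  finally show ?thesis .
qed simp

locale kernel_chain = markov_kernel +
  fixes \<Omega> :: "'w measure" and \<rho> :: "'a measure" and X :: "nat \<Rightarrow> 'w \<Rightarrow> 'a"
  assumes chain: "markov_chain \<Omega> M P \<rho> X"
begin

abbreviation "Fil \<equiv> natural_filtration \<Omega> M X"

lemma prob_Omega: "prob_space \<Omega>" and X_measurable [measurable]: "X n \<in> \<Omega> \<rightarrow>\<^sub>M M"
  using chain by (auto simp: markov_chain_def)

lemma space_Fil [simp]: "space (Fil n) = space \<Omega>"
  by (simp add: natural_filtration_def)

lemma measurable_X_Fil [measurable (raw)]: "i \<le> n \<Longrightarrow> X i \<in> Fil n \<rightarrow>\<^sub>M M"
proof -
  assume i: "i \<le> n"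
  have "(\<lambda>\<omega>. \<lambda>i\<in>{..n}. X i \<omega>) \<in> Fil n \<rightarrow>\<^sub>M Pi\<^sub>M {..n} (\<lambda>_. M)"
    unfolding natural_filtration_def
    using measurable_space[OF X_measurable] by (intro measurable_vimage_algebra1) (auto simp: space_PiM)
  from measurable_compose[OF this measurable_component_singleton[of i]] show ?thesis using i by simp
qed

text \<open>Inclusion of sigma-algebras is phrased as measurability of the identity, so that
  adaptedness follows by composition.\<close>

lemma measurable_id_Fil:
  assumes "\<And>i. i \<le> n \<Longrightarrow> X i \<in> N \<rightarrow>\<^sub>M M" "space N = space \<Omega>"
  shows "(\<lambda>\<omega>. \<omega>) \<in> N \<rightarrow>\<^sub>M Fil n"
  unfolding natural_filtration_def
  by (rule measurable_vimage_algebra2) (use assms in \<open>auto intro!: measurable_restrict\<close>)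

lemma measurable_id_Fil_mono [measurable (raw)]: "m \<le> n \<Longrightarrow> (\<lambda>\<omega>. \<omega>) \<in> Fil n \<rightarrow>\<^sub>M Fil m"
  by (rule measurable_id_Fil) auto

lemma measurable_id_Fil_Omega [measurable]: "(\<lambda>\<omega>. \<omega>) \<in> \<Omega> \<rightarrow>\<^sub>M Fil n"
  by (rule measurable_id_Fil) auto

lemma measurable_Fil_mono: "f \<in> Fil m \<rightarrow>\<^sub>M N \<Longrightarrow> m \<le> n \<Longrightarrow> f \<in> Fil n \<rightarrow>\<^sub>M N"
  using measurable_compose[OF measurable_id_Fil_mono] by fast

lemma measurable_Fil_Omega: "f \<in> Fil m \<rightarrow>\<^sub>M N \<Longrightarrow> f \<in> \<Omega> \<rightarrow>\<^sub>M N"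
  using measurable_compose[OF measurable_id_Fil_Omega] by fast

lemma measurable_Fil_pair_mono:
  assumes [measurable]: "f \<in> Fil m \<Otimes>\<^sub>M M \<rightarrow>\<^sub>M N" and mn: "m \<le> n"
  shows "f \<in> Fil n \<Otimes>\<^sub>M M \<rightarrow>\<^sub>M N"
proof -
  note [measurable] = measurable_id_Fil_mono[OF mn]
  have "(\<lambda>z. (fst z, snd z)) \<in> Fil n \<Otimes>\<^sub>M M \<rightarrow>\<^sub>M Fil m \<Otimes>\<^sub>M M"
    by (intro measurable_Pair measurable_compose[OF measurable_fst measurable_id_Fil_mono[OF mn]]) auto
  from measurable_compose[OF this assms(1)] show ?thesis by simp
qed

lemma subalgebra_Fil: "subalgebra \<Omega> (Fil n)"
proof -
  have "sets (Fil n) \<subseteq> sets \<Omega>"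
  proof
    fix A assume A: "A \<in> sets (Fil n)"
    from measurable_sets[OF measurable_id_Fil_Omega this] have "(\<lambda>\<omega>. \<omega>) -` A \<inter> space \<Omega> \<in> sets \<Omega>" .
    moreover have "(\<lambda>\<omega>. \<omega>) -` A \<inter> space \<Omega> = A" using sets.sets_into_space[OF A] by auto
    ultimately show "A \<in> sets \<Omega>" by simp
  qed
  then show ?thesis by (simp add: subalgebra_def)
qed

text \<open>The Markov property in \<open>markov_chain\<close> is an almost sure identity for each
  \<open>C\<close> separately. Integrating over an event of the past removes the exceptional
  sets.\<close>

lemma markov_rectangle:
  assumes A: "A \<in> sets (Fil n)" and C: "C \<in> sets M"
  shows "emeasure \<Omega> (A \<inter> (X (Suc n) -` C \<inter> space \<Omega>)) = (\<integral>\<^sup>+\<omega>. indicator A \<omega> * emeasure (P (X n \<omega>)) C \<partial>\<Omega>)"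
proof -
  interpret prob_space \<Omega> by (rule prob_Omega)
  interpret finite_measure_subalgebra \<Omega> "Fil n" by unfold_locales (rule subalgebra_Fil)
  have A' [measurable]: "A \<in> sets \<Omega>" using A subalgebra_Fil by (auto simp: subalgebra_def)
  let ?S = "X (Suc n) -` C \<inter> space \<Omega>"
  have S [measurable]: "?S \<in> sets \<Omega>" using C by measurable
  have Pm [measurable]: "(\<lambda>\<omega>. measure (P (X n \<omega>)) C) \<in> borel_measurable \<Omega>"
    by (rule measurable_compose[OF _ measurable_compose[OF P_measurable_subprob measurable_measure_subprob_algebra[OF C]]]) measurable
  have P1: "prob_space (P (X n \<omega>))" if "\<omega> \<in> space \<Omega>" for \<omega>
    using measurable_space[OF X_measurable that] by (rule prob_P)
  have int: "integrable \<Omega> (\<lambda>\<omega>. indicator A \<omega> * measure (P (X n \<omega>)) C)"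
    by (rule integrable_const_bound[of _ 1]) (auto intro!: AE_I2 mult_le_one prob_space.prob_le_1 P1)
  have "(\<integral>\<omega>\<in>A. indicator ?S \<omega> \<partial>\<Omega>) = (\<integral>\<omega>\<in>A. real_cond_exp \<Omega> (Fil n) (indicator ?S) \<omega> \<partial>\<Omega>)"
    by (rule real_cond_exp_intA[OF integrable_real_indicator A]) (auto simp: emeasure_eq_measure)
  also have "\<dots> = (\<integral>\<omega>\<in>A. measure (P (X n \<omega>)) C \<partial>\<Omega>)"
    unfolding set_lebesgue_integral_def
  proof (rule integral_cong_AE)
    have "AE \<omega> in \<Omega>. real_cond_exp \<Omega> (Fil n) (indicator ?S) \<omega> = measure (P (X n \<omega>)) C"
      using chain C unfolding markov_chain_def by blast
    then show "AE \<omega> in \<Omega>. indicator A \<omega> *\<^sub>R real_cond_exp \<Omega> (Fil n) (indicator ?S) \<omega> = indicator A \<omega> *\<^sub>R measure (P (X n \<omega>)) C"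
      by eventually_elim simp
  qed auto
  finally have e: "(\<integral>\<omega>. indicator A \<omega> * indicator ?S \<omega> \<partial>\<Omega>) = (\<integral>\<omega>. indicator A \<omega> * measure (P (X n \<omega>)) C \<partial>\<Omega>)"
    by (simp add: set_lebesgue_integral_def)
  have "emeasure \<Omega> (A \<inter> ?S) = ennreal (\<integral>\<omega>. indicator A \<omega> * indicator ?S \<omega> \<partial>\<Omega>)"
    by (simp add: emeasure_eq_measure indicator_inter_arith[symmetric])
  also have "\<dots> = ennreal (\<integral>\<omega>. indicator A \<omega> * measure (P (X n \<omega>)) C \<partial>\<Omega>)" by (simp add: e)
  also have "\<dots> = (\<integral>\<^sup>+\<omega>. ennreal (indicator A \<omega> * measure (P (X n \<omega>)) C) \<partial>\<Omega>)"
    by (rule nn_integral_eq_integral[symmetric, OF int]) auto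
  also have "\<dots> = (\<integral>\<^sup>+\<omega>. indicator A \<omega> * emeasure (P (X n \<omega>)) C \<partial>\<Omega>)"
  proof (rule nn_integral_cong)
    fix \<omega> assume "\<omega> \<in> space \<Omega>"
    then interpret Px: prob_space "P (X n \<omega>)" by (rule P1)
    show "ennreal (indicator A \<omega> * measure (P (X n \<omega>)) C) = indicator A \<omega> * emeasure (P (X n \<omega>)) C"
      by (auto simp: Px.emeasure_eq_measure split: split_indicator)
  qed
  finally show ?thesis .
qed

text \<open>Since \<open>\<psi>\<close> may depend on the whole past, the Markov property is used as
  an identity of joint laws on \<open>Fil n\<close> times \<open>M\<close>. Rectangles form a
  generator stable under intersection, and \<open>markov_rectangle\<close> says that the two laws
  agree there.\<close>

lemma nn_integral_markov_step:
  assumes \<psi> [measurable]: "(\<lambda>(\<omega>, z). \<psi> \<omega> z) \<in> borel_measurable (Fil n \<Otimes>\<^sub>M M)"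
  shows "(\<integral>\<^sup>+\<omega>. \<psi> \<omega> (X (Suc n) \<omega>) \<partial>\<Omega>) = (\<integral>\<^sup>+\<omega>. (\<integral>\<^sup>+z. \<psi> \<omega> z \<partial>P (X n \<omega>)) \<partial>\<Omega>)"
proof -
  interpret prob_space \<Omega> by (rule prob_Omega)
  define N1 where "N1 = distr \<Omega> (Fil n \<Otimes>\<^sub>M M) (\<lambda>\<omega>. (\<omega>, X (Suc n) \<omega>))"
  define L where "L \<omega> = distr (P (X n \<omega>)) (Fil n \<Otimes>\<^sub>M M) (\<lambda>z. (\<omega>, z))" for \<omega>
  define N2 where "N2 = \<Omega> \<bind> L"
  have L [measurable]: "L \<in> \<Omega> \<rightarrow>\<^sub>M subprob_algebra (Fil n \<Otimes>\<^sub>M M)"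
    unfolding L_def
  proof (rule measurable_distr2[where M=M])
    show "(\<lambda>(\<omega>, z). (\<omega>, z)) \<in> \<Omega> \<Otimes>\<^sub>M M \<rightarrow>\<^sub>M Fil n \<Otimes>\<^sub>M M"
      unfolding case_prod_beta'
      by (intro measurable_Pair measurable_compose[OF measurable_fst measurable_id_Fil_Omega]) auto
  qed measurable
  have pm: "(\<lambda>\<omega>. (\<omega>, X (Suc n) \<omega>)) \<in> \<Omega> \<rightarrow>\<^sub>M Fil n \<Otimes>\<^sub>M M"
    by (intro measurable_Pair) auto
  have pz: "(\<lambda>z. (\<omega>, z)) \<in> P (X n \<omega>) \<rightarrow>\<^sub>M Fil n \<Otimes>\<^sub>M M" if "\<omega> \<in> space \<Omega>" for \<omega>
    using that sets_P[OF measurable_space[OF X_measurable that, of n]]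
    by (subst measurable_cong_sets[OF _ refl, of _ M]) auto
  have sL: "sets (L \<omega>) = sets (Fil n \<Otimes>\<^sub>M M)" for \<omega> by (simp add: L_def)
  have N12: "N1 = N2"
  proof (rule measure_eqI_generator_eq)
    let ?E = "{a \<times> b | a b. a \<in> sets (Fil n) \<and> b \<in> sets M}"
    show "Int_stable ?E" by (rule Int_stable_pair_measure_generator)
    show "?E \<subseteq> Pow (space \<Omega> \<times> space M)"
      using pair_measure_closed[of "Fil n" M] by simp
    show "sets N1 = sigma_sets (space \<Omega> \<times> space M) ?E"
      unfolding N1_def by (simp add: sets_pair_measure)
    show "sets N2 = sigma_sets (space \<Omega> \<times> space M) ?E"
      unfolding N2_def using not_empty by (simp add: sets_bind[OF sL] sets_pair_measure)
    show "range (\<lambda>i::nat. space \<Omega> \<times> space M) \<subseteq> ?E"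
      using sets.top[of "Fil n"] by auto
    show "(\<Union>i::nat. space \<Omega> \<times> space M) = space \<Omega> \<times> space M" by simp
    show "emeasure N1 (space \<Omega> \<times> space M) \<noteq> \<infinity>" for i :: nat
    proof -
      have "prob_space N1" unfolding N1_def by (rule prob_space_distr[OF pm])
      then interpret N1: prob_space N1 .
      show ?thesis by simp
    qed
    fix E assume "E \<in> ?E"
    then obtain A C where E: "E = A \<times> C" and A: "A \<in> sets (Fil n)" and C: "C \<in> sets M" by blast
    have E': "A \<times> C \<in> sets (Fil n \<Otimes>\<^sub>M M)" using A C by simp
    have "emeasure N1 E = emeasure \<Omega> (A \<inter> (X (Suc n) -` C \<inter> space \<Omega>))"
      unfolding N1_def E emeasure_distr[OF pm E'] by (rule arg_cong[of _ _ "emeasure \<Omega>"]) auto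
    also have "\<dots> = (\<integral>\<^sup>+\<omega>. indicator A \<omega> * emeasure (P (X n \<omega>)) C \<partial>\<Omega>)"
      by (rule markov_rectangle[OF A C])
    also have "\<dots> = (\<integral>\<^sup>+\<omega>. emeasure (L \<omega>) (A \<times> C) \<partial>\<Omega>)"
    proof (rule nn_integral_cong)
      fix \<omega> assume w: "\<omega> \<in> space \<Omega>"
      have "emeasure (L \<omega>) (A \<times> C) = emeasure (P (X n \<omega>)) ((\<lambda>z. (\<omega>, z)) -` (A \<times> C) \<inter> space (P (X n \<omega>)))"
        unfolding L_def by (rule emeasure_distr[OF pz[OF w] E'])
      also have "(\<lambda>z. (\<omega>, z)) -` (A \<times> C) \<inter> space (P (X n \<omega>)) = (if \<omega> \<in> A then C else {})"
        using sets.sets_into_space[OF C] space_P[OF measurable_space[OF X_measurable w]] by auto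
      finally show "indicator A \<omega> * emeasure (P (X n \<omega>)) C = emeasure (L \<omega>) (A \<times> C)" by simp
    qed
    also have "\<dots> = emeasure N2 E"
      unfolding N2_def E using not_empty by (intro emeasure_bind[OF _ L E', symmetric]) auto
    finally show "emeasure N1 E = emeasure N2 E" .
  qed
  have "(\<integral>\<^sup>+\<omega>. \<psi> \<omega> (X (Suc n) \<omega>) \<partial>\<Omega>) = (\<integral>\<^sup>+u. (case u of (\<omega>, z) \<Rightarrow> \<psi> \<omega> z) \<partial>N1)"
    unfolding N1_def by (subst nn_integral_distr[OF pm]) auto
  also have "\<dots> = (\<integral>\<^sup>+\<omega>. (\<integral>\<^sup>+u. (case u of (\<omega>, z) \<Rightarrow> \<psi> \<omega> z) \<partial>L \<omega>) \<partial>\<Omega>)"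
    unfolding N12 N2_def by (rule nn_integral_bind[OF _ L]) measurable
  also have "\<dots> = (\<integral>\<^sup>+\<omega>. (\<integral>\<^sup>+z. \<psi> \<omega> z \<partial>P (X n \<omega>)) \<partial>\<Omega>)"
    unfolding L_def by (intro nn_integral_cong, subst nn_integral_distr[OF pz]) auto
  finally show ?thesis .
qed

text \<open>The induction removes the latest step, so that \<open>\<psi>\<close> stays measurable
  with respect to the past up to \<open>p\<close> throughout.\<close>

lemma nn_integral_markov:
  assumes \<psi>: "(\<lambda>(\<omega>, z). \<psi> \<omega> z) \<in> borel_measurable (Fil p \<Otimes>\<^sub>M M)"
  shows "(\<integral>\<^sup>+\<omega>. \<psi> \<omega> (X (p + k) \<omega>) \<partial>\<Omega>) = (\<integral>\<^sup>+\<omega>. (\<integral>\<^sup>+z. \<psi> \<omega> z \<partial>K k (X p \<omega>)) \<partial>\<Omega>)"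
  using \<psi>
proof (induction k arbitrary: \<psi>)
  case 0
  note [measurable] = 0
  have "(\<integral>\<^sup>+z. \<psi> \<omega> z \<partial>return M (X p \<omega>)) = \<psi> \<omega> (X p \<omega>)" if w: "\<omega> \<in> space \<Omega>" for \<omega>
  proof -
    have "\<psi> \<omega> \<in> borel_measurable M"
      using measurable_compose[OF measurable_Pair1' 0, of \<omega>] w by simp
    then show ?thesis using measurable_space[OF X_measurable w] by (intro nn_integral_return)
  qed
  then show ?case by (auto intro!: nn_integral_cong)
next
  case (Suc k)
  note \<psi> [measurable] = Suc.prems
  have sec: "\<psi> \<omega> \<in> borel_measurable M" if "\<omega> \<in> space \<Omega>" for \<omega>
    using measurable_compose[OF measurable_Pair1' \<psi>, of \<omega>] that by simp
  have m: "(\<lambda>(\<omega>, x). \<integral>\<^sup>+z. \<psi> \<omega> z \<partial>P x) \<in> borel_measurable (Fil p \<Otimes>\<^sub>M M)"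
    unfolding case_prod_beta'
  proof (rule nn_integral_measurable_subprob_algebra2[where N=M])
    show "(\<lambda>x. P (snd x)) \<in> Fil p \<Otimes>\<^sub>M M \<rightarrow>\<^sub>M subprob_algebra M" by measurable
    have "(\<lambda>u. (fst (fst u), snd u)) \<in> (Fil p \<Otimes>\<^sub>M M) \<Otimes>\<^sub>M M \<rightarrow>\<^sub>M Fil p \<Otimes>\<^sub>M M" by measurable
    from measurable_compose[OF this \<psi>]
    show "(\<lambda>(x, y). \<psi> (fst x) y) \<in> borel_measurable ((Fil p \<Otimes>\<^sub>M M) \<Otimes>\<^sub>M M)" by (simp add: case_prod_beta')
  qed
  have "(\<integral>\<^sup>+\<omega>. \<psi> \<omega> (X (p + Suc k) \<omega>) \<partial>\<Omega>) = (\<integral>\<^sup>+\<omega>. (\<integral>\<^sup>+z. \<psi> \<omega> z \<partial>P (X (p + k) \<omega>)) \<partial>\<Omega>)"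
    using nn_integral_markov_step[OF measurable_Fil_pair_mono[OF \<psi>, of "p + k"]] by simp
  also have "\<dots> = (\<integral>\<^sup>+\<omega>. (\<integral>\<^sup>+x. (\<integral>\<^sup>+z. \<psi> \<omega> z \<partial>P x) \<partial>K k (X p \<omega>)) \<partial>\<Omega>)"
    by (rule Suc.IH[OF m])
  also have "\<dots> = (\<integral>\<^sup>+\<omega>. (\<integral>\<^sup>+z. \<psi> \<omega> z \<partial>K (Suc k) (X p \<omega>)) \<partial>\<Omega>)"
    by (intro nn_integral_cong nn_integral_K_Suc[symmetric] sec measurable_space[OF X_measurable])
  finally show ?case .
qed

text \<open>Orthogonality of the increments, with each conditional variance replaced by the larger
  conditional second moment. It is applied twice: to the later coordinate of the U-statistic and,
  for a frozen point \<open>z\<close>, to the earlier one.\<close>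

lemma martingale_difference_sum_le:
  fixes F :: "nat \<Rightarrow> 'w \<Rightarrow> 'a \<Rightarrow> real"
  assumes S0: "S0 \<in> borel_measurable (Fil 0)"
    and F: "\<And>l. (\<lambda>(\<omega>, z). F l \<omega> z) \<in> borel_measurable (Fil l \<Otimes>\<^sub>M M)"
  shows "(\<integral>\<^sup>+\<omega>. ennreal ((S0 \<omega> + (\<Sum>l<n. F l \<omega> (X (Suc l) \<omega>) - (\<integral>z. F l \<omega> z \<partial>P (X l \<omega>))))\<^sup>2) \<partial>\<Omega>)
    \<le> (\<integral>\<^sup>+\<omega>. ennreal ((S0 \<omega>)\<^sup>2) \<partial>\<Omega>) + (\<Sum>l<n. \<integral>\<^sup>+\<omega>. ennreal ((F l \<omega> (X (Suc l) \<omega>))\<^sup>2) \<partial>\<Omega>)"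
proof (induction n)
  case (Suc n)
  define D where "D l \<omega> = F l \<omega> (X (Suc l) \<omega>) - (\<integral>z. F l \<omega> z \<partial>P (X l \<omega>))" for l \<omega>
  define S where "S \<omega> = S0 \<omega> + (\<Sum>l<n. D l \<omega>)" for \<omega>
  have Pm: "(\<lambda>\<omega>. \<integral>z. F l \<omega> z \<partial>P (X l \<omega>)) \<in> borel_measurable (Fil l)" for l
    by (rule integral_measurable_kernel[OF F measurable_compose[OF measurable_X_Fil P_measurable_subprob]]) simp
  have Fm: "(\<lambda>\<omega>. F l \<omega> (X (Suc l) \<omega>)) \<in> borel_measurable (Fil (Suc l))" for l
  proof -
    have "(\<lambda>\<omega>. (\<omega>, X (Suc l) \<omega>)) \<in> Fil (Suc l) \<rightarrow>\<^sub>M Fil l \<Otimes>\<^sub>M M"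
      by (intro measurable_Pair measurable_id_Fil_mono measurable_X_Fil) auto
    from measurable_compose[OF this F] show ?thesis by simp
  qed
  have S_m: "S \<in> borel_measurable (Fil n)"
    unfolding S_def D_def
    by (intro borel_measurable_add borel_measurable_sum borel_measurable_diff measurable_Fil_mono[OF S0]
        measurable_Fil_mono[OF Fm] measurable_Fil_mono[OF Pm]) auto
  note F' [measurable] = F[of n]
  note [measurable] = Pm[of n] S_m
  define \<psi> where "\<psi> \<omega> z = ennreal ((S \<omega> + (F n \<omega> z - (\<integral>z. F n \<omega> z \<partial>P (X n \<omega>))))\<^sup>2)" for \<omega> z
  have \<psi>_m: "(\<lambda>(\<omega>, z). \<psi> \<omega> z) \<in> borel_measurable (Fil n \<Otimes>\<^sub>M M)"
    unfolding \<psi>_def by measurable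
  have sec: "F n \<omega> \<in> borel_measurable M" if "\<omega> \<in> space \<Omega>" for \<omega>
    using measurable_compose[OF measurable_Pair1' F[of n], of \<omega>] that by simp
  have m2: "(\<lambda>(\<omega>, z). ennreal ((F n \<omega> z)\<^sup>2)) \<in> borel_measurable (Fil n \<Otimes>\<^sub>M M)" by measurable
  have "(\<integral>\<^sup>+\<omega>. ennreal ((S0 \<omega> + (\<Sum>l<Suc n. D l \<omega>))\<^sup>2) \<partial>\<Omega>) = (\<integral>\<^sup>+\<omega>. \<psi> \<omega> (X (Suc n) \<omega>) \<partial>\<Omega>)"
    unfolding \<psi>_def S_def D_def by (simp add: add.assoc)
  also have "\<dots> = (\<integral>\<^sup>+\<omega>. (\<integral>\<^sup>+z. \<psi> \<omega> z \<partial>P (X n \<omega>)) \<partial>\<Omega>)"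
    by (rule nn_integral_markov_step[OF \<psi>_m])
  also have "\<dots> \<le> (\<integral>\<^sup>+\<omega>. ennreal ((S \<omega>)\<^sup>2) + (\<integral>\<^sup>+z. ennreal ((F n \<omega> z)\<^sup>2) \<partial>P (X n \<omega>)) \<partial>\<Omega>)"
  proof (intro nn_integral_mono)
    fix \<omega> assume w: "\<omega> \<in> space \<Omega>"
    then have x: "X n \<omega> \<in> space M" by (rule measurable_space[OF X_measurable])
    have "F n \<omega> \<in> borel_measurable (P (X n \<omega>))" using sec[OF w] sets_P[OF x] by (simp cong: measurable_cong_sets)
    then show "(\<integral>\<^sup>+z. \<psi> \<omega> z \<partial>P (X n \<omega>)) \<le> ennreal ((S \<omega>)\<^sup>2) + (\<integral>\<^sup>+z. ennreal ((F n \<omega> z)\<^sup>2) \<partial>P (X n \<omega>))"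
      unfolding \<psi>_def by (rule power2_drift_le[OF prob_P[OF x]])
  qed
  also have "\<dots> = (\<integral>\<^sup>+\<omega>. ennreal ((S \<omega>)\<^sup>2) \<partial>\<Omega>) + (\<integral>\<^sup>+\<omega>. (\<integral>\<^sup>+z. ennreal ((F n \<omega> z)\<^sup>2) \<partial>P (X n \<omega>)) \<partial>\<Omega>)"
  proof (rule nn_integral_add)
    show "(\<lambda>\<omega>. ennreal ((S \<omega>)\<^sup>2)) \<in> borel_measurable \<Omega>"
      by (rule measurable_Fil_Omega[of _ n]) measurable
    show "(\<lambda>\<omega>. \<integral>\<^sup>+z. ennreal ((F n \<omega> z)\<^sup>2) \<partial>P (X n \<omega>)) \<in> borel_measurable \<Omega>"
    proof (rule measurable_Fil_Omega[of _ n], rule nn_integral_measurable_subprob_algebra2[OF m2])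
      show "(\<lambda>\<omega>. P (X n \<omega>)) \<in> Fil n \<rightarrow>\<^sub>M subprob_algebra M"
        by (rule measurable_compose[OF measurable_X_Fil P_measurable_subprob]) simp
    qed
  qed
  also have "(\<integral>\<^sup>+\<omega>. (\<integral>\<^sup>+z. ennreal ((F n \<omega> z)\<^sup>2) \<partial>P (X n \<omega>)) \<partial>\<Omega>) = (\<integral>\<^sup>+\<omega>. ennreal ((F n \<omega> (X (Suc n) \<omega>))\<^sup>2) \<partial>\<Omega>)"
    by (rule nn_integral_markov_step[OF m2, symmetric])
  also have "(\<integral>\<^sup>+\<omega>. ennreal ((S \<omega>)\<^sup>2) \<partial>\<Omega>) + \<dots> \<le> ((\<integral>\<^sup>+\<omega>. ennreal ((S0 \<omega>)\<^sup>2) \<partial>\<Omega>) +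
      (\<Sum>l<n. \<integral>\<^sup>+\<omega>. ennreal ((F l \<omega> (X (Suc l) \<omega>))\<^sup>2) \<partial>\<Omega>)) + (\<integral>\<^sup>+\<omega>. ennreal ((F n \<omega> (X (Suc n) \<omega>))\<^sup>2) \<partial>\<Omega>)"
    using Suc unfolding S_def D_def by (intro add_right_mono)
  finally show ?case unfolding D_def by (simp add: add.assoc)
qed simp

end

section \<open>Decoupling\<close>

locale ergodic_chain = product_ergodic_kernel M P \<mu> V W c c' + kernel_chain M P \<mu> \<Omega> \<rho> X
  for M :: "'a measure" and P \<mu> V W c c' and \<Omega> :: "'w measure" and \<rho> X +
  fixes C0 :: real
  assumes C0_ge_1: "1 \<le> C0"
    and moment: "(\<integral>\<^sup>+\<omega>. ennreal ((W (X l \<omega>, X j \<omega>))\<^sup>2) \<partial>\<Omega>) \<le> ennreal C0"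
begin

lemma X_space [simp]: "\<omega> \<in> space \<Omega> \<Longrightarrow> X n \<omega> \<in> space M"
  by (rule measurable_space[OF X_measurable])

lemma section_measurable:
  assumes "(\<lambda>(\<omega>, z). \<phi> \<omega> z) \<in> Fil p \<Otimes>\<^sub>M M \<rightarrow>\<^sub>M N" "\<omega> \<in> space \<Omega>"
  shows "\<phi> \<omega> \<in> M \<rightarrow>\<^sub>M N"
  using measurable_compose[OF measurable_Pair1' assms(1), of \<omega>] assms(2) by simp

lemma nn_integral_mu_measurable:
  assumes "(\<lambda>(\<omega>, z). \<phi> \<omega> z) \<in> borel_measurable (Fil p \<Otimes>\<^sub>M M)"
  shows "(\<lambda>\<omega>. \<integral>\<^sup>+z. \<phi> \<omega> z \<partial>\<mu>) \<in> borel_measurable \<Omega>"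
proof -
  interpret mu: prob_space \<mu> by (rule prob_mu)
  have "(\<lambda>\<omega>. \<integral>\<^sup>+z. \<phi> \<omega> z \<partial>\<mu>) \<in> borel_measurable (Fil p)"
  proof (rule mu.borel_measurable_nn_integral)
    show "(\<lambda>(x, y). \<phi> x y) \<in> borel_measurable (Fil p \<Otimes>\<^sub>M \<mu>)"
      using assms by (subst measurable_cong_sets[OF sets_pair_measure_cong[OF refl sets_mu] refl])
  qed
  then show ?thesis by (rule measurable_Fil_Omega)
qed

lemma nn_integral_K_measurable:
  assumes "(\<lambda>(\<omega>, z). \<phi> \<omega> z) \<in> borel_measurable (Fil p \<Otimes>\<^sub>M M)"
  shows "(\<lambda>\<omega>. \<integral>\<^sup>+z. \<phi> \<omega> z \<partial>K k (X p \<omega>)) \<in> borel_measurable \<Omega>"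
  by (rule measurable_Fil_Omega[of _ p], rule nn_integral_measurable_subprob_algebra2[OF assms])
    (rule measurable_compose[OF measurable_X_Fil[OF order_refl] K_measurable_subprob])

text \<open>The slow rate suffices because \<open>k\<close> tends to infinity afterwards; the weight
  \<open>W\<close> on the diagonal that it carries is averaged by \<open>moment\<close>.\<close>

lemma decouple_lower:
  assumes \<phi>: "(\<lambda>(\<omega>, z). \<phi> \<omega> z) \<in> borel_measurable (Fil p \<Otimes>\<^sub>M M)"
    and le: "\<And>\<omega> z. \<omega> \<in> space \<Omega> \<Longrightarrow> z \<in> space M \<Longrightarrow> \<phi> \<omega> z \<le> ennreal a" and a: "0 \<le> a"
  shows "(\<integral>\<^sup>+\<omega>. (\<integral>\<^sup>+z. \<phi> \<omega> z \<partial>\<mu>) \<partial>\<Omega>) \<le> (\<integral>\<^sup>+\<omega>. \<phi> \<omega> (X (p + k) \<omega>) \<partial>\<Omega>) + ennreal (a * c * C0 / real (Suc k))"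
proof -
  let ?q = "a * c / real (Suc k)"
  have q: "0 \<le> ?q" using a c_ge_1 by simp
  have [measurable]: "(\<lambda>\<omega>. W (X p \<omega>, X p \<omega>)) \<in> borel_measurable \<Omega>" by measurable
  have "(\<integral>\<^sup>+\<omega>. (\<integral>\<^sup>+z. \<phi> \<omega> z \<partial>\<mu>) \<partial>\<Omega>)
      \<le> (\<integral>\<^sup>+\<omega>. (\<integral>\<^sup>+z. \<phi> \<omega> z \<partial>K k (X p \<omega>)) + ennreal ?q * ennreal ((W (X p \<omega>, X p \<omega>))\<^sup>2) \<partial>\<Omega>)"
  proof (intro nn_integral_mono)
    fix \<omega> assume w: "\<omega> \<in> space \<Omega>"
    have "(\<integral>\<^sup>+z. \<phi> \<omega> z \<partial>\<mu>) \<le> (\<integral>\<^sup>+z. \<phi> \<omega> z \<partial>K k (X p \<omega>)) + ennreal (a * (c * (W (X p \<omega>, X p \<omega>))\<^sup>2 / real (Suc k)))"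
      by (rule nn_integral_K_le_mu(2)[OF section_measurable[OF \<phi> w] le[OF w] X_space[OF w] ergodic_rate'[OF _ _ X_space[OF w]]])
    also have "a * (c * (W (X p \<omega>, X p \<omega>))\<^sup>2 / real (Suc k)) = ?q * (W (X p \<omega>, X p \<omega>))\<^sup>2" by simp
    finally show "(\<integral>\<^sup>+z. \<phi> \<omega> z \<partial>\<mu>) \<le> (\<integral>\<^sup>+z. \<phi> \<omega> z \<partial>K k (X p \<omega>)) + ennreal ?q * ennreal ((W (X p \<omega>, X p \<omega>))\<^sup>2)"
      using q by (simp only: ennreal_mult[OF q zero_le_power2])
  qed
  also have "\<dots> = (\<integral>\<^sup>+\<omega>. (\<integral>\<^sup>+z. \<phi> \<omega> z \<partial>K k (X p \<omega>)) \<partial>\<Omega>) + ennreal ?q * (\<integral>\<^sup>+\<omega>. ennreal ((W (X p \<omega>, X p \<omega>))\<^sup>2) \<partial>\<Omega>)"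
  proof (subst nn_integral_add)
    show "(\<lambda>\<omega>. \<integral>\<^sup>+z. \<phi> \<omega> z \<partial>K k (X p \<omega>)) \<in> borel_measurable \<Omega>" by (rule nn_integral_K_measurable[OF \<phi>])
  qed (simp_all add: nn_integral_cmult)
  also have "(\<integral>\<^sup>+\<omega>. (\<integral>\<^sup>+z. \<phi> \<omega> z \<partial>K k (X p \<omega>)) \<partial>\<Omega>) = (\<integral>\<^sup>+\<omega>. \<phi> \<omega> (X (p + k) \<omega>) \<partial>\<Omega>)"
    by (rule nn_integral_markov[OF \<phi>, symmetric])
  also have "ennreal ?q * (\<integral>\<^sup>+\<omega>. ennreal ((W (X p \<omega>, X p \<omega>))\<^sup>2) \<partial>\<Omega>) \<le> ennreal ?q * ennreal C0"
    by (intro mult_left_mono moment) simp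
  also have "ennreal ?q * ennreal C0 = ennreal (a * c * C0 / real (Suc k))"
    using q C0_ge_1 by (simp flip: ennreal_mult)
  finally show ?thesis by (simp add: add_left_mono)
qed

text \<open>The moment hypotheses concern the chain started from rho, but after decoupling they are
  needed under mu. For a truncation at level \<open>a\<close> the limit in \<open>k\<close> removes
  the mixing error, and monotone convergence in \<open>a\<close> then removes the truncation. The
  order matters, since the error is proportional to \<open>a\<close>.\<close>

lemma nn_integral_mu_le_of_chain:
  assumes \<phi>: "(\<lambda>(\<omega>, z). \<phi> \<omega> z) \<in> borel_measurable (Fil p \<Otimes>\<^sub>M M)"
    and le: "\<And>k. (\<integral>\<^sup>+\<omega>. \<phi> \<omega> (X (p + k) \<omega>) \<partial>\<Omega>) \<le> ennreal C"
  shows "(\<integral>\<^sup>+\<omega>. (\<integral>\<^sup>+z. \<phi> \<omega> z \<partial>\<mu>) \<partial>\<Omega>) \<le> ennreal C"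
proof -
  define \<phi>' where "\<phi>' a \<omega> z = min (\<phi> \<omega> z) (ennreal (real a))" for a :: nat and \<omega> z
  have m: "(\<lambda>(\<omega>, z). \<phi>' a \<omega> z) \<in> borel_measurable (Fil p \<Otimes>\<^sub>M M)" for a
    unfolding \<phi>'_def case_prod_beta' using \<phi>[unfolded case_prod_beta'] by measurable
  have "(\<integral>\<^sup>+\<omega>. (\<integral>\<^sup>+z. \<phi>' a \<omega> z \<partial>\<mu>) \<partial>\<Omega>) \<le> ennreal C" for a
  proof (rule LIMSEQ_le_const)
    have "(\<lambda>k. a * c * C0 / real (Suc k)) \<longlonglongrightarrow> 0"
      by (rule LIMSEQ_Suc[OF lim_const_over_n])
    then have "(\<lambda>k. ennreal C + ennreal (a * c * C0 / real (Suc k))) \<longlonglongrightarrow> ennreal C + ennreal 0"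
      by (intro tendsto_intros tendsto_ennrealI)
    then show "(\<lambda>k. ennreal C + ennreal (a * c * C0 / real (Suc k))) \<longlonglongrightarrow> ennreal C" by simp
    have "(\<integral>\<^sup>+\<omega>. (\<integral>\<^sup>+z. \<phi>' a \<omega> z \<partial>\<mu>) \<partial>\<Omega>) \<le> ennreal C + ennreal (a * c * C0 / real (Suc k))" for k
    proof -
      have "(\<integral>\<^sup>+\<omega>. (\<integral>\<^sup>+z. \<phi>' a \<omega> z \<partial>\<mu>) \<partial>\<Omega>) \<le> (\<integral>\<^sup>+\<omega>. \<phi>' a \<omega> (X (p + k) \<omega>) \<partial>\<Omega>) + ennreal (a * c * C0 / real (Suc k))"
        by (rule decouple_lower[OF m]) (auto simp: \<phi>'_def)
      also have "(\<integral>\<^sup>+\<omega>. \<phi>' a \<omega> (X (p + k) \<omega>) \<partial>\<Omega>) \<le> (\<integral>\<^sup>+\<omega>. \<phi> \<omega> (X (p + k) \<omega>) \<partial>\<Omega>)"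
        by (intro nn_integral_mono) (auto simp: \<phi>'_def)
      also have "\<dots> \<le> ennreal C" by (rule le)
      finally show ?thesis by (simp add: add_right_mono)
    qed
    then show "\<exists>N. \<forall>k\<ge>N. (\<integral>\<^sup>+\<omega>. (\<integral>\<^sup>+z. \<phi>' a \<omega> z \<partial>\<mu>) \<partial>\<Omega>) \<le> ennreal C + ennreal (a * c * C0 / real (Suc k))" by blast
  qed
  moreover have "(\<integral>\<^sup>+\<omega>. (\<integral>\<^sup>+z. \<phi> \<omega> z \<partial>\<mu>) \<partial>\<Omega>) = (SUP a. \<integral>\<^sup>+\<omega>. (\<integral>\<^sup>+z. \<phi>' a \<omega> z \<partial>\<mu>) \<partial>\<Omega>)"
  proof -
    have mono: "\<phi>' a \<omega> z \<le> \<phi>' b \<omega> z" if "a \<le> b" for a b \<omega> z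
      using that unfolding \<phi>'_def by (intro min.mono ennreal_leI) auto
    have sup: "\<phi> \<omega> z = (SUP a. \<phi>' a \<omega> z)" for \<omega> z
    proof (cases "\<phi> \<omega> z = top")
      case True
      then show ?thesis unfolding \<phi>'_def
        by (simp add: min_def top_unique ennreal_of_nat_eq_real_of_nat[symmetric] ennreal_SUP_of_nat_eq_top)
    next
      case False
      then obtain n where "\<phi> \<omega> z < of_nat n" using ennreal_Ex_less_of_nat[of "\<phi> \<omega> z"] top.not_eq_extremum by auto
      then have "\<phi>' n \<omega> z = \<phi> \<omega> z" by (simp add: \<phi>'_def ennreal_of_nat_eq_real_of_nat)
      then show ?thesis by (intro antisym SUP_least) (auto intro: SUP_upper2[of n] simp: \<phi>'_def)
    qed
    have "(\<integral>\<^sup>+z. \<phi> \<omega> z \<partial>\<mu>) = (SUP a. \<integral>\<^sup>+z. \<phi>' a \<omega> z \<partial>\<mu>)" if w: "\<omega> \<in> space \<Omega>" for \<omega>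
      unfolding sup using section_measurable[OF m w] mono
      by (intro nn_integral_monotone_convergence_SUP) (auto simp: incseq_def le_fun_def cong: measurable_cong_sets)
    then have "(\<integral>\<^sup>+\<omega>. (\<integral>\<^sup>+z. \<phi> \<omega> z \<partial>\<mu>) \<partial>\<Omega>) = (\<integral>\<^sup>+\<omega>. (SUP a. \<integral>\<^sup>+z. \<phi>' a \<omega> z \<partial>\<mu>) \<partial>\<Omega>)"
      by (intro nn_integral_cong) simp
    also have "\<dots> = (SUP a. \<integral>\<^sup>+\<omega>. (\<integral>\<^sup>+z. \<phi>' a \<omega> z \<partial>\<mu>) \<partial>\<Omega>)"
      using nn_integral_mu_measurable[OF m] mono
      by (intro nn_integral_monotone_convergence_SUP) (auto simp: incseq_def le_fun_def intro!: nn_integral_mono)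
    finally show ?thesis .
  qed
  ultimately show ?thesis by (simp add: SUP_least)
qed

lemma moment_mu: "(\<integral>\<^sup>+\<omega>. (\<integral>\<^sup>+z. ennreal ((W (z, X p \<omega>))\<^sup>2) \<partial>\<mu>) \<partial>\<Omega>) \<le> ennreal C0"
proof (rule nn_integral_mu_le_of_chain[where p=p])
  have [measurable]: "X p \<in> Fil p \<rightarrow>\<^sub>M M" by (rule measurable_X_Fil) simp
  show "(\<lambda>(\<omega>, z). ennreal ((W (z, X p \<omega>))\<^sup>2)) \<in> borel_measurable (Fil p \<Otimes>\<^sub>M M)" by measurable
  show "(\<integral>\<^sup>+\<omega>. ennreal ((W (X (p + k) \<omega>, X p \<omega>))\<^sup>2) \<partial>\<Omega>) \<le> ennreal C0" for k by (rule moment)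
qed

lemma moment_mu_diag: "(\<integral>\<^sup>+z. ennreal ((W (z, z))\<^sup>2) \<partial>\<mu>) \<le> ennreal C0"
proof -
  interpret prob_space \<Omega> by (rule prob_Omega)
  have "(\<integral>\<^sup>+\<omega>. (\<integral>\<^sup>+z. ennreal ((W (z, z))\<^sup>2) \<partial>\<mu>) \<partial>\<Omega>) \<le> ennreal C0"
  proof (rule nn_integral_mu_le_of_chain[where p=0])
    show "(\<lambda>(\<omega>, z). ennreal ((W (z, z))\<^sup>2)) \<in> borel_measurable (Fil 0 \<Otimes>\<^sub>M M)" by measurable
    show "(\<integral>\<^sup>+\<omega>. ennreal ((W (X (0 + k) \<omega>, X (0 + k) \<omega>))\<^sup>2) \<partial>\<Omega>) \<le> ennreal C0" for k by (rule moment)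
  qed
  then show ?thesis using emeasure_space_1 by simp
qed

text \<open>65536 is the square of the 256 in \<open>Bad\<close>: by Chebyshev's inequality for the
  second moment of \<open>W\<close>, the set \<open>Bad i\<close> has probability at most D0 /
  16^i.\<close>

definition D0 :: real where "D0 = 65536 * c\<^sup>2 * C0"

lemma D0_ge: "65536 \<le> D0"
proof -
  have "1 * 1 \<le> c\<^sup>2 * C0" using c_ge_1 C0_ge_1 by (intro mult_mono) (auto simp: one_le_power)
  then show ?thesis by (simp add: D0_def)
qed

lemma nn_integral_indicator_X:
  assumes [measurable]: "B \<in> sets M"
  shows "(\<integral>\<^sup>+\<omega>. indicator B (X l \<omega>) \<partial>\<Omega>) = emeasure \<Omega> {\<omega> \<in> space \<Omega>. X l \<omega> \<in> B}"
proof -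
  have "(\<integral>\<^sup>+\<omega>. indicator B (X l \<omega>) \<partial>\<Omega>) = (\<integral>\<^sup>+\<omega>. indicator {\<omega> \<in> space \<Omega>. X l \<omega> \<in> B} \<omega> \<partial>\<Omega>)"
    by (intro nn_integral_cong) (auto split: split_indicator)
  then show ?thesis by simp
qed

lemma indicator_Bad_le:
  assumes "x \<in> space M"
  shows "indicator (Bad i) x \<le> ennreal (65536 * c\<^sup>2 / 16 ^ i) * ennreal ((W (x, x))\<^sup>2)"
proof (cases "x \<in> Bad i")
  case True
  then have "4 ^ i / 256 \<le> c * W (x, x)" by (simp add: Bad_def)
  then have "(4 ^ i / 256)\<^sup>2 \<le> (c * W (x, x))\<^sup>2" by (intro power_mono) auto
  moreover have "(4 ^ i / 256)\<^sup>2 = (16 ^ i / 65536 :: real)"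
    by (simp add: power_divide power2_eq_square flip: power_mult_distrib)
  ultimately have "16 ^ i \<le> 65536 * c\<^sup>2 * (W (x, x))\<^sup>2"
    by (simp add: power_mult_distrib)
  then have "1 \<le> 65536 * c\<^sup>2 / 16 ^ i * (W (x, x))\<^sup>2" by (simp add: pos_le_divide_eq)
  then have "ennreal 1 \<le> ennreal (65536 * c\<^sup>2 / 16 ^ i * (W (x, x))\<^sup>2)" by (rule ennreal_leI)
  then show ?thesis using True by (simp add: ennreal_mult[symmetric])
qed simp

lemma prob_Bad: "measure \<Omega> {\<omega> \<in> space \<Omega>. X l \<omega> \<in> Bad i} \<le> D0 / 16 ^ i" (is ?A)
  and mu_Bad: "measure \<mu> (Bad i) \<le> D0 / 16 ^ i" (is ?B)
proof -
  interpret prob_space \<Omega> by (rule prob_Omega)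
  interpret mu: prob_space \<mu> by (rule prob_mu)
  let ?q = "65536 * c\<^sup>2 / 16 ^ i"
  have C: "ennreal ?q * ennreal C0 = ennreal (D0 / 16 ^ i)"
    using C0_ge_1 by (simp add: D0_def flip: ennreal_mult)
  have nn: "0 \<le> D0 / 16 ^ i" using D0_ge by simp
  have "emeasure \<Omega> {\<omega> \<in> space \<Omega>. X l \<omega> \<in> Bad i} = (\<integral>\<^sup>+\<omega>. indicator (Bad i) (X l \<omega>) \<partial>\<Omega>)"
    by (rule nn_integral_indicator_X[symmetric]) measurable
  also have "\<dots> \<le> (\<integral>\<^sup>+\<omega>. ennreal ?q * ennreal ((W (X l \<omega>, X l \<omega>))\<^sup>2) \<partial>\<Omega>)"
    by (intro nn_integral_mono indicator_Bad_le X_space)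
  also have "\<dots> = ennreal ?q * (\<integral>\<^sup>+\<omega>. ennreal ((W (X l \<omega>, X l \<omega>))\<^sup>2) \<partial>\<Omega>)"
    by (rule nn_integral_cmult) measurable
  also have "\<dots> \<le> ennreal ?q * ennreal C0" by (intro mult_left_mono moment) simp
  finally show ?A unfolding C using nn by (simp add: emeasure_eq_measure)
  have "emeasure \<mu> (Bad i) = (\<integral>\<^sup>+z. indicator (Bad i) z \<partial>\<mu>)" by simp
  also have "\<dots> \<le> (\<integral>\<^sup>+z. ennreal ?q * ennreal ((W (z, z))\<^sup>2) \<partial>\<mu>)"
    by (intro nn_integral_mono indicator_Bad_le) simp
  also have "\<dots> = ennreal ?q * (\<integral>\<^sup>+z. ennreal ((W (z, z))\<^sup>2) \<partial>\<mu>)"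
    by (rule nn_integral_cmult) measurable
  also have "\<dots> \<le> ennreal ?q * ennreal C0" by (intro mult_left_mono moment_mu_diag) simp
  finally show ?B unfolding C using nn by (simp add: mu.emeasure_eq_measure)
qed

text \<open>The two-step recursion behind \<open>tv_rate\<close> turns the fourth-moment tail of the mixing bound into
  the decay \<open>k\<^sup>-\<^sup>3\<close> of the expected total variation distance after \<open>k = 2\<^sup>i\<close> steps.\<close>

lemma expected_tv_rate: "(\<integral>\<^sup>+\<omega>. ennreal (tv_rate i (X p \<omega>)) \<partial>\<Omega>) \<le> ennreal (64 * D0 / 8 ^ i)"
proof (induction i)
  case 0
  interpret prob_space \<Omega> by (rule prob_Omega)
  show ?case using D0_ge emeasure_space_1 by (simp add: ennreal_leI)
next
  case (Suc i)
  interpret prob_space \<Omega> by (rule prob_Omega)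
  have [measurable]: "(\<lambda>x. measure (K (2 ^ i) x) (Bad i)) \<in> borel_measurable M"
    by (rule measurable_compose[OF K_measurable_subprob measurable_measure_subprob_algebra]) measurable
  have nn: "0 \<le> D0" using D0_ge by simp
  have Kbad: "(\<integral>\<^sup>+\<omega>. ennreal (measure (K (2 ^ i) (X p \<omega>)) (Bad i)) \<partial>\<Omega>) \<le> ennreal (D0 / 16 ^ i)"
  proof -
    have "(\<integral>\<^sup>+\<omega>. ennreal (measure (K (2 ^ i) (X p \<omega>)) (Bad i)) \<partial>\<Omega>) = (\<integral>\<^sup>+\<omega>. (\<integral>\<^sup>+z. indicator (Bad i) z \<partial>K (2 ^ i) (X p \<omega>)) \<partial>\<Omega>)"
    proof (rule nn_integral_cong)
      fix \<omega> assume "\<omega> \<in> space \<Omega>"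
      then interpret Kx: prob_space "K (2 ^ i) (X p \<omega>)" by (intro prob_K X_space)
      show "ennreal (measure (K (2 ^ i) (X p \<omega>)) (Bad i)) = (\<integral>\<^sup>+z. indicator (Bad i) z \<partial>K (2 ^ i) (X p \<omega>))"
        using \<open>\<omega> \<in> space \<Omega>\<close> by (simp add: Kx.emeasure_eq_measure)
    qed
    also have "\<dots> = (\<integral>\<^sup>+\<omega>. indicator (Bad i) (X (p + 2 ^ i) \<omega>) \<partial>\<Omega>)"
      by (rule nn_integral_markov[symmetric]) measurable
    also have "\<dots> = emeasure \<Omega> {\<omega> \<in> space \<Omega>. X (p + 2 ^ i) \<omega> \<in> Bad i}"
      by (rule nn_integral_indicator_X) measurable
    also have "\<dots> \<le> ennreal (D0 / 16 ^ i)" using prob_Bad[of "p + 2 ^ i" i] by (simp add: emeasure_eq_measure ennreal_leI)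
    finally show ?thesis .
  qed
  have "(\<integral>\<^sup>+\<omega>. ennreal (tv_rate (Suc i) (X p \<omega>)) \<partial>\<Omega>)
     = (\<integral>\<^sup>+\<omega>. ennreal (1 / 16) * ennreal (tv_rate i (X p \<omega>)) + (ennreal 2 * ennreal (measure (K (2 ^ i) (X p \<omega>)) (Bad i)) + ennreal (2 * measure \<mu> (Bad i))) \<partial>\<Omega>)"
  proof (intro nn_integral_cong)
    have "ennreal (t / 16 + 2 * m + 2 * b) = ennreal (1 / 16) * ennreal t + (ennreal 2 * ennreal m + ennreal (2 * b))"
      if "0 \<le> t" "0 \<le> m" "0 \<le> b" for t m b :: real
      unfolding ennreal_mult[of "1 / 16" t, OF _ that(1), simplified, symmetric] using that
      by (simp add: ennreal_plus ennreal_mult add.assoc)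
    from this[OF tv_rate_nonneg measure_nonneg measure_nonneg]
    show "ennreal (tv_rate (Suc i) (X p \<omega>)) = ennreal (1 / 16) * ennreal (tv_rate i (X p \<omega>)) +
        (ennreal 2 * ennreal (measure (K (2 ^ i) (X p \<omega>)) (Bad i)) + ennreal (2 * measure \<mu> (Bad i)))" for \<omega>
      unfolding tv_rate.simps .
  qed
  also have "\<dots> = ennreal (1 / 16) * (\<integral>\<^sup>+\<omega>. ennreal (tv_rate i (X p \<omega>)) \<partial>\<Omega>) +
      (ennreal 2 * (\<integral>\<^sup>+\<omega>. ennreal (measure (K (2 ^ i) (X p \<omega>)) (Bad i)) \<partial>\<Omega>) + ennreal (2 * measure \<mu> (Bad i)))"
    using emeasure_space_1 by (simp add: nn_integral_add nn_integral_cmult)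
  also have "\<dots> \<le> ennreal (1 / 16) * ennreal (64 * D0 / 8 ^ i) + (ennreal 2 * ennreal (D0 / 16 ^ i) + ennreal (2 * (D0 / 16 ^ i)))"
    using mu_Bad[of i] by (intro add_mono mult_left_mono Suc Kbad ennreal_leI) auto
  also have "\<dots> = ennreal (4 * D0 / 8 ^ i + 4 * (D0 / 16 ^ i))"
  proof -
    have "ennreal (1 / 16) * ennreal (64 * D0 / 8 ^ i) = ennreal (4 * D0 / 8 ^ i)"
      using ennreal_mult[of "1 / 16" "64 * D0 / 8 ^ i"] nn by simp
    moreover have "ennreal 2 * ennreal (D0 / 16 ^ i) = ennreal (2 * (D0 / 16 ^ i))"
      using ennreal_mult[of 2 "D0 / 16 ^ i"] nn by simp
    moreover have "ennreal (2 * (D0 / 16 ^ i)) + ennreal (2 * (D0 / 16 ^ i)) = ennreal (4 * (D0 / 16 ^ i))"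
      using ennreal_plus[of "2 * (D0 / 16 ^ i)" "2 * (D0 / 16 ^ i)"] nn by simp
    ultimately show ?thesis
      using ennreal_plus[of "4 * D0 / 8 ^ i" "4 * (D0 / 16 ^ i)"] nn by simp
  qed
  \<comment> \<open>The constant 64 is the fixed point of the recursion at rate 1/8: once 16^-i is
    replaced by 8^-i, it reads 64/16 + 4 = 64/8.\<close>
  also have "\<dots> \<le> ennreal (64 * D0 / 8 ^ Suc i)"
  proof (rule ennreal_leI)
    have "D0 / 16 ^ i \<le> D0 / 8 ^ i" using nn by (intro divide_left_mono power_mono) auto
    then show "4 * D0 / 8 ^ i + 4 * (D0 / 16 ^ i) \<le> 64 * D0 / 8 ^ Suc i" by simp
  qed
  finally show ?case .
qed

text \<open>The rate is averaged over X_p by \<open>expected_tv_rate\<close>, so the error is the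
  bound \<open>a\<close> times a number and involves no moment of \<open>\<phi>\<close>.\<close>

lemma decouple:
  assumes \<phi>: "(\<lambda>(\<omega>, z). \<phi> \<omega> z) \<in> borel_measurable (Fil p \<Otimes>\<^sub>M M)"
    and le: "\<And>\<omega> z. \<omega> \<in> space \<Omega> \<Longrightarrow> z \<in> space M \<Longrightarrow> \<phi> \<omega> z \<le> ennreal a" and a: "0 \<le> a"
  shows "(\<integral>\<^sup>+\<omega>. \<phi> \<omega> (X (p + 2 ^ i) \<omega>) \<partial>\<Omega>) \<le> (\<integral>\<^sup>+\<omega>. (\<integral>\<^sup>+z. \<phi> \<omega> z \<partial>\<mu>) \<partial>\<Omega>) + ennreal (a * (64 * D0 / 8 ^ i))"
proof -
  have "(\<integral>\<^sup>+\<omega>. \<phi> \<omega> (X (p + 2 ^ i) \<omega>) \<partial>\<Omega>) = (\<integral>\<^sup>+\<omega>. (\<integral>\<^sup>+z. \<phi> \<omega> z \<partial>K (2 ^ i) (X p \<omega>)) \<partial>\<Omega>)"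
    by (rule nn_integral_markov[OF \<phi>])
  also have "\<dots> \<le> (\<integral>\<^sup>+\<omega>. (\<integral>\<^sup>+z. \<phi> \<omega> z \<partial>\<mu>) + ennreal a * ennreal (tv_rate i (X p \<omega>)) \<partial>\<Omega>)"
  proof (intro nn_integral_mono)
    fix \<omega> assume w: "\<omega> \<in> space \<Omega>"
    show "(\<integral>\<^sup>+z. \<phi> \<omega> z \<partial>K (2 ^ i) (X p \<omega>)) \<le> (\<integral>\<^sup>+z. \<phi> \<omega> z \<partial>\<mu>) + ennreal a * ennreal (tv_rate i (X p \<omega>))"
      unfolding ennreal_mult[OF a tv_rate_nonneg, symmetric]
      by (rule nn_integral_K_le_mu(1)[OF section_measurable[OF \<phi> w] le[OF w] X_space[OF w] tv_rate_bound[OF _ _ X_space[OF w]]])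
  qed
  also have "\<dots> = (\<integral>\<^sup>+\<omega>. (\<integral>\<^sup>+z. \<phi> \<omega> z \<partial>\<mu>) \<partial>\<Omega>) + ennreal a * (\<integral>\<^sup>+\<omega>. ennreal (tv_rate i (X p \<omega>)) \<partial>\<Omega>)"
  proof (subst nn_integral_add)
    show "(\<lambda>\<omega>. \<integral>\<^sup>+z. \<phi> \<omega> z \<partial>\<mu>) \<in> borel_measurable \<Omega>" by (rule nn_integral_mu_measurable[OF \<phi>])
  qed (simp_all add: nn_integral_cmult)
  also have "\<dots> \<le> (\<integral>\<^sup>+\<omega>. (\<integral>\<^sup>+z. \<phi> \<omega> z \<partial>\<mu>) \<partial>\<Omega>) + ennreal a * ennreal (64 * D0 / 8 ^ i)"
    by (intro add_left_mono mult_left_mono expected_tv_rate) simp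
  also have "ennreal a * ennreal (64 * D0 / 8 ^ i) = ennreal (a * (64 * D0 / 8 ^ i))"
    using a D0_ge by (intro ennreal_mult[symmetric]) auto
  finally show ?thesis .
qed

end

section \<open>Truncated Poisson equations\<close>

locale degenerate_kernel_chain = ergodic_chain M P \<mu> V W c c' \<Omega> \<rho> X C0
  for M :: "'a measure" and P \<mu> V W c c' and \<Omega> :: "'w measure" and \<rho> X C0 +
  fixes h :: "'a \<times> 'a \<Rightarrow> real" and T :: real
  assumes dom_h: "dominated h" and can_h: "canonical h"
    and h_sym: "x \<in> space M \<Longrightarrow> y \<in> space M \<Longrightarrow> h (x, y) = h (y, x)"
    and T_nonneg: "0 \<le> T"
    and h_second_moment: "x \<in> space M \<Longrightarrow> y \<in> space M \<Longrightarrow>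
          (\<integral>\<^sup>+z. ennreal ((h (z, y))\<^sup>2) \<partial>P x) \<le> ennreal (T\<^sup>2 * (V (x, y))\<^sup>2)"
begin

lemma h_measurable [measurable]: "h \<in> borel_measurable (M \<Otimes>\<^sub>M M)"
  by (rule dominated_measurable[OF dom_h])

text \<open>Jensen's inequality, read off from non-negativity of the variance. On \<open>h\<close>
  itself the constant \<open>T\<close> acts only through conditional second moments; after one step
  it acts pointwise.\<close>

lemma abs_P_fst_le:
  assumes x: "x \<in> space M" and y: "y \<in> space M"
  shows "\<bar>P_fst h (x, y)\<bar> \<le> T * V (x, y)"
proof -
  interpret Px: prob_space "P x" by (rule prob_P[OF x])
  have m: "(\<lambda>z. h (z, y)) \<in> borel_measurable (P x)"
    using x y by (simp cong: measurable_cong_sets)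
  have lt: "(\<integral>\<^sup>+z. ennreal ((h (z, y))\<^sup>2) \<partial>P x) < \<infinity>"
    using h_second_moment[OF x y] by (rule le_less_trans) simp
  have i: "integrable (P x) (\<lambda>z. h (z, y))" by (rule dominated_integrable_P(1)[OF dom_h x y])
  have i2: "integrable (P x) (\<lambda>z. (h (z, y))\<^sup>2)"
    using m lt by (intro integrableI_nonneg) auto
  have "0 \<le> Px.variance (\<lambda>z. h (z, y))" by (rule Px.variance_positive)
  then have "(\<integral>z. h (z, y) \<partial>P x)\<^sup>2 \<le> (\<integral>z. (h (z, y))\<^sup>2 \<partial>P x)"
    using Px.variance_eq[OF i i2] by simp
  also have "\<dots> \<le> (T * V (x, y))\<^sup>2"
    using h_second_moment[OF x y] i2 by (simp add: nn_integral_eq_integral power_mult_distrib)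
  finally have "\<bar>\<integral>z. h (z, y) \<partial>P x\<bar> \<le> \<bar>T * V (x, y)\<bar>"
    unfolding abs_le_square_iff .
  then show ?thesis using T_nonneg V_ge_1[OF x y] by (simp add: P_fst_def abs_mult)
qed

lemma abs_P_snd_le:
  assumes x: "x \<in> space M" and y: "y \<in> space M"
  shows "\<bar>P_snd h (x, y)\<bar> \<le> T * V (x, y)"
proof -
  have "P_snd h (x, y) = P_fst h (y, x)"
    unfolding P_snd_def P_fst_def prod.case
    using x y by (intro Bochner_Integration.integral_cong) (auto simp: h_sym)
  then show ?thesis using abs_P_fst_le[OF y x] V_sym[OF x y] by simp
qed

text \<open>\<open>G N\<close> truncates the solution of the Poisson equation \<open>G - PG = h\<close> in the first coordinate, \<open>R N b\<close>
  that of the Poisson equation for \<open>G N\<close> in the second; \<open>G' N\<close> and \<open>R' N b\<close> are their images under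
  one step of \<open>P\<close> in that coordinate.\<close>

definition G :: "nat \<Rightarrow> 'a \<times> 'a \<Rightarrow> real" where "G N u = (\<Sum>k<N. Q k 0 h u)"
definition G' :: "nat \<Rightarrow> 'a \<times> 'a \<Rightarrow> real" where "G' N u = (\<Sum>k<N. Q (Suc k) 0 h u)"
definition R :: "nat \<Rightarrow> nat \<Rightarrow> 'a \<times> 'a \<Rightarrow> real" where "R N b u = (\<Sum>i<b. \<Sum>k<N. Q k i h u)"
definition R' :: "nat \<Rightarrow> nat \<Rightarrow> 'a \<times> 'a \<Rightarrow> real" where "R' N b u = (\<Sum>i<b. \<Sum>k<N. Q k (Suc i) h u)"

lemma Q_h_measurable [measurable]: "Q k i h \<in> borel_measurable (M \<Otimes>\<^sub>M M)"
  by (rule Q_measurable[OF dom_h])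

lemma G_measurable [measurable]: "G N \<in> borel_measurable (M \<Otimes>\<^sub>M M)"
  and G'_measurable [measurable]: "G' N \<in> borel_measurable (M \<Otimes>\<^sub>M M)"
  and R_measurable [measurable]: "R N b \<in> borel_measurable (M \<Otimes>\<^sub>M M)"
  and R'_measurable [measurable]: "R' N b \<in> borel_measurable (M \<Otimes>\<^sub>M M)"
  unfolding G_def[abs_def] G'_def[abs_def] R_def[abs_def] R'_def[abs_def] by measurable

lemma G_0 [simp]: "G 0 u = 0" and G'_0 [simp]: "G' 0 u = 0" and R_0 [simp]: "R N 0 u = 0" and R'_0 [simp]: "R' N 0 u = 0"
  by (simp_all add: G_def G'_def R_def R'_def)

text \<open>The horizon drops by one when a step is taken. With horizon n - t at time t the Poisson
  equation thus holds without a leftover power of \<open>P\<close>, and the recursion ends at an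
  empty sum.\<close>

lemma G_Suc: "x \<in> space M \<Longrightarrow> y \<in> space M \<Longrightarrow> G (Suc N) (x, y) = h (x, y) + G' N (x, y)"
  unfolding G_def G'_def sum.lessThan_Suc_shift by (simp add: Q_0[OF dom_h])

lemma R_Suc: "R N (Suc b) u = G N u + R' N b u"
  unfolding R_def R'_def G_def sum.lessThan_Suc_shift[of _ b] ..

lemma integrable_G: "x \<in> space M \<Longrightarrow> y \<in> space M \<Longrightarrow> integrable (P x) (\<lambda>z. G N (z, y))"
  unfolding G_def by (intro Bochner_Integration.integrable_sum dominated_integrable_P(1) dominated_Q dom_h)

lemma integral_G: "x \<in> space M \<Longrightarrow> y \<in> space M \<Longrightarrow> (\<integral>z. G N (z, y) \<partial>P x) = G' N (x, y)"
  unfolding G_def G'_def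
  by (simp add: Bochner_Integration.integral_sum dominated_integrable_P(1) dominated_Q dom_h integral_P_Q_fst)

lemma integral_R: "x \<in> space M \<Longrightarrow> y \<in> space M \<Longrightarrow> (\<integral>w. R N b (x, w) \<partial>P y) = R' N b (x, y)"
  unfolding R_def R'_def
  by (simp add: Bochner_Integration.integral_sum dominated_integrable_P(2) dominated_Q dom_h integral_P_Q_snd)

text \<open>Every term carries at least one power of \<open>P\<close>, which turns \<open>h\<close>
  into \<open>P_fst h\<close> and lets \<open>T\<close> act as domination constant. The first term
  of \<open>G\<close> has no such spare step.\<close>

lemma abs_G'_le:
  assumes x: "x \<in> space M" and y: "y \<in> space M"
  shows "\<bar>G' N (x, y)\<bar> \<le> T * (c * W (x, y))"
proof -
  have "\<bar>G' N (x, y)\<bar> \<le> (\<Sum>k<N. \<bar>Q (Suc k) 0 h (x, y)\<bar>)" unfolding G'_def by (rule sum_abs)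
  also have "\<dots> = (\<Sum>k<N. \<Sum>i<Suc 0. \<bar>Q k i (P_fst h) (x, y)\<bar>)" by (simp add: Q_Suc_fst[OF dom_h x y])
  also have "\<dots> \<le> T * (c * W (x, y))"
    by (rule sum_Q_le[OF dominated_P_fst[OF dom_h] canonical_P_fst[OF dom_h can_h] x y T_nonneg abs_P_fst_le])
  finally show ?thesis .
qed

text \<open>Here the spare step lies in the second coordinate; the sum over both indices is where
  the mixing condition is used as a genuine double series.\<close>

lemma abs_R'_le:
  assumes x: "x \<in> space M" and y: "y \<in> space M"
  shows "\<bar>R' N b (x, y)\<bar> \<le> T * (c * W (x, y))"
proof -
  have "\<bar>R' N b (x, y)\<bar> \<le> (\<Sum>i<b. \<Sum>k<N. \<bar>Q k (Suc i) h (x, y)\<bar>)"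
    unfolding R'_def by (intro order_trans[OF sum_abs] sum_mono sum_abs)
  also have "\<dots> = (\<Sum>k<N. \<Sum>i<b. \<bar>Q k (Suc i) h (x, y)\<bar>)" by (rule sum.swap)
  also have "\<dots> = (\<Sum>k<N. \<Sum>i<b. \<bar>Q k i (P_snd h) (x, y)\<bar>)" by (simp add: Q_Suc_snd[OF dom_h x y])
  also have "\<dots> \<le> T * (c * W (x, y))"
    by (rule sum_Q_le[OF dominated_P_snd[OF dom_h] canonical_P_snd[OF dom_h can_h] x y T_nonneg abs_P_snd_le])
  finally show ?thesis .
qed

lemma power2_le_of_abs:
  fixes a b :: real
  assumes "\<bar>a\<bar> \<le> b" shows "a\<^sup>2 \<le> b\<^sup>2"
  using assms abs_le_square_iff[of a b] by simp

lemma G'_square_le: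
  assumes "x \<in> space M" "y \<in> space M"
  shows "(G' N (x, y))\<^sup>2 \<le> T\<^sup>2 * c\<^sup>2 * (W (x, y))\<^sup>2"
  using power2_le_of_abs[OF abs_G'_le[OF assms]] by (simp add: power_mult_distrib mult.assoc)

lemma R'_square_le:
  assumes "x \<in> space M" "y \<in> space M"
  shows "(R' N b (x, y))\<^sup>2 \<le> T\<^sup>2 * c\<^sup>2 * (W (x, y))\<^sup>2"
  using power2_le_of_abs[OF abs_R'_le[OF assms]] by (simp add: power_mult_distrib mult.assoc)

lemma square_add_le: "(a + b)\<^sup>2 \<le> 2 * a\<^sup>2 + 2 * b\<^sup>2" for a b :: real
  using zero_le_power2[of "a - b"] by (simp add: power2_eq_square algebra_simps)

text \<open>The term \<open>h\<close> is kept apart, since its square is controlled only after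
  integration over one step, whereas the rest is bounded pointwise by \<open>W\<close>.\<close>

lemma G_square_le:
  assumes x: "x \<in> space M" and y: "y \<in> space M"
  shows "(G N (x, y))\<^sup>2 \<le> 2 * (h (x, y))\<^sup>2 + 2 * (T\<^sup>2 * c\<^sup>2) * (W (x, y))\<^sup>2"
proof (cases N)
  case (Suc N')
  show ?thesis
    using square_add_le[of "h (x, y)" "G' N' (x, y)"] G'_square_le[OF x y, of N'] by (simp add: Suc G_Suc[OF x y])
qed simp

lemma R_square_le:
  assumes x: "x \<in> space M" and y: "y \<in> space M"
  shows "(R N b (x, y))\<^sup>2 \<le> 4 * (h (x, y))\<^sup>2 + 6 * (T\<^sup>2 * c\<^sup>2) * (W (x, y))\<^sup>2"
proof (cases b)
  case (Suc b')
  show ?thesis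
    using square_add_le[of "G N (x, y)" "R' N b' (x, y)"] G_square_le[OF x y, of N] R'_square_le[OF x y, of N b']
    by (simp add: Suc R_Suc)
qed simp

lemma V_square_le: "x \<in> space M \<Longrightarrow> y \<in> space M \<Longrightarrow> (V (x, y))\<^sup>2 \<le> (W (x, y))\<^sup>2"
  using V_ge_1[of x y] V_le_W[of x y] by (intro power_mono) auto

text \<open>The strict gap between the two times allows conditioning at time \<open>l\<close> with
  X_j already known, which is the step on which \<open>T\<close> acts.\<close>

lemma h_moment:
  assumes "j \<le> l"
  shows "(\<integral>\<^sup>+\<omega>. ennreal ((h (X (Suc l) \<omega>, X j \<omega>))\<^sup>2) \<partial>\<Omega>) \<le> ennreal (T\<^sup>2 * C0)"
proof -
  have [measurable]: "X j \<in> Fil l \<rightarrow>\<^sub>M M" by (rule measurable_X_Fil[OF assms])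
  have "(\<integral>\<^sup>+\<omega>. ennreal ((h (X (Suc l) \<omega>, X j \<omega>))\<^sup>2) \<partial>\<Omega>) = (\<integral>\<^sup>+\<omega>. (\<integral>\<^sup>+z. ennreal ((h (z, X j \<omega>))\<^sup>2) \<partial>P (X l \<omega>)) \<partial>\<Omega>)"
    by (rule nn_integral_markov_step) measurable
  also have "\<dots> \<le> (\<integral>\<^sup>+\<omega>. ennreal (T\<^sup>2) * ennreal ((W (X l \<omega>, X j \<omega>))\<^sup>2) \<partial>\<Omega>)"
  proof (intro nn_integral_mono)
    fix \<omega> assume w: "\<omega> \<in> space \<Omega>"
    have "(\<integral>\<^sup>+z. ennreal ((h (z, X j \<omega>))\<^sup>2) \<partial>P (X l \<omega>)) \<le> ennreal (T\<^sup>2 * (V (X l \<omega>, X j \<omega>))\<^sup>2)"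
      using w by (intro h_second_moment) auto
    also have "\<dots> \<le> ennreal (T\<^sup>2 * (W (X l \<omega>, X j \<omega>))\<^sup>2)"
      using w by (intro ennreal_leI mult_left_mono V_square_le) auto
    finally show "(\<integral>\<^sup>+z. ennreal ((h (z, X j \<omega>))\<^sup>2) \<partial>P (X l \<omega>)) \<le> ennreal (T\<^sup>2) * ennreal ((W (X l \<omega>, X j \<omega>))\<^sup>2)"
      by (simp add: ennreal_mult)
  qed
  also have "\<dots> = ennreal (T\<^sup>2) * (\<integral>\<^sup>+\<omega>. ennreal ((W (X l \<omega>, X j \<omega>))\<^sup>2) \<partial>\<Omega>)"
    by (rule nn_integral_cmult) measurable
  also have "\<dots> \<le> ennreal (T\<^sup>2) * ennreal C0" by (intro mult_left_mono moment) simp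
  finally show ?thesis using C0_ge_1 by (simp add: ennreal_mult)
qed

text \<open>A variable of law mu has not just made a step of \<open>P\<close>; writing mu as mu P
  supplies the step on which \<open>T\<close> acts.\<close>

lemma h_moment_mu: "(\<integral>\<^sup>+\<omega>. (\<integral>\<^sup>+z. ennreal ((h (z, X j \<omega>))\<^sup>2) \<partial>\<mu>) \<partial>\<Omega>) \<le> ennreal (T\<^sup>2 * C0)"
proof -
  have [measurable]: "X j \<in> Fil j \<rightarrow>\<^sub>M M" by (rule measurable_X_Fil) simp
  have "(\<integral>\<^sup>+\<omega>. (\<integral>\<^sup>+z. ennreal ((h (z, X j \<omega>))\<^sup>2) \<partial>\<mu>) \<partial>\<Omega>) \<le> (\<integral>\<^sup>+\<omega>. ennreal (T\<^sup>2) * (\<integral>\<^sup>+z. ennreal ((W (z, X j \<omega>))\<^sup>2) \<partial>\<mu>) \<partial>\<Omega>)"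
  proof (intro nn_integral_mono)
    fix \<omega> assume w: "\<omega> \<in> space \<Omega>"
    have [measurable]: "X j \<omega> \<in> space M" using w by simp
    have "(\<integral>\<^sup>+z. ennreal ((h (z, X j \<omega>))\<^sup>2) \<partial>\<mu>) = (\<integral>\<^sup>+x. (\<integral>\<^sup>+z. ennreal ((h (z, X j \<omega>))\<^sup>2) \<partial>P x) \<partial>\<mu>)"
      by (rule nn_integral_mu_P[symmetric]) measurable
    also have "\<dots> \<le> (\<integral>\<^sup>+z. ennreal (T\<^sup>2) * ennreal ((W (z, X j \<omega>))\<^sup>2) \<partial>\<mu>)"
    proof (intro nn_integral_mono)
      fix x assume x: "x \<in> space \<mu>"
      have "(\<integral>\<^sup>+z. ennreal ((h (z, X j \<omega>))\<^sup>2) \<partial>P x) \<le> ennreal (T\<^sup>2 * (V (x, X j \<omega>))\<^sup>2)"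
        using w x by (intro h_second_moment) auto
      also have "\<dots> \<le> ennreal (T\<^sup>2 * (W (x, X j \<omega>))\<^sup>2)"
        using w x by (intro ennreal_leI mult_left_mono V_square_le) auto
      finally show "(\<integral>\<^sup>+z. ennreal ((h (z, X j \<omega>))\<^sup>2) \<partial>P x) \<le> ennreal (T\<^sup>2) * ennreal ((W (x, X j \<omega>))\<^sup>2)"
        by (simp add: ennreal_mult)
    qed
    also have "\<dots> = ennreal (T\<^sup>2) * (\<integral>\<^sup>+z. ennreal ((W (z, X j \<omega>))\<^sup>2) \<partial>\<mu>)"
      by (rule nn_integral_cmult) measurable
    finally show "(\<integral>\<^sup>+z. ennreal ((h (z, X j \<omega>))\<^sup>2) \<partial>\<mu>) \<le> ennreal (T\<^sup>2) * (\<integral>\<^sup>+z. ennreal ((W (z, X j \<omega>))\<^sup>2) \<partial>\<mu>)" .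
  qed
  also have "\<dots> = ennreal (T\<^sup>2) * (\<integral>\<^sup>+\<omega>. (\<integral>\<^sup>+z. ennreal ((W (z, X j \<omega>))\<^sup>2) \<partial>\<mu>) \<partial>\<Omega>)"
    by (rule nn_integral_cmult[OF nn_integral_mu_measurable[of _ j]]) measurable
  also have "\<dots> \<le> ennreal (T\<^sup>2) * ennreal C0" by (intro mult_left_mono moment_mu) simp
  finally show ?thesis using C0_ge_1 by (simp add: ennreal_mult)
qed

lemma nn_integral_lincomb_le:
  assumes [measurable]: "u \<in> borel_measurable m" "v \<in> borel_measurable m"
    and le: "\<And>x. x \<in> space m \<Longrightarrow> f x \<le> ennreal \<alpha> * u x + ennreal \<beta> * v x"
    and A: "(\<integral>\<^sup>+x. u x \<partial>m) \<le> ennreal A" and B: "(\<integral>\<^sup>+x. v x \<partial>m) \<le> ennreal B"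
    and nn: "0 \<le> \<alpha>" "0 \<le> \<beta>" "0 \<le> A" "0 \<le> B"
  shows "(\<integral>\<^sup>+x. f x \<partial>m) \<le> ennreal (\<alpha> * A + \<beta> * B)"
proof -
  have "(\<integral>\<^sup>+x. f x \<partial>m) \<le> (\<integral>\<^sup>+x. ennreal \<alpha> * u x + ennreal \<beta> * v x \<partial>m)"
    by (intro nn_integral_mono le)
  also have "\<dots> = ennreal \<alpha> * (\<integral>\<^sup>+x. u x \<partial>m) + ennreal \<beta> * (\<integral>\<^sup>+x. v x \<partial>m)"
    by (simp add: nn_integral_add nn_integral_cmult)
  also have "\<dots> \<le> ennreal \<alpha> * ennreal A + ennreal \<beta> * ennreal B"
    by (intro add_mono mult_left_mono A B) auto
  also have "\<dots> = ennreal (\<alpha> * A + \<beta> * B)"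
    using nn by (simp add: ennreal_mult ennreal_plus)
  finally show ?thesis .
qed

lemma ennreal_lincomb_le:
  assumes "s \<le> \<alpha> * u + \<beta> * v" "0 \<le> \<alpha>" "0 \<le> u" "0 \<le> \<beta>" "0 \<le> v"
  shows "ennreal s \<le> ennreal \<alpha> * ennreal u + ennreal \<beta> * ennreal v"
proof -
  have "ennreal s \<le> ennreal (\<alpha> * u + \<beta> * v)" using assms(1) by (rule ennreal_leI)
  then show ?thesis using assms by (simp add: ennreal_mult ennreal_plus)
qed

text \<open>Cauchy-Schwarz, with no use of orthogonality. This is good enough for the near part,
  which has about sqrt n terms, and for the remainder, where n^2 T^2 is still small against the
  squared normalization.\<close>

lemma sum_second_moment:
  fixes f :: "'i \<Rightarrow> 'b \<Rightarrow> real"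
  assumes [measurable]: "\<And>s. s \<in> I \<Longrightarrow> f s \<in> borel_measurable m"
    and B: "\<And>s. s \<in> I \<Longrightarrow> (\<integral>\<^sup>+x. ennreal ((f s x)\<^sup>2) \<partial>m) \<le> ennreal B" "0 \<le> B"
    and k: "card I \<le> k"
  shows "(\<integral>\<^sup>+x. ennreal ((\<Sum>s\<in>I. f s x)\<^sup>2) \<partial>m) \<le> ennreal ((real k)\<^sup>2 * B)"
proof -
  have "(\<integral>\<^sup>+x. ennreal ((\<Sum>s\<in>I. f s x)\<^sup>2) \<partial>m) \<le> (\<integral>\<^sup>+x. ennreal (real k) * (\<Sum>s\<in>I. ennreal ((f s x)\<^sup>2)) \<partial>m)"
  proof (intro nn_integral_mono)
    fix x
    have "(\<Sum>s\<in>I. f s x)\<^sup>2 \<le> (\<Sum>s\<in>I. (f s x)\<^sup>2) * real (card I)" by (rule sum_squared_le_sum_of_squares)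
    also have "\<dots> \<le> (\<Sum>s\<in>I. (f s x)\<^sup>2) * real k" using k by (intro mult_left_mono sum_nonneg) auto
    finally have "ennreal ((\<Sum>s\<in>I. f s x)\<^sup>2) \<le> ennreal (real k * (\<Sum>s\<in>I. (f s x)\<^sup>2))"
      by (intro ennreal_leI) (simp add: mult.commute)
    then show "ennreal ((\<Sum>s\<in>I. f s x)\<^sup>2) \<le> ennreal (real k) * (\<Sum>s\<in>I. ennreal ((f s x)\<^sup>2))"
      by (simp add: ennreal_mult sum_nonneg)
  qed
  also have "\<dots> = ennreal (real k) * (\<Sum>s\<in>I. \<integral>\<^sup>+x. ennreal ((f s x)\<^sup>2) \<partial>m)"
    by (subst nn_integral_cmult, measurable, subst nn_integral_sum, measurable)
  also have "\<dots> \<le> ennreal (real k) * (\<Sum>s\<in>I. ennreal B)" by (intro mult_left_mono sum_mono B) auto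
  also have "\<dots> = ennreal (real k) * ennreal (real (card I) * B)"
    unfolding sum_constant using B(2) by (simp only: ennreal_of_nat_eq_real_of_nat ennreal_mult[symmetric] of_nat_0_le_iff)
  also have "\<dots> \<le> ennreal (real k) * ennreal (real k * B)"
    using k B(2) by (intro mult_left_mono ennreal_leI mult_right_mono) auto
  also have "\<dots> = ennreal ((real k)\<^sup>2 * B)"
    using B(2) by (simp only: ennreal_mult[symmetric] of_nat_0_le_iff mult_nonneg_nonneg power2_eq_square mult.assoc)
  finally show ?thesis .
qed

lemma G_moment:
  assumes "j \<le> l"
  shows "(\<integral>\<^sup>+\<omega>. ennreal ((G N (X (Suc l) \<omega>, X j \<omega>))\<^sup>2) \<partial>\<Omega>) \<le> ennreal (2 * (T\<^sup>2 * C0) + 2 * (T\<^sup>2 * c\<^sup>2) * C0)"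
proof (rule nn_integral_lincomb_le[OF _ _ _ h_moment[OF assms] moment[of "Suc l" j]])
  fix \<omega> assume "\<omega> \<in> space \<Omega>"
  then show "ennreal ((G N (X (Suc l) \<omega>, X j \<omega>))\<^sup>2) \<le> ennreal 2 * ennreal ((h (X (Suc l) \<omega>, X j \<omega>))\<^sup>2) +
      ennreal (2 * (T\<^sup>2 * c\<^sup>2)) * ennreal ((W (X (Suc l) \<omega>, X j \<omega>))\<^sup>2)"
    by (intro ennreal_lincomb_le G_square_le) auto
qed (use C0_ge_1 in auto)

lemma R_moment_mu:
  "(\<integral>\<^sup>+\<omega>. (\<integral>\<^sup>+z. ennreal ((R N b (z, X j \<omega>))\<^sup>2) \<partial>\<mu>) \<partial>\<Omega>) \<le> ennreal (4 * (T\<^sup>2 * C0) + 6 * (T\<^sup>2 * c\<^sup>2) * C0)"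
proof (rule nn_integral_lincomb_le[OF _ _ _ h_moment_mu[of j] moment_mu[of j]])
  have [measurable]: "X j \<in> Fil j \<rightarrow>\<^sub>M M" by (rule measurable_X_Fil) simp
  show "(\<lambda>\<omega>. \<integral>\<^sup>+z. ennreal ((h (z, X j \<omega>))\<^sup>2) \<partial>\<mu>) \<in> borel_measurable \<Omega>"
    by (rule nn_integral_mu_measurable[of _ j]) measurable
  show "(\<lambda>\<omega>. \<integral>\<^sup>+z. ennreal ((W (z, X j \<omega>))\<^sup>2) \<partial>\<mu>) \<in> borel_measurable \<Omega>"
    by (rule nn_integral_mu_measurable[of _ j]) measurable
  fix \<omega> assume w: "\<omega> \<in> space \<Omega>"
  have [measurable]: "X j \<omega> \<in> space M" using w by simp
  have "(\<integral>\<^sup>+z. ennreal ((R N b (z, X j \<omega>))\<^sup>2) \<partial>\<mu>) \<le>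
     (\<integral>\<^sup>+z. ennreal 4 * ennreal ((h (z, X j \<omega>))\<^sup>2) + ennreal (6 * (T\<^sup>2 * c\<^sup>2)) * ennreal ((W (z, X j \<omega>))\<^sup>2) \<partial>\<mu>)"
    using w by (intro nn_integral_mono ennreal_lincomb_le R_square_le) auto
  then show "(\<integral>\<^sup>+z. ennreal ((R N b (z, X j \<omega>))\<^sup>2) \<partial>\<mu>) \<le> ennreal 4 * (\<integral>\<^sup>+z. ennreal ((h (z, X j \<omega>))\<^sup>2) \<partial>\<mu>) +
      ennreal (6 * (T\<^sup>2 * c\<^sup>2)) * (\<integral>\<^sup>+z. ennreal ((W (z, X j \<omega>))\<^sup>2) \<partial>\<mu>)"
    by (simp add: nn_integral_add nn_integral_cmult)
qed (use C0_ge_1 in auto)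

lemma R'_moment_mu:
  "(\<integral>\<^sup>+\<omega>. (\<integral>\<^sup>+z. ennreal ((R' N b (z, X j \<omega>))\<^sup>2) \<partial>\<mu>) \<partial>\<Omega>) \<le> ennreal (T\<^sup>2 * c\<^sup>2 * C0)"
proof -
  have [measurable]: "X j \<in> Fil j \<rightarrow>\<^sub>M M" by (rule measurable_X_Fil) simp
  have "(\<integral>\<^sup>+\<omega>. (\<integral>\<^sup>+z. ennreal ((R' N b (z, X j \<omega>))\<^sup>2) \<partial>\<mu>) \<partial>\<Omega>)
      \<le> (\<integral>\<^sup>+\<omega>. ennreal (T\<^sup>2 * c\<^sup>2) * (\<integral>\<^sup>+z. ennreal ((W (z, X j \<omega>))\<^sup>2) \<partial>\<mu>) \<partial>\<Omega>)"
  proof (intro nn_integral_mono)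
    fix \<omega> assume w: "\<omega> \<in> space \<Omega>"
    have [measurable]: "X j \<omega> \<in> space M" using w by simp
    have "(\<integral>\<^sup>+z. ennreal ((R' N b (z, X j \<omega>))\<^sup>2) \<partial>\<mu>) \<le> (\<integral>\<^sup>+z. ennreal (T\<^sup>2 * c\<^sup>2) * ennreal ((W (z, X j \<omega>))\<^sup>2) \<partial>\<mu>)"
      using w by (intro nn_integral_mono) (auto simp: ennreal_mult[symmetric] intro!: ennreal_leI R'_square_le)
    then show "(\<integral>\<^sup>+z. ennreal ((R' N b (z, X j \<omega>))\<^sup>2) \<partial>\<mu>) \<le> ennreal (T\<^sup>2 * c\<^sup>2) * (\<integral>\<^sup>+z. ennreal ((W (z, X j \<omega>))\<^sup>2) \<partial>\<mu>)"
      by (simp add: nn_integral_cmult)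
  qed
  also have "\<dots> = ennreal (T\<^sup>2 * c\<^sup>2) * (\<integral>\<^sup>+\<omega>. (\<integral>\<^sup>+z. ennreal ((W (z, X j \<omega>))\<^sup>2) \<partial>\<mu>) \<partial>\<Omega>)"
    by (rule nn_integral_cmult[OF nn_integral_mu_measurable[of _ j]]) measurable
  also have "\<dots> \<le> ennreal (T\<^sup>2 * c\<^sup>2) * ennreal C0" by (intro mult_left_mono moment_mu) simp
  finally show ?thesis using C0_ge_1 by (simp add: ennreal_mult)
qed

lemma G'_moment: "(\<integral>\<^sup>+\<omega>. ennreal ((G' N (X l \<omega>, X j \<omega>))\<^sup>2) \<partial>\<Omega>) \<le> ennreal (T\<^sup>2 * c\<^sup>2 * C0)"
proof -
  have "(\<integral>\<^sup>+\<omega>. ennreal ((G' N (X l \<omega>, X j \<omega>))\<^sup>2) \<partial>\<Omega>) \<le> (\<integral>\<^sup>+\<omega>. ennreal (T\<^sup>2 * c\<^sup>2) * ennreal ((W (X l \<omega>, X j \<omega>))\<^sup>2) \<partial>\<Omega>)"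
    by (intro nn_integral_mono) (auto simp: ennreal_mult[symmetric] intro!: ennreal_leI G'_square_le)
  also have "\<dots> = ennreal (T\<^sup>2 * c\<^sup>2) * (\<integral>\<^sup>+\<omega>. ennreal ((W (X l \<omega>, X j \<omega>))\<^sup>2) \<partial>\<Omega>)"
    by (rule nn_integral_cmult) measurable
  also have "\<dots> \<le> ennreal (T\<^sup>2 * c\<^sup>2) * ennreal C0" by (intro mult_left_mono moment) simp
  finally show ?thesis using C0_ge_1 by (simp add: ennreal_mult)
qed

text \<open>For a frozen first argument, the Poisson equation in the second coordinate writes the
  sum as differences with compensators plus an initial term. The horizon m - l runs down to 0, so
  nothing is left at the end.\<close>

lemma sum_G_telescope:
  "(\<Sum>l<m. G N (z, x (Suc l))) = R' N m (z, x 0) + (\<Sum>l<m. R N (m - l) (z, x (Suc l)) - R' N (m - l) (z, x l))"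
proof -
  have "(\<Sum>l<m. R N (m - l) (z, x (Suc l)) - R' N (m - l) (z, x l))
      = (\<Sum>l<m. G N (z, x (Suc l)) + (R' N (m - Suc l) (z, x (Suc l)) - R' N (m - l) (z, x l)))"
  proof (rule sum.cong[OF refl])
    fix l assume "l \<in> {..<m}"
    then have "m - l = Suc (m - Suc l)" by auto
    then have "R N (m - l) (z, x (Suc l)) = G N (z, x (Suc l)) + R' N (m - Suc l) (z, x (Suc l))"
      by (metis R_Suc)
    then show "R N (m - l) (z, x (Suc l)) - R' N (m - l) (z, x l) =
        G N (z, x (Suc l)) + (R' N (m - Suc l) (z, x (Suc l)) - R' N (m - l) (z, x l))" by simp
  qed
  also have "\<dots> = (\<Sum>l<m. G N (z, x (Suc l))) + (R' N (m - m) (z, x m) - R' N (m - 0) (z, x 0))"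
    unfolding sum.distrib by (subst sum_lessThan_telescope[of "\<lambda>l. R' N (m - l) (z, x l)"]) simp
  finally show ?thesis by simp
qed

text \<open>The martingale bound is applied for each frozen \<open>z\<close>, and \<open>z\<close>
  is integrated under mu only afterwards, by Fubini. The result is linear in \<open>m\<close>, where
  Cauchy-Schwarz would give m^2. In the constant, 4 + 6 c^2 comes from \<open>R\<close> and a
  further c^2 from the initial term \<open>R'\<close>.\<close>

lemma G_sum_moment:
  "(\<integral>\<^sup>+\<omega>. (\<integral>\<^sup>+z. ennreal ((\<Sum>l<m. G N (z, X (Suc l) \<omega>))\<^sup>2) \<partial>\<mu>) \<partial>\<Omega>) \<le> ennreal (T\<^sup>2 * (4 + 7 * c\<^sup>2) * C0 * (real m + 1))"
proof -
  interpret Om: prob_space \<Omega> by (rule prob_Omega)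
  interpret mu: prob_space \<mu> by (rule prob_mu)
  interpret Omu: pair_prob_space \<Omega> \<mu> ..
  have swap: "(\<integral>\<^sup>+\<omega>. (\<integral>\<^sup>+z. f \<omega> z \<partial>\<mu>) \<partial>\<Omega>) = (\<integral>\<^sup>+z. (\<integral>\<^sup>+\<omega>. f \<omega> z \<partial>\<Omega>) \<partial>\<mu>)"
    if "(\<lambda>(\<omega>, z). f \<omega> z) \<in> borel_measurable (\<Omega> \<Otimes>\<^sub>M M)" for f :: "'w \<Rightarrow> 'a \<Rightarrow> ennreal"
    using that by (intro Omu.Fubini'[symmetric]) (simp cong: measurable_cong_sets add: measurable_cong_sets[OF sets_pair_measure_cong[OF refl sets_mu] refl])
  let ?r = "\<lambda>l z. \<integral>\<^sup>+\<omega>. ennreal ((R N (m - l) (z, X (Suc l) \<omega>))\<^sup>2) \<partial>\<Omega>"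
  let ?r' = "\<lambda>z. \<integral>\<^sup>+\<omega>. ennreal ((R' N m (z, X 0 \<omega>))\<^sup>2) \<partial>\<Omega>"
  have pt: "(\<integral>\<^sup>+\<omega>. ennreal ((\<Sum>l<m. G N (z, X (Suc l) \<omega>))\<^sup>2) \<partial>\<Omega>) \<le> ?r' z + (\<Sum>l<m. ?r l z)" if z: "z \<in> space M" for z
  proof -
    note [measurable] = z
    have "(\<integral>\<^sup>+\<omega>. ennreal ((\<Sum>l<m. G N (z, X (Suc l) \<omega>))\<^sup>2) \<partial>\<Omega>)
      = (\<integral>\<^sup>+\<omega>. ennreal ((R' N m (z, X 0 \<omega>) + (\<Sum>l<m. R N (m - l) (z, X (Suc l) \<omega>) - (\<integral>w. R N (m - l) (z, w) \<partial>P (X l \<omega>))))\<^sup>2) \<partial>\<Omega>)"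
      by (intro nn_integral_cong) (subst sum_G_telescope, simp add: integral_R z)
    also have "\<dots> \<le> ?r' z + (\<Sum>l<m. ?r l z)"
    proof (rule martingale_difference_sum_le)
      have [measurable]: "X 0 \<in> Fil 0 \<rightarrow>\<^sub>M M" by (rule measurable_X_Fil) simp
      show "(\<lambda>\<omega>. R' N m (z, X 0 \<omega>)) \<in> borel_measurable (Fil 0)" by measurable
      show "(\<lambda>(\<omega>, w). R N (m - l) (z, w)) \<in> borel_measurable (Fil l \<Otimes>\<^sub>M M)" for l by measurable
    qed
    finally show ?thesis .
  qed
  have mr [measurable]: "?r l \<in> borel_measurable M" "?r' \<in> borel_measurable M" for l
    by (rule Om.borel_measurable_nn_integral, measurable)+
  have Ir: "(\<integral>\<^sup>+z. ?r l z \<partial>\<mu>) \<le> ennreal (4 * (T\<^sup>2 * C0) + 6 * (T\<^sup>2 * c\<^sup>2) * C0)" for l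
    by (subst swap[symmetric]) (measurable, rule R_moment_mu)
  have Ir': "(\<integral>\<^sup>+z. ?r' z \<partial>\<mu>) \<le> ennreal (T\<^sup>2 * c\<^sup>2 * C0)"
    by (subst swap[symmetric]) (measurable, rule R'_moment_mu)
  have "(\<integral>\<^sup>+\<omega>. (\<integral>\<^sup>+z. ennreal ((\<Sum>l<m. G N (z, X (Suc l) \<omega>))\<^sup>2) \<partial>\<mu>) \<partial>\<Omega>)
      = (\<integral>\<^sup>+z. (\<integral>\<^sup>+\<omega>. ennreal ((\<Sum>l<m. G N (z, X (Suc l) \<omega>))\<^sup>2) \<partial>\<Omega>) \<partial>\<mu>)"
    by (rule swap) measurable
  also have "\<dots> \<le> (\<integral>\<^sup>+z. ?r' z + (\<Sum>l<m. ?r l z) \<partial>\<mu>)"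
    using pt by (intro nn_integral_mono) simp
  also have "\<dots> = (\<integral>\<^sup>+z. ?r' z \<partial>\<mu>) + (\<Sum>l<m. \<integral>\<^sup>+z. ?r l z \<partial>\<mu>)"
    by (subst nn_integral_add, measurable, subst nn_integral_sum, measurable)
  also have "\<dots> \<le> ennreal (T\<^sup>2 * c\<^sup>2 * C0) + (\<Sum>l<m. ennreal (4 * (T\<^sup>2 * C0) + 6 * (T\<^sup>2 * c\<^sup>2) * C0))"
    by (intro add_mono sum_mono Ir Ir')
  also have "\<dots> = ennreal (T\<^sup>2 * c\<^sup>2 * C0 + real m * (4 * (T\<^sup>2 * C0) + 6 * (T\<^sup>2 * c\<^sup>2) * C0))"
  proof -
    have "0 \<le> 4 * (T\<^sup>2 * C0) + 6 * (T\<^sup>2 * c\<^sup>2) * C0" "0 \<le> T\<^sup>2 * c\<^sup>2 * C0" using C0_ge_1 by auto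
    then show ?thesis
      by (simp only: sum_constant card_lessThan ennreal_of_nat_eq_real_of_nat ennreal_mult[symmetric] ennreal_plus[symmetric]
          of_nat_0_le_iff mult_nonneg_nonneg)
  qed
  also have "\<dots> \<le> ennreal (T\<^sup>2 * (4 + 7 * c\<^sup>2) * C0 * (real m + 1))"
  proof (rule ennreal_leI)
    have "0 \<le> T\<^sup>2 * C0 * (4 + 6 * c\<^sup>2) + real m * (T\<^sup>2 * c\<^sup>2 * C0)" using C0_ge_1 by auto
    then show "T\<^sup>2 * c\<^sup>2 * C0 + real m * (4 * (T\<^sup>2 * C0) + 6 * (T\<^sup>2 * c\<^sup>2) * C0) \<le> T\<^sup>2 * (4 + 7 * c\<^sup>2) * C0 * (real m + 1)"
      by (simp add: algebra_simps)
  qed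
  finally show ?thesis .
qed

end

section \<open>The degenerate U-statistic\<close>

context degenerate_kernel_chain
begin

text \<open>Subtraction on \<open>nat\<close> is truncated: for \<open>t < k\<close> every pair is near and \<open>far n k t\<close> vanishes.\<close>

definition near :: "nat \<Rightarrow> nat \<Rightarrow> nat \<Rightarrow> 'w \<Rightarrow> 'a \<Rightarrow> real" where
  "near n k t \<omega> z = (\<Sum>s\<in>{t - k..<t}. G (n - t) (z, X (Suc s) \<omega>))"

definition far :: "nat \<Rightarrow> nat \<Rightarrow> nat \<Rightarrow> 'w \<Rightarrow> 'a \<Rightarrow> real" where
  "far n k t \<omega> z = (\<Sum>s<t - k. G (n - t) (z, X (Suc s) \<omega>))"

text \<open>The point \<open>x\<close> is an argument separate from the past, so that it can be
  given the law mu independently of \<open>\<omega>\<close>.\<close>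

definition cvar :: "nat \<Rightarrow> nat \<Rightarrow> nat \<Rightarrow> 'w \<Rightarrow> 'a \<Rightarrow> ennreal" where
  "cvar n k t \<omega> x = (\<integral>\<^sup>+z. ennreal ((far n k t \<omega> z)\<^sup>2) \<partial>P x)"

text \<open>The cut-off looks at time \<open>t\<close> and not at the new value \<open>z\<close>,
  hence compensation still yields a martingale difference.\<close>

definition trunc :: "nat \<Rightarrow> nat \<Rightarrow> real \<Rightarrow> nat \<Rightarrow> 'w \<Rightarrow> 'a \<Rightarrow> real" where
  "trunc n k a t \<omega> z = near n k t \<omega> z + of_bool (cvar n k t \<omega> (X t \<omega>) \<le> ennreal a) * far n k t \<omega> z"

text \<open>Diagonal terms that appear when the index \<open>t\<close> joins the inner sum during
  telescoping; they are controlled by the moments of \<open>W\<close> on the diagonal.\<close>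

definition remainder :: "nat \<Rightarrow> 'w \<Rightarrow> real" where
  "remainder n \<omega> = (\<Sum>t<n. G' (n - Suc t) (X (Suc t) \<omega>, X (Suc t) \<omega>))"

lemma near_measurable: "(\<lambda>(\<omega>, z). near n k t \<omega> z) \<in> borel_measurable (Fil t \<Otimes>\<^sub>M M)"
  unfolding near_def case_prod_beta'
proof (rule borel_measurable_sum)
  fix s assume "s \<in> {t - k..<t}"
  then have [measurable]: "X (Suc s) \<in> Fil t \<rightarrow>\<^sub>M M" by (intro measurable_X_Fil) auto
  show "(\<lambda>u. G (n - t) (snd u, X (Suc s) (fst u))) \<in> borel_measurable (Fil t \<Otimes>\<^sub>M M)" by measurable
qed

text \<open>The indices reach at most t - k, so for k <= t the far part is known \<open>k\<close>
  steps before time \<open>t\<close>. This gap is what decoupling exploits.\<close>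

lemma far_measurable: "(\<lambda>(\<omega>, z). far n k t \<omega> z) \<in> borel_measurable (Fil (t - k) \<Otimes>\<^sub>M M)"
  unfolding far_def case_prod_beta'
proof (rule borel_measurable_sum)
  fix s assume "s \<in> {..<t - k}"
  then have [measurable]: "X (Suc s) \<in> Fil (t - k) \<rightarrow>\<^sub>M M" by (intro measurable_X_Fil) auto
  show "(\<lambda>u. G (n - t) (snd u, X (Suc s) (fst u))) \<in> borel_measurable (Fil (t - k) \<Otimes>\<^sub>M M)" by measurable
qed

lemma cvar_measurable: "(\<lambda>(\<omega>, x). cvar n k t \<omega> x) \<in> borel_measurable (Fil (t - k) \<Otimes>\<^sub>M M)"
  unfolding cvar_def case_prod_beta'
proof (rule nn_integral_measurable_subprob_algebra2[where N=M])
  show "(\<lambda>u. P (snd u)) \<in> Fil (t - k) \<Otimes>\<^sub>M M \<rightarrow>\<^sub>M subprob_algebra M" by measurable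
  have "(\<lambda>u. (fst (fst u), snd u)) \<in> (Fil (t - k) \<Otimes>\<^sub>M M) \<Otimes>\<^sub>M M \<rightarrow>\<^sub>M Fil (t - k) \<Otimes>\<^sub>M M" by measurable
  from measurable_compose[OF this far_measurable]
  have [measurable]: "(\<lambda>u. far n k t (fst (fst u)) (snd u)) \<in> borel_measurable ((Fil (t - k) \<Otimes>\<^sub>M M) \<Otimes>\<^sub>M M)" by simp
  show "(\<lambda>(x, y). ennreal ((far n k t (fst x) y)\<^sup>2)) \<in> borel_measurable ((Fil (t - k) \<Otimes>\<^sub>M M) \<Otimes>\<^sub>M M)" by measurable
qed

lemma trunc_indicator_measurable:
  "(\<lambda>\<omega>. cvar n k t \<omega> (X t \<omega>)) \<in> borel_measurable (Fil t)"
proof -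
  have "(\<lambda>\<omega>. (\<omega>, X t \<omega>)) \<in> Fil t \<rightarrow>\<^sub>M Fil (t - k) \<Otimes>\<^sub>M M"
    by (intro measurable_Pair measurable_id_Fil_mono measurable_X_Fil) auto
  from measurable_compose[OF this cvar_measurable] show ?thesis by simp
qed

lemma trunc_measurable: "(\<lambda>(\<omega>, z). trunc n k a t \<omega> z) \<in> borel_measurable (Fil t \<Otimes>\<^sub>M M)"
proof -
  note [measurable] = near_measurable[of n k t] measurable_Fil_pair_mono[OF far_measurable[of n k t] diff_le_self]
    trunc_indicator_measurable[of n k t]
  show ?thesis unfolding trunc_def by measurable
qed

lemma integrable_near: "\<omega> \<in> space \<Omega> \<Longrightarrow> x \<in> space M \<Longrightarrow> integrable (P x) (near n k t \<omega>)"
  and integrable_far: "\<omega> \<in> space \<Omega> \<Longrightarrow> x \<in> space M \<Longrightarrow> integrable (P x) (far n k t \<omega>)"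
  unfolding near_def[abs_def] far_def[abs_def]
  by (auto intro!: Bochner_Integration.integrable_sum integrable_G)

lemma integral_near: "\<omega> \<in> space \<Omega> \<Longrightarrow> x \<in> space M \<Longrightarrow> (\<integral>z. near n k t \<omega> z \<partial>P x) = (\<Sum>s\<in>{t - k..<t}. G' (n - t) (x, X (Suc s) \<omega>))"
  and integral_far: "\<omega> \<in> space \<Omega> \<Longrightarrow> x \<in> space M \<Longrightarrow> (\<integral>z. far n k t \<omega> z \<partial>P x) = (\<Sum>s<t - k. G' (n - t) (x, X (Suc s) \<omega>))"
  unfolding near_def far_def by (simp_all add: Bochner_Integration.integral_sum integrable_G integral_G)

lemma near_far_sum: "(\<Sum>s<t. f s) = (\<Sum>s\<in>{t - k..<t}. f s) + (\<Sum>s<t - k. f s)" for f :: "nat \<Rightarrow> real"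
  using sum.atLeastLessThan_concat[of 0 "t - k" t f] by (simp add: lessThan_atLeast0 add.commute)

text \<open>As long as no conditional variance exceeds the level, the cut-off is inactive, and the
  Poisson equation telescopes over time and over the growing range of the inner sum.\<close>

lemma U_decomposition:
  assumes w: "\<omega> \<in> space \<Omega>" and small: "\<And>t. t < n \<Longrightarrow> cvar n k t \<omega> (X t \<omega>) \<le> ennreal a"
  shows "(\<Sum>t<n. \<Sum>s<t. h (X (Suc t) \<omega>, X (Suc s) \<omega>)) =
     (\<Sum>t<n. trunc n k a t \<omega> (X (Suc t) \<omega>) - (\<integral>z. trunc n k a t \<omega> z \<partial>P (X t \<omega>))) + remainder n \<omega>"
proof -
  define B where "B t s = G' (n - t) (X t \<omega>, X (Suc s) \<omega>)" for t s
  have 1: "trunc n k a t \<omega> (X (Suc t) \<omega>) - (\<integral>z. trunc n k a t \<omega> z \<partial>P (X t \<omega>))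
     = (\<Sum>s<t. h (X (Suc t) \<omega>, X (Suc s) \<omega>)) + ((\<Sum>s<t. B (Suc t) s) - (\<Sum>s<t. B t s))" if t: "t < n" for t
  proof -
    have x: "X t \<omega> \<in> space M" using w by simp
    have "(\<integral>z. trunc n k a t \<omega> z \<partial>P (X t \<omega>)) = (\<integral>z. near n k t \<omega> z \<partial>P (X t \<omega>)) + (\<integral>z. far n k t \<omega> z \<partial>P (X t \<omega>))"
      using small[OF t] integrable_near[OF w x] integrable_far[OF w x] by (simp add: trunc_def)
    also have "\<dots> = (\<Sum>s<t. B t s)"
      unfolding integral_near[OF w x] integral_far[OF w x] B_def by (rule near_far_sum[symmetric])
    finally have i: "(\<integral>z. trunc n k a t \<omega> z \<partial>P (X t \<omega>)) = (\<Sum>s<t. B t s)" .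
    have "trunc n k a t \<omega> (X (Suc t) \<omega>) = (\<Sum>s<t. G (n - t) (X (Suc t) \<omega>, X (Suc s) \<omega>))"
      unfolding trunc_def near_def far_def using small[OF t] near_far_sum[of "\<lambda>s. G (n - t) (X (Suc t) \<omega>, X (Suc s) \<omega>)" t k] by simp
    also have "\<dots> = (\<Sum>s<t. h (X (Suc t) \<omega>, X (Suc s) \<omega>) + B (Suc t) s)"
    proof (rule sum.cong[OF refl])
      fix s
      \<comment> \<open>Since t < n, the horizon is positive and one step of the Poisson equation
        can be split off.\<close>
      have "n - t = Suc (n - Suc t)" using t by simp
      then show "G (n - t) (X (Suc t) \<omega>, X (Suc s) \<omega>) = h (X (Suc t) \<omega>, X (Suc s) \<omega>) + B (Suc t) s"
        using w by (simp add: B_def G_Suc del: Suc_diff_Suc)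
    qed
    finally show ?thesis using i by (simp add: sum.distrib)
  qed
  \<comment> \<open>The diagonal terms \<open>B (Suc t) t\<close> extend the inner range by one and
    make the sum telescope; its end value vanishes because the horizon is 0 at time
    \<open>n\<close>.\<close>
  have "(\<Sum>t<n. (\<Sum>s<t. B (Suc t) s) - (\<Sum>s<t. B t s)) + remainder n \<omega> = (\<Sum>t<n. (\<Sum>s<Suc t. B (Suc t) s) - (\<Sum>s<t. B t s))"
    unfolding remainder_def sum.distrib[symmetric] by (intro sum.cong) (auto simp: B_def)
  also have "\<dots> = (\<Sum>s<n. B n s) - (\<Sum>s<0. B 0 s)" by (rule sum_lessThan_telescope)
  also have "\<dots> = 0" by (simp add: B_def)
  finally have "(\<Sum>t<n. (\<Sum>s<t. B (Suc t) s) - (\<Sum>s<t. B t s)) + remainder n \<omega> = 0" .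
  then show ?thesis by (simp add: 1 sum.distrib)
qed

lemma near_moment:
  "(\<integral>\<^sup>+\<omega>. ennreal ((near n k t \<omega> (X (Suc t) \<omega>))\<^sup>2) \<partial>\<Omega>) \<le> ennreal ((real k)\<^sup>2 * (2 * (T\<^sup>2 * C0) + 2 * (T\<^sup>2 * c\<^sup>2) * C0))"
  unfolding near_def using C0_ge_1 by (intro sum_second_moment G_moment) auto

definition B3 :: real where "B3 = (4 + 7 * c\<^sup>2) * C0"

lemma B3_nonneg: "0 \<le> B3"
  using C0_ge_1 by (simp add: B3_def)

text \<open>Under mu the averaging over one step of \<open>P\<close> disappears by invariance, which
  leaves exactly the decoupled second moment of \<open>G_sum_moment\<close>.\<close>

lemma cvar_mu:
  assumes "t < n"
  shows "(\<integral>\<^sup>+\<omega>. (\<integral>\<^sup>+x. cvar n k t \<omega> x \<partial>\<mu>) \<partial>\<Omega>) \<le> ennreal (T\<^sup>2 * B3 * real n)"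
proof -
  have "(\<integral>\<^sup>+\<omega>. (\<integral>\<^sup>+x. cvar n k t \<omega> x \<partial>\<mu>) \<partial>\<Omega>) = (\<integral>\<^sup>+\<omega>. (\<integral>\<^sup>+z. ennreal ((far n k t \<omega> z)\<^sup>2) \<partial>\<mu>) \<partial>\<Omega>)"
  proof (rule nn_integral_cong)
    fix \<omega> assume w: "\<omega> \<in> space \<Omega>"
    have [measurable]: "far n k t \<omega> \<in> borel_measurable M" by (rule section_measurable[OF far_measurable w])
    show "(\<integral>\<^sup>+x. cvar n k t \<omega> x \<partial>\<mu>) = (\<integral>\<^sup>+z. ennreal ((far n k t \<omega> z)\<^sup>2) \<partial>\<mu>)"
      unfolding cvar_def by (rule nn_integral_mu_P) measurable
  qed
  also have "\<dots> \<le> ennreal (T\<^sup>2 * (4 + 7 * c\<^sup>2) * C0 * (real (t - k) + 1))"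
    unfolding far_def by (rule G_sum_moment)
  also have "\<dots> \<le> ennreal (T\<^sup>2 * B3 * real n)"
  proof (rule ennreal_leI)
    have "T\<^sup>2 * B3 * (real (t - k) + 1) \<le> T\<^sup>2 * B3 * real n"
      using assms B3_nonneg by (intro mult_left_mono) auto
    then show "T\<^sup>2 * (4 + 7 * c\<^sup>2) * C0 * (real (t - k) + 1) \<le> T\<^sup>2 * B3 * real n" by (simp add: B3_def mult.assoc)
  qed
  finally show ?thesis .
qed

text \<open>Decoupling \<open>X t\<close> from the past up to time \<open>t - 2\<^sup>i\<close> requires a bounded function; this is
  why the far part of the martingale is truncated at the level \<open>a\<close> of its conditional variance.\<close>

lemma cvar_truncated_moment:
  assumes t: "t < n" and a: "0 \<le> a"
  shows "(\<integral>\<^sup>+\<omega>. cvar n (2 ^ i) t \<omega> (X t \<omega>) * of_bool (cvar n (2 ^ i) t \<omega> (X t \<omega>) \<le> ennreal a) \<partial>\<Omega>)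
     \<le> ennreal (T\<^sup>2 * B3 * real n + a * (64 * D0 / 8 ^ i))" (is "?L \<le> ?R")
proof (cases "2 ^ i \<le> t")
  case False
  then have "cvar n (2 ^ i) t \<omega> x = 0" for \<omega> x by (simp add: cvar_def far_def)
  then show ?thesis by simp
next
  case True
  define p where "p = t - 2 ^ i"
  have tp: "t = p + 2 ^ i" using True by (simp add: p_def)
  define \<phi> where "\<phi> \<omega> x = cvar n (2 ^ i) t \<omega> x * of_bool (cvar n (2 ^ i) t \<omega> x \<le> ennreal a)" for \<omega> x
  note [measurable] = cvar_measurable[of n "2 ^ i" t, folded p_def]
  have m: "(\<lambda>(\<omega>, x). \<phi> \<omega> x) \<in> borel_measurable (Fil p \<Otimes>\<^sub>M M)" unfolding \<phi>_def by measurable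
  have "?L = (\<integral>\<^sup>+\<omega>. \<phi> \<omega> (X (p + 2 ^ i) \<omega>) \<partial>\<Omega>)" unfolding \<phi>_def tp ..
  also have "\<dots> \<le> (\<integral>\<^sup>+\<omega>. (\<integral>\<^sup>+x. \<phi> \<omega> x \<partial>\<mu>) \<partial>\<Omega>) + ennreal (a * (64 * D0 / 8 ^ i))"
    by (rule decouple[OF m _ a]) (auto simp: \<phi>_def)
  also have "\<dots> \<le> (\<integral>\<^sup>+\<omega>. (\<integral>\<^sup>+x. cvar n (2 ^ i) t \<omega> x \<partial>\<mu>) \<partial>\<Omega>) + ennreal (a * (64 * D0 / 8 ^ i))"
    by (intro add_right_mono nn_integral_mono) (auto simp: \<phi>_def)
  also have "\<dots> \<le> ennreal (T\<^sup>2 * B3 * real n) + ennreal (a * (64 * D0 / 8 ^ i))"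
    by (intro add_right_mono cvar_mu t)
  also have "\<dots> = ?R" using a B3_nonneg D0_ge by (intro ennreal_plus[symmetric]) auto
  finally show ?thesis .
qed

text \<open>The indicator is decoupled first and Markov's inequality is applied under mu, because
  decoupling requires a bounded function and the conditional variance has no known bound.\<close>

lemma cvar_large:
  assumes t: "t < n" and a: "0 < a"
  shows "(\<integral>\<^sup>+\<omega>. of_bool (\<not> cvar n (2 ^ i) t \<omega> (X t \<omega>) \<le> ennreal a) \<partial>\<Omega>)
     \<le> ennreal (T\<^sup>2 * B3 * real n / a + 64 * D0 / 8 ^ i)" (is "?L \<le> ?R")
proof (cases "2 ^ i \<le> t")
  case False
  then have "cvar n (2 ^ i) t \<omega> x = 0" for \<omega> x by (simp add: cvar_def far_def)
  then show ?thesis by simp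
next
  case True
  define p where "p = t - 2 ^ i"
  have tp: "t = p + 2 ^ i" using True by (simp add: p_def)
  define \<phi> :: "'w \<Rightarrow> 'a \<Rightarrow> ennreal" where "\<phi> \<omega> x = of_bool (\<not> cvar n (2 ^ i) t \<omega> x \<le> ennreal a)" for \<omega> x
  note cm [measurable] = cvar_measurable[of n "2 ^ i" t, folded p_def]
  have m: "(\<lambda>(\<omega>, x). \<phi> \<omega> x) \<in> borel_measurable (Fil p \<Otimes>\<^sub>M M)" unfolding \<phi>_def by measurable
  have le: "\<phi> \<omega> x \<le> ennreal (1 / a) * cvar n (2 ^ i) t \<omega> x" for \<omega> x
  proof (cases "cvar n (2 ^ i) t \<omega> x \<le> ennreal a")
    case False
    then have "ennreal (1 / a) * ennreal a \<le> ennreal (1 / a) * cvar n (2 ^ i) t \<omega> x"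
      by (intro mult_left_mono) auto
    then show ?thesis using a by (simp add: \<phi>_def False ennreal_mult[symmetric])
  qed (simp add: \<phi>_def)
  have "?L = (\<integral>\<^sup>+\<omega>. \<phi> \<omega> (X (p + 2 ^ i) \<omega>) \<partial>\<Omega>)" unfolding \<phi>_def tp ..
  also have "\<dots> \<le> (\<integral>\<^sup>+\<omega>. (\<integral>\<^sup>+x. \<phi> \<omega> x \<partial>\<mu>) \<partial>\<Omega>) + ennreal (1 * (64 * D0 / 8 ^ i))"
    by (rule decouple[OF m]) (auto simp: \<phi>_def)
  also have "\<dots> \<le> (\<integral>\<^sup>+\<omega>. ennreal (1 / a) * (\<integral>\<^sup>+x. cvar n (2 ^ i) t \<omega> x \<partial>\<mu>) \<partial>\<Omega>) + ennreal (1 * (64 * D0 / 8 ^ i))"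
  proof (intro add_right_mono nn_integral_mono)
    fix \<omega> assume w: "\<omega> \<in> space \<Omega>"
    have [measurable]: "cvar n (2 ^ i) t \<omega> \<in> borel_measurable M" by (rule section_measurable[OF cvar_measurable w])
    have "(\<integral>\<^sup>+x. \<phi> \<omega> x \<partial>\<mu>) \<le> (\<integral>\<^sup>+x. ennreal (1 / a) * cvar n (2 ^ i) t \<omega> x \<partial>\<mu>)"
      by (intro nn_integral_mono le)
    then show "(\<integral>\<^sup>+x. \<phi> \<omega> x \<partial>\<mu>) \<le> ennreal (1 / a) * (\<integral>\<^sup>+x. cvar n (2 ^ i) t \<omega> x \<partial>\<mu>)"
      by (simp add: nn_integral_cmult)
  qed
  also have "(\<integral>\<^sup>+\<omega>. ennreal (1 / a) * (\<integral>\<^sup>+x. cvar n (2 ^ i) t \<omega> x \<partial>\<mu>) \<partial>\<Omega>) = ennreal (1 / a) * (\<integral>\<^sup>+\<omega>. (\<integral>\<^sup>+x. cvar n (2 ^ i) t \<omega> x \<partial>\<mu>) \<partial>\<Omega>)"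
    by (rule nn_integral_cmult[OF nn_integral_mu_measurable[OF cm]])
  also have "\<dots> + ennreal (1 * (64 * D0 / 8 ^ i)) \<le> ennreal (1 / a) * ennreal (T\<^sup>2 * B3 * real n) + ennreal (1 * (64 * D0 / 8 ^ i))"
    by (intro add_right_mono mult_left_mono cvar_mu t) simp
  also have "ennreal (1 / a) * ennreal (T\<^sup>2 * B3 * real n) = ennreal (T\<^sup>2 * B3 * real n / a)"
    using a B3_nonneg by (subst ennreal_mult[symmetric]) auto
  also have "ennreal (T\<^sup>2 * B3 * real n / a) + ennreal (1 * (64 * D0 / 8 ^ i)) = ?R"
    using a B3_nonneg D0_ge by (subst ennreal_plus[symmetric]) auto
  finally show ?thesis .
qed

text \<open>The cut-off is known at time \<open>t\<close>, so conditioning there turns the squared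
  far part into the truncated conditional variance.\<close>

lemma trunc_moment:
  assumes t: "t < n" and a: "0 \<le> a"
  shows "(\<integral>\<^sup>+\<omega>. ennreal ((trunc n (2 ^ i) a t \<omega> (X (Suc t) \<omega>))\<^sup>2) \<partial>\<Omega>) \<le>
     ennreal (2 * ((real (2 ^ i))\<^sup>2 * (2 * (T\<^sup>2 * C0) + 2 * (T\<^sup>2 * c\<^sup>2) * C0)) + 2 * (T\<^sup>2 * B3 * real n + a * (64 * D0 / 8 ^ i)))"
proof -
  let ?b = "\<lambda>\<omega>. of_bool (cvar n (2 ^ i) t \<omega> (X t \<omega>) \<le> ennreal a)"
  note [measurable] = near_measurable[of n "2 ^ i" t] trunc_indicator_measurable[of n "2 ^ i" t]
  have fm [measurable]: "(\<lambda>(\<omega>, z). far n (2 ^ i) t \<omega> z) \<in> borel_measurable (Fil t \<Otimes>\<^sub>M M)"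
    by (rule measurable_Fil_pair_mono[OF far_measurable diff_le_self])
  define \<psi> where "\<psi> \<omega> z = ennreal ((far n (2 ^ i) t \<omega> z)\<^sup>2) * ?b \<omega>" for \<omega> z
  have \<psi>m: "(\<lambda>(\<omega>, z). \<psi> \<omega> z) \<in> borel_measurable (Fil t \<Otimes>\<^sub>M M)" unfolding \<psi>_def by measurable
  have "(\<integral>\<^sup>+\<omega>. \<psi> \<omega> (X (Suc t) \<omega>) \<partial>\<Omega>) = (\<integral>\<^sup>+\<omega>. (\<integral>\<^sup>+z. \<psi> \<omega> z \<partial>P (X t \<omega>)) \<partial>\<Omega>)"
    by (rule nn_integral_markov_step[OF \<psi>m])
  also have "\<dots> = (\<integral>\<^sup>+\<omega>. cvar n (2 ^ i) t \<omega> (X t \<omega>) * ?b \<omega> \<partial>\<Omega>)"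
  proof (rule nn_integral_cong)
    fix \<omega> assume w: "\<omega> \<in> space \<Omega>"
    have "far n (2 ^ i) t \<omega> \<in> borel_measurable (P (X t \<omega>))"
      using section_measurable[OF far_measurable w] w by (simp cong: measurable_cong_sets)
    then show "(\<integral>\<^sup>+z. \<psi> \<omega> z \<partial>P (X t \<omega>)) = cvar n (2 ^ i) t \<omega> (X t \<omega>) * ?b \<omega>"
      unfolding \<psi>_def cvar_def by (subst nn_integral_multc) auto
  qed
  finally have F: "(\<integral>\<^sup>+\<omega>. \<psi> \<omega> (X (Suc t) \<omega>) \<partial>\<Omega>) \<le> ennreal (T\<^sup>2 * B3 * real n + a * (64 * D0 / 8 ^ i))"
    using cvar_truncated_moment[OF t a, of i] by simp
  have pm: "(\<lambda>\<omega>. (\<omega>, X (Suc t) \<omega>)) \<in> \<Omega> \<rightarrow>\<^sub>M Fil t \<Otimes>\<^sub>M M"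
    by (intro measurable_Pair measurable_id_Fil_Omega X_measurable)
  show ?thesis
  proof (rule nn_integral_lincomb_le[OF _ _ _ near_moment F])
    show "(\<lambda>\<omega>. \<psi> \<omega> (X (Suc t) \<omega>)) \<in> borel_measurable \<Omega>"
      using measurable_compose[OF pm \<psi>m] by simp
    have "(\<lambda>\<omega>. near n (2 ^ i) t \<omega> (X (Suc t) \<omega>)) \<in> borel_measurable \<Omega>"
      using measurable_compose[OF pm near_measurable] by simp
    then show "(\<lambda>\<omega>. ennreal ((near n (2 ^ i) t \<omega> (X (Suc t) \<omega>))\<^sup>2)) \<in> borel_measurable \<Omega>" by measurable
    fix \<omega>
    have "\<psi> \<omega> z = ennreal ((?b \<omega> * far n (2 ^ i) t \<omega> z)\<^sup>2)" for z
      by (cases "cvar n (2 ^ i) t \<omega> (X t \<omega>) \<le> ennreal a") (auto simp: \<psi>_def)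
    then show "ennreal ((trunc n (2 ^ i) a t \<omega> (X (Suc t) \<omega>))\<^sup>2) \<le>
        ennreal 2 * ennreal ((near n (2 ^ i) t \<omega> (X (Suc t) \<omega>))\<^sup>2) + ennreal 2 * \<psi> \<omega> (X (Suc t) \<omega>)"
      unfolding trunc_def by (simp only:) (intro ennreal_lincomb_le square_add_le; simp)
  qed (use a C0_ge_1 B3_nonneg D0_ge in auto)
qed

lemma remainder_moment:
  "(\<integral>\<^sup>+\<omega>. ennreal ((remainder n \<omega>)\<^sup>2) \<partial>\<Omega>) \<le> ennreal ((real n)\<^sup>2 * (T\<^sup>2 * c\<^sup>2 * C0))"
  unfolding remainder_def using C0_ge_1 by (intro sum_second_moment G'_moment) auto

text \<open>A union bound over the \<open>n\<close> times pays for the event that some cut-off is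
  active. Off it the sum is martingale plus remainder, and Chebyshev's inequality at level
  \<open>\<epsilon>\<close> for each explains the 2. The truncated martingale is estimated on the
  whole space, so adaptedness is not lost by restricting to the good event.\<close>

lemma U_tail_bound:
  assumes a: "0 < a" and l: "0 < \<epsilon>"
  shows "measure \<Omega> {\<omega> \<in> space \<Omega>. 2 * \<epsilon> < \<bar>\<Sum>t<n. \<Sum>s<t. h (X (Suc t) \<omega>, X (Suc s) \<omega>)\<bar>} \<le>
     real n * (T\<^sup>2 * B3 * real n / a + 64 * D0 / 8 ^ i) +
     (1 / \<epsilon>\<^sup>2) * (real n * (2 * ((real (2 ^ i))\<^sup>2 * (2 * (T\<^sup>2 * C0) + 2 * (T\<^sup>2 * c\<^sup>2) * C0)) + 2 * (T\<^sup>2 * B3 * real n + a * (64 * D0 / 8 ^ i)))) +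
     (1 / \<epsilon>\<^sup>2) * ((real n)\<^sup>2 * (T\<^sup>2 * c\<^sup>2 * C0))"
    (is "measure \<Omega> ?A \<le> real n * ?p + _ * (real n * ?q) + _ * ?r")
proof -
  interpret prob_space \<Omega> by (rule prob_Omega)
  let ?U = "\<lambda>\<omega>. \<Sum>t<n. \<Sum>s<t. h (X (Suc t) \<omega>, X (Suc s) \<omega>)"
  define S where "S \<omega> = (\<Sum>t<n. trunc n (2 ^ i) a t \<omega> (X (Suc t) \<omega>) - (\<integral>z. trunc n (2 ^ i) a t \<omega> z \<partial>P (X t \<omega>)))" for \<omega>
  define b :: "nat \<Rightarrow> 'w \<Rightarrow> ennreal" where "b t \<omega> = of_bool (\<not> cvar n (2 ^ i) t \<omega> (X t \<omega>) \<le> ennreal a)" for t \<omega>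
  have nn: "0 \<le> ?p" "0 \<le> ?q" "0 \<le> ?r" using a C0_ge_1 B3_nonneg D0_ge by auto
  have pm: "(\<lambda>\<omega>. (\<omega>, X (Suc t) \<omega>)) \<in> \<Omega> \<rightarrow>\<^sub>M Fil t \<Otimes>\<^sub>M M" for t
    by (intro measurable_Pair measurable_id_Fil_Omega X_measurable)
  have [measurable]: "(\<lambda>\<omega>. trunc n (2 ^ i) a t \<omega> (X (Suc t) \<omega>)) \<in> borel_measurable \<Omega>" for t
    using measurable_compose[OF pm trunc_measurable] by simp
  have [measurable]: "(\<lambda>\<omega>. \<integral>z. trunc n (2 ^ i) a t \<omega> z \<partial>P (X t \<omega>)) \<in> borel_measurable \<Omega>" for t
    by (rule measurable_Fil_Omega[OF integral_measurable_kernel[OF trunc_measurable measurable_compose[OF measurable_X_Fil P_measurable_subprob]]]) simp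
  have [measurable]: "S \<in> borel_measurable \<Omega>" unfolding S_def by measurable
  have [measurable]: "remainder n \<in> borel_measurable \<Omega>" unfolding remainder_def[abs_def] by measurable
  have [measurable]: "b t \<in> borel_measurable \<Omega>" for t
  proof -
    note [measurable] = measurable_Fil_Omega[OF trunc_indicator_measurable[of n "2 ^ i" t]]
    show ?thesis unfolding b_def by measurable
  qed
  have A: "?A \<in> sets \<Omega>" by measurable
  have S2: "(\<integral>\<^sup>+\<omega>. ennreal ((S \<omega>)\<^sup>2) \<partial>\<Omega>) \<le> ennreal (real n * ?q)"
  proof -
    have "(\<integral>\<^sup>+\<omega>. ennreal ((S \<omega>)\<^sup>2) \<partial>\<Omega>) \<le> (\<Sum>t<n. \<integral>\<^sup>+\<omega>. ennreal ((trunc n (2 ^ i) a t \<omega> (X (Suc t) \<omega>))\<^sup>2) \<partial>\<Omega>)"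
      using martingale_difference_sum_le[of "\<lambda>_. 0" "trunc n (2 ^ i) a" n, OF _ trunc_measurable] by (simp add: S_def)
    also have "\<dots> \<le> (\<Sum>t<n. ennreal ?q)"
      using a by (intro sum_mono trunc_moment) auto
    also have "\<dots> = ennreal (real n * ?q)"
      unfolding sum_constant card_lessThan using nn by (simp only: ennreal_of_nat_eq_real_of_nat ennreal_mult[symmetric] of_nat_0_le_iff)
    finally show ?thesis .
  qed
  have ind: "indicator ?A \<omega> \<le> (\<Sum>t<n. b t \<omega>) + (ennreal (1 / \<epsilon>\<^sup>2) * ennreal ((S \<omega>)\<^sup>2) + ennreal (1 / \<epsilon>\<^sup>2) * ennreal ((remainder n \<omega>)\<^sup>2))"
    if w: "\<omega> \<in> space \<Omega>" for \<omega>
  proof (cases "\<omega> \<in> ?A")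
    case inA: True
    show ?thesis
    proof (cases "\<forall>t<n. cvar n (2 ^ i) t \<omega> (X t \<omega>) \<le> ennreal a")
      case True
      then have "?U \<omega> = S \<omega> + remainder n \<omega>" unfolding S_def by (intro U_decomposition w) auto
      then have "\<epsilon> \<le> \<bar>S \<omega>\<bar> \<or> \<epsilon> \<le> \<bar>remainder n \<omega>\<bar>" using inA by auto
      moreover have "1 \<le> ennreal (1 / \<epsilon>\<^sup>2) * ennreal (y\<^sup>2)" if "\<epsilon> \<le> \<bar>y\<bar>" for y
      proof -
        have "\<epsilon>\<^sup>2 \<le> \<bar>y\<bar>\<^sup>2" using that l by (intro power_mono) auto
        then have "1 \<le> 1 / \<epsilon>\<^sup>2 * y\<^sup>2" using l by (simp add: pos_le_divide_eq)
        then have "ennreal 1 \<le> ennreal (1 / \<epsilon>\<^sup>2 * y\<^sup>2)" by (rule ennreal_leI)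
        moreover have "ennreal (1 / \<epsilon>\<^sup>2 * y\<^sup>2) = ennreal (1 / \<epsilon>\<^sup>2) * ennreal (y\<^sup>2)" by (rule ennreal_mult) auto
        ultimately show ?thesis by (simp only: ennreal_1)
      qed
      ultimately have "1 \<le> ennreal (1 / \<epsilon>\<^sup>2) * ennreal ((S \<omega>)\<^sup>2) + ennreal (1 / \<epsilon>\<^sup>2) * ennreal ((remainder n \<omega>)\<^sup>2)"
        by (meson add_increasing add_increasing2 zero_le)
      then show ?thesis using inA by (auto intro: add_increasing)
    next
      case False
      then obtain t where t: "t < n" "b t \<omega> = 1" unfolding b_def by auto
      have "b t \<omega> \<le> (\<Sum>t<n. b t \<omega>)" using t by (intro member_le_sum) auto
      then show ?thesis using inA t by (auto intro: add_increasing2)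
    qed
  qed simp
  have "emeasure \<Omega> ?A = (\<integral>\<^sup>+\<omega>. indicator ?A \<omega> \<partial>\<Omega>)" using A by simp
  also have "\<dots> \<le> (\<integral>\<^sup>+\<omega>. (\<Sum>t<n. b t \<omega>) + (ennreal (1 / \<epsilon>\<^sup>2) * ennreal ((S \<omega>)\<^sup>2) + ennreal (1 / \<epsilon>\<^sup>2) * ennreal ((remainder n \<omega>)\<^sup>2)) \<partial>\<Omega>)"
    by (intro nn_integral_mono ind)
  also have "\<dots> = (\<Sum>t<n. \<integral>\<^sup>+\<omega>. b t \<omega> \<partial>\<Omega>) + (ennreal (1 / \<epsilon>\<^sup>2) * (\<integral>\<^sup>+\<omega>. ennreal ((S \<omega>)\<^sup>2) \<partial>\<Omega>) + ennreal (1 / \<epsilon>\<^sup>2) * (\<integral>\<^sup>+\<omega>. ennreal ((remainder n \<omega>)\<^sup>2) \<partial>\<Omega>))"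
    by (simp add: nn_integral_add nn_integral_cmult nn_integral_sum)
  also have "\<dots> \<le> (\<Sum>t<n. ennreal ?p) + (ennreal (1 / \<epsilon>\<^sup>2) * ennreal (real n * ?q) + ennreal (1 / \<epsilon>\<^sup>2) * ennreal ?r)"
    using a unfolding b_def by (intro add_mono sum_mono mult_left_mono cvar_large S2 remainder_moment) auto
  also have "(\<Sum>t<n. ennreal ?p) = ennreal (real n * ?p)"
    unfolding sum_constant card_lessThan using nn by (simp only: ennreal_of_nat_eq_real_of_nat ennreal_mult[symmetric] of_nat_0_le_iff)
  also have "ennreal (1 / \<epsilon>\<^sup>2) * ennreal (real n * ?q) = ennreal (1 / \<epsilon>\<^sup>2 * (real n * ?q))"
    using nn by (intro ennreal_mult[symmetric]) auto
  also have "ennreal (1 / \<epsilon>\<^sup>2) * ennreal ?r = ennreal (1 / \<epsilon>\<^sup>2 * ?r)"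
    using nn by (intro ennreal_mult[symmetric]) auto
  also have "ennreal (real n * ?p) + (ennreal (1 / \<epsilon>\<^sup>2 * (real n * ?q)) + ennreal (1 / \<epsilon>\<^sup>2 * ?r)) =
      ennreal (real n * ?p + 1 / \<epsilon>\<^sup>2 * (real n * ?q) + 1 / \<epsilon>\<^sup>2 * ?r)"
  proof -
    have "0 \<le> real n * ?p" "0 \<le> 1 / \<epsilon>\<^sup>2 * (real n * ?q)" "0 \<le> 1 / \<epsilon>\<^sup>2 * ?r"
      using nn by (auto intro!: mult_nonneg_nonneg)
    then show ?thesis by (simp only: ennreal_plus[symmetric] add_nonneg_nonneg add.assoc)
  qed
  finally have "ennreal (measure \<Omega> ?A) \<le> ennreal (real n * ?p + 1 / \<epsilon>\<^sup>2 * (real n * ?q) + 1 / \<epsilon>\<^sup>2 * ?r)"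
    by (simp only: emeasure_eq_measure)
  moreover have "0 \<le> real n * ?p + 1 / \<epsilon>\<^sup>2 * (real n * ?q) + 1 / \<epsilon>\<^sup>2 * ?r"
    using mult_nonneg_nonneg[OF of_nat_0_le_iff nn(1), of n] mult_nonneg_nonneg[OF _ mult_nonneg_nonneg[OF of_nat_0_le_iff nn(2)], of "1 / \<epsilon>\<^sup>2" n]
      mult_nonneg_nonneg[OF _ nn(3), of "1 / \<epsilon>\<^sup>2"]
    by (simp only: zero_le_divide_1_iff zero_le_power2 add_nonneg_nonneg)
  ultimately show ?thesis by (subst (asm) ennreal_le_iff)
qed

end

section \<open>Choice of the lag and of the truncation level\<close>

context degenerate_kernel_chain
begin

text \<open>The kernel enters the bound only through the ratio of \<open>T\<close> to sqrt n times
  \<open>s\<close>; all other constants are independent of it, which is what permits kernels that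
  vary with \<open>n\<close>.\<close>

lemma U_prob_le:
  assumes n: "2 \<le> n" and s: "0 < s" and e: "0 < \<epsilon>"
  shows "measure \<Omega> {\<omega> \<in> space \<Omega>. \<epsilon> * (sqrt (real n) * (real n - 1) * s) < \<bar>\<Sum>t<n. \<Sum>s<t. h (X (Suc t) \<omega>, X (Suc s) \<omega>)\<bar>}
    \<le> ((4 + 7 * c\<^sup>2) * C0 + 16 / \<epsilon>\<^sup>2 * (2 * (2 * C0 + 2 * c\<^sup>2 * C0) + 2 * ((4 + 7 * c\<^sup>2) * C0) + c\<^sup>2 * C0)) * (T / (sqrt (real n) * s))\<^sup>2
      + (1 + 32 / \<epsilon>\<^sup>2) * (512 * (65536 * c\<^sup>2 * C0)) / sqrt (real n)"
    (is "?p \<le> ?R")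
proof -
  \<comment> \<open>The lag 2^i lies between sqrt n / 2 and sqrt n: small enough that its square,
    the cost of the near part, is at most \<open>n\<close>, and large enough that \<open>n\<close>
    decoupling errors add up to order 1 / sqrt n.\<close>
  obtain i where i: "4 ^ i \<le> n" "n < 4 ^ (i + 1)"
    using ex_power_ivl1[of 4 n] n by auto
  define N where "N = real n"
  have N: "2 \<le> N" using n by (simp add: N_def)
  define \<eta> where "\<eta> = (T / (sqrt N * s))\<^sup>2"
  \<comment> \<open>The level has the order of the squared normalization. The Markov part of the
    union bound then costs a multiple of \<open>\<eta>\<close>, and the decoupling error in the
    second moment, divided by L^2, a multiple of \<open>N * w\<close>.\<close>
  define a where "a = N ^ 3 * s\<^sup>2"
  define w where "w = 64 * D0 / 8 ^ i"
  define B1 where "B1 = 2 * C0 + 2 * c\<^sup>2 * C0"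
  define L where "L = \<epsilon> * (sqrt N * (N - 1) * s) / 2"
  have a: "0 < a" using N s by (simp add: a_def)
  have L: "0 < L" using N s e by (simp add: L_def)
  have \<eta>: "0 \<le> \<eta>" by (simp add: \<eta>_def)
  have T2: "T\<^sup>2 = \<eta> * (N * s\<^sup>2)"
    using N s by (simp add: \<eta>_def power_divide power_mult_distrib)
  have w: "0 \<le> w" using D0_ge by (simp add: w_def)
  have B1: "0 \<le> B1" using C0_ge_1 by (simp add: B1_def)
  \<comment> \<open>For N >= 2 one has N - 1 >= N / 2; together with the halving in \<open>L\<close>
    this produces the 16.\<close>
  have iL: "1 / L\<^sup>2 \<le> 16 / (\<epsilon>\<^sup>2 * a)"
  proof -
    have "(N / 2)\<^sup>2 \<le> (N - 1)\<^sup>2" using N by (intro power_mono) auto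
    then have "\<epsilon>\<^sup>2 * (N * s\<^sup>2) * ((N / 2)\<^sup>2 / 4) \<le> \<epsilon>\<^sup>2 * (N * s\<^sup>2) * ((N - 1)\<^sup>2 / 4)"
      using N by (intro mult_left_mono) auto
    also have "\<dots> = L\<^sup>2"
      using N by (simp add: L_def power_divide power_mult_distrib)
    finally have "\<epsilon>\<^sup>2 * a / 16 \<le> L\<^sup>2"
      by (simp add: a_def power2_eq_square power3_eq_cube ac_simps)
    moreover have "0 < \<epsilon>\<^sup>2 * a / 16" using a e by simp
    ultimately have "1 / L\<^sup>2 \<le> 1 / (\<epsilon>\<^sup>2 * a / 16)" by (intro divide_left_mono mult_pos_pos) (use L in auto)
    then show ?thesis by simp
  qed
  \<comment> \<open>From n < 4^(i+1) the power n^(3/2) is at most 8 times 8^i; multiplied by the 64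
    in \<open>w\<close> this gives 512.\<close>
  have Nw: "N * w \<le> 512 * D0 / sqrt N"
  proof -
    have "real n \<le> real (4 * 4 ^ i)" using i(2) by (subst of_nat_le_iff) simp
    then have "N \<le> 4 * 4 ^ i" by (simp add: N_def)
    then have "sqrt N \<le> sqrt (4 * 4 ^ i)" by simp
    also have "\<dots> = 2 * 2 ^ i" by (simp add: real_sqrt_mult real_sqrt_power)
    finally have "sqrt N ^ 3 \<le> (2 * 2 ^ i) ^ 3" using N by (intro power_mono) auto
    also have "\<dots> = 8 * 8 ^ i" by (simp add: power_mult_distrib power3_eq_cube flip: power_mult_distrib)
    finally have *: "N * sqrt N \<le> 8 * 8 ^ i" using N by (simp add: power3_eq_cube)
    have "N * w * sqrt N = (N * sqrt N) * (64 * D0 / 8 ^ i)" by (simp add: w_def)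
    also have "\<dots> \<le> (8 * 8 ^ i) * (64 * D0 / 8 ^ i)" using * D0_ge by (intro mult_right_mono) auto
    also have "\<dots> = 512 * D0" by simp
    finally show ?thesis using N by (simp add: pos_le_divide_eq)
  qed
  have four: "(real (2 ^ i))\<^sup>2 \<le> N"
  proof -
    have "(real (2 ^ i))\<^sup>2 = real (4 ^ i)" by (simp add: power2_eq_square flip: power_mult_distrib)
    then show ?thesis using i(1) by (simp add: N_def del: of_nat_power)
  qed
  have "?p = measure \<Omega> {\<omega> \<in> space \<Omega>. 2 * L < \<bar>\<Sum>t<n. \<Sum>s<t. h (X (Suc t) \<omega>, X (Suc s) \<omega>)\<bar>}"
    by (simp add: L_def N_def)
  also have "\<dots> \<le> N * (T\<^sup>2 * B3 * N / a + w) +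
     (1 / L\<^sup>2) * (N * (2 * ((real (2 ^ i))\<^sup>2 * (2 * (T\<^sup>2 * C0) + 2 * (T\<^sup>2 * c\<^sup>2) * C0)) + 2 * (T\<^sup>2 * B3 * N + a * w))) +
     (1 / L\<^sup>2) * (N\<^sup>2 * (T\<^sup>2 * c\<^sup>2 * C0))"
    unfolding N_def w_def by (rule U_tail_bound[OF a L])
  also have "\<dots> \<le> \<eta> * B3 + N * w + 16 / \<epsilon>\<^sup>2 * (2 * (\<eta> * B1) + 2 * (\<eta> * B3) + 2 * (N * w)) + 16 / \<epsilon>\<^sup>2 * (\<eta> * (c\<^sup>2 * C0))"
  proof (intro add_mono)
    have "N * (T\<^sup>2 * B3 * N / a) = \<eta> * B3"
      unfolding T2 a_def using N s by (simp add: power3_eq_cube power2_eq_square)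
    then show "N * (T\<^sup>2 * B3 * N / a + w) \<le> \<eta> * B3 + N * w" by (simp add: distrib_left)
    have sc: "1 / L\<^sup>2 * (a * y) \<le> 16 / \<epsilon>\<^sup>2 * y" if "0 \<le> y" for y
    proof -
      have "1 / L\<^sup>2 * (a * y) \<le> 16 / (\<epsilon>\<^sup>2 * a) * (a * y)" using iL a that by (intro mult_right_mono) auto
      then show ?thesis using a by simp
    qed
    have "N * (2 * ((real (2 ^ i))\<^sup>2 * (2 * (T\<^sup>2 * C0) + 2 * (T\<^sup>2 * c\<^sup>2) * C0)) + 2 * (T\<^sup>2 * B3 * N + a * w))
       = N * (2 * ((real (2 ^ i))\<^sup>2 * (T\<^sup>2 * B1)) + 2 * (T\<^sup>2 * B3 * N + a * w))"
      by (simp add: B1_def algebra_simps)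
    also have "\<dots> \<le> N * (2 * (N * (T\<^sup>2 * B1)) + 2 * (T\<^sup>2 * B3 * N + a * w))"
    proof (rule mult_left_mono)
      have "(real (2 ^ i))\<^sup>2 * (T\<^sup>2 * B1) \<le> N * (T\<^sup>2 * B1)"
        using four B1 by (intro mult_right_mono) auto
      then show "2 * ((real (2 ^ i))\<^sup>2 * (T\<^sup>2 * B1)) + 2 * (T\<^sup>2 * B3 * N + a * w) \<le> 2 * (N * (T\<^sup>2 * B1)) + 2 * (T\<^sup>2 * B3 * N + a * w)"
        by linarith
    qed (use N in simp)
    also have "\<dots> = a * (2 * (\<eta> * B1) + 2 * (\<eta> * B3) + 2 * (N * w))"
      unfolding T2 a_def by (simp add: algebra_simps power3_eq_cube power2_eq_square)
    finally have "(1 / L\<^sup>2) * (N * (2 * ((real (2 ^ i))\<^sup>2 * (2 * (T\<^sup>2 * C0) + 2 * (T\<^sup>2 * c\<^sup>2) * C0)) + 2 * (T\<^sup>2 * B3 * N + a * w)))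
      \<le> (1 / L\<^sup>2) * (a * (2 * (\<eta> * B1) + 2 * (\<eta> * B3) + 2 * (N * w)))"
      by (rule mult_left_mono) simp
    also have "\<dots> \<le> 16 / \<epsilon>\<^sup>2 * (2 * (\<eta> * B1) + 2 * (\<eta> * B3) + 2 * (N * w))"
      using \<eta> B1 B3_nonneg N w by (intro sc) auto
    finally show "(1 / L\<^sup>2) * (N * (2 * ((real (2 ^ i))\<^sup>2 * (2 * (T\<^sup>2 * C0) + 2 * (T\<^sup>2 * c\<^sup>2) * C0)) + 2 * (T\<^sup>2 * B3 * N + a * w)))
      \<le> 16 / \<epsilon>\<^sup>2 * (2 * (\<eta> * B1) + 2 * (\<eta> * B3) + 2 * (N * w))" .
    have "N\<^sup>2 * (T\<^sup>2 * c\<^sup>2 * C0) = a * (\<eta> * (c\<^sup>2 * C0))"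
      unfolding T2 a_def by (simp add: power3_eq_cube power2_eq_square)
    then show "(1 / L\<^sup>2) * (N\<^sup>2 * (T\<^sup>2 * c\<^sup>2 * C0)) \<le> 16 / \<epsilon>\<^sup>2 * (\<eta> * (c\<^sup>2 * C0))"
      using sc[of "\<eta> * (c\<^sup>2 * C0)"] \<eta> C0_ge_1 by (simp only: mult_nonneg_nonneg zero_le_power2 order_trans[OF zero_le_one])
  qed
  also have "\<dots> = (B3 + 16 / \<epsilon>\<^sup>2 * (2 * B1 + 2 * B3 + c\<^sup>2 * C0)) * \<eta> + (1 + 32 / \<epsilon>\<^sup>2) * (N * w)"
    by (simp add: algebra_simps)
  also have "\<dots> \<le> (B3 + 16 / \<epsilon>\<^sup>2 * (2 * B1 + 2 * B3 + c\<^sup>2 * C0)) * \<eta> + (1 + 32 / \<epsilon>\<^sup>2) * (512 * D0 / sqrt N)"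
    by (intro add_left_mono mult_left_mono Nw) simp
  finally show ?thesis
    by (simp add: B3_def B1_def D0_def \<eta>_def N_def)
qed

end

section \<open>Hoeffding's decomposition and the hypotheses on the kernels\<close>

lemma U_stat_eq: "U_stat n g X \<omega> = (\<Sum>t<n. \<Sum>s<t. g (X (Suc t) \<omega>, X (Suc s) \<omega>))"
proof -
  define F where "F l = (\<Sum>j = 1..l - 1. g (X l \<omega>, X j \<omega>))" for l
  have "(\<Sum>l = 2..n. F l) = (\<Sum>l = 1..n. F l)"
  proof (cases "n = 0")
    case False
    then have "{1..n} = insert 1 {2..n}" by auto
    then show ?thesis by (simp add: F_def)
  qed simp
  also have "\<dots> = (\<Sum>t<n. F (Suc t))" using sum.atLeast1_atMost_eq[of F n] by simp
  finally have "(\<Sum>l = 2..n. F l) = (\<Sum>t<n. F (Suc t))" .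
  moreover have "F (Suc t) = (\<Sum>s<t. g (X (Suc t) \<omega>, X (Suc s) \<omega>))" for t
    unfolding F_def using sum.atLeast1_atMost_eq[of "\<lambda>j. g (X (Suc t) \<omega>, X j \<omega>)" t] by simp
  ultimately show ?thesis by (simp add: U_stat_def F_def)
qed

text \<open>The factor n - 1 arises because each index lies in n - 1 pairs, counting its roles as
  larger and as smaller index together.\<close>

lemma sum_pairs_hoeffding:
  fixes a :: "nat \<Rightarrow> real"
  shows "(\<Sum>t<n. \<Sum>s<t. f t s + a t + a s + \<theta>) = (\<Sum>t<n. \<Sum>s<t. f t s) + (real n - 1) * (\<Sum>t<n. a t) + \<theta> * real (n choose 2)"
proof (induction n)
  case (Suc n)
  have "(\<Sum>s<n. f n s + a n + a s + \<theta>) = (\<Sum>s<n. f n s) + real n * a n + (\<Sum>s<n. a s) + real n * \<theta>"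
    by (simp add: sum.distrib)
  moreover have "Suc n choose 2 = n + (n choose 2)" by (simp add: numeral_2_eq_2)
  ultimately show ?case using Suc by (simp add: algebra_simps)
qed simp

lemma U_stat_hoeffding:
  "U_stat n h X \<omega> - hoeff_mean \<mu> h * real (n choose 2) =
     (\<Sum>t<n. \<Sum>s<t. hoeff_snd \<mu> h (X (Suc t) \<omega>, X (Suc s) \<omega>)) + (real n - 1) * (\<Sum>l = 1..n. hoeff_fst \<mu> h (X l \<omega>))"
proof -
  let ?h2 = "hoeff_snd \<mu> h" and ?h1 = "hoeff_fst \<mu> h" and ?\<theta> = "hoeff_mean \<mu> h"
  have "U_stat n h X \<omega> = (\<Sum>t<n. \<Sum>s<t. ?h2 (X (Suc t) \<omega>, X (Suc s) \<omega>) + ?h1 (X (Suc t) \<omega>) + ?h1 (X (Suc s) \<omega>) + ?\<theta>)"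
    unfolding U_stat_eq by (simp add: hoeff_snd_def)
  also have "\<dots> = (\<Sum>t<n. \<Sum>s<t. ?h2 (X (Suc t) \<omega>, X (Suc s) \<omega>)) + (real n - 1) * (\<Sum>t<n. ?h1 (X (Suc t) \<omega>)) + ?\<theta> * real (n choose 2)"
    by (rule sum_pairs_hoeffding)
  also have "(\<Sum>t<n. ?h1 (X (Suc t) \<omega>)) = (\<Sum>l = 1..n. ?h1 (X l \<omega>))"
    using sum.atLeast1_atMost_eq[of "\<lambda>l. ?h1 (X l \<omega>)" n] by simp
  finally show ?thesis by simp
qed

text \<open>Finiteness of the norm excludes an infinite integral, whose square root and quotient by
  \<open>V\<close> would remain infinite.\<close>

lemma triple_norm_second_moment:
  assumes T: "triple_norm M P 2 V g = ennreal T" "0 \<le> T"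
    and x: "x \<in> space M" and y: "y \<in> space M" and V: "0 < V (x, y)"
  shows "(\<integral>\<^sup>+z. ennreal ((g (z, y))\<^sup>2) \<partial>P x) \<le> ennreal (T\<^sup>2 * (V (x, y))\<^sup>2)"
proof -
  define I where "I = (\<integral>\<^sup>+z. ennreal ((g (z, y))\<^sup>2) \<partial>P x)"
  have I: "(\<integral>\<^sup>+z. ennreal (\<bar>g (z, y)\<bar> powr 2) \<partial>P x) = I"
    unfolding I_def by (intro nn_integral_cong) simp
  have "ennreal_powr I (1 / 2) / ennreal (V (x, y)) \<le> triple_norm M P 2 V g"
    unfolding triple_norm_def I[symmetric] by (rule SUP_upper2[OF x SUP_upper[OF y]])
  then have le: "ennreal_powr I (1 / 2) / ennreal (V (x, y)) \<le> ennreal T" by (simp add: T)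
  have "I \<noteq> \<infinity>"
  proof
    assume "I = \<infinity>"
    then have "ennreal_powr I (1 / 2) / ennreal (V (x, y)) = top"
      by (simp add: ennreal_powr_def ennreal_top_divide)
    then show False using le by (simp add: top_unique)
  qed
  then obtain r where r: "I = ennreal r" "0 \<le> r" by (cases I) auto
  have "ennreal (sqrt r / V (x, y)) \<le> ennreal T"
    using le r V by (simp add: ennreal_powr_def powr_half_sqrt divide_ennreal)
  then have "sqrt r / V (x, y) \<le> T" using T(2) by simp
  then have "sqrt r \<le> T * V (x, y)" using V by (simp add: pos_divide_le_eq)
  then have "(sqrt r)\<^sup>2 \<le> (T * V (x, y))\<^sup>2" using r by (intro power_mono) auto
  then have "r \<le> T\<^sup>2 * (V (x, y))\<^sup>2" using r by (simp add: power_mult_distrib)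
  then show ?thesis unfolding I_def[symmetric] r(1) by (rule ennreal_leI)
qed

context product_ergodic_kernel
begin

lemma dominated_weighted_space:
  assumes "g \<in> weighted_space (M \<Otimes>\<^sub>M M) V"
  shows "dominated g"
proof -
  obtain r where r: "weighted_sup_norm (M \<Otimes>\<^sub>M M) V g = ennreal r" "0 \<le> r"
    using assms by (cases "weighted_sup_norm (M \<Otimes>\<^sub>M M) V g") (auto simp: weighted_space_def)
  show ?thesis
  proof (rule dominatedI)
    show "g \<in> borel_measurable (M \<Otimes>\<^sub>M M)" using assms by (simp add: weighted_space_def)
    fix x y assume xy: "x \<in> space M" "y \<in> space M"
    then have "ennreal (\<bar>g (x, y)\<bar> / V (x, y)) \<le> ennreal r"
      unfolding r(1)[symmetric] weighted_sup_norm_def by (intro SUP_upper) (auto simp: space_pair_measure)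
    then have "\<bar>g (x, y)\<bar> / V (x, y) \<le> r" using r(2) by simp
    then show "\<bar>g (x, y)\<bar> \<le> r * V (x, y)" using V_ge_1[OF xy] by (simp add: pos_divide_le_eq)
  qed
qed

text \<open>Integrability of \<open>g\<close> under the product of mu with itself controls its
  sections for almost every point only. Domination makes every section of the degenerate part
  integrable, so that the integral of \<open>g (x, w)\<close> splits at each \<open>x\<close>;
  symmetry gives the other coordinate.\<close>

lemma canonical_hoeff_snd:
  assumes g [measurable]: "g \<in> borel_measurable (M \<Otimes>\<^sub>M M)" and sym: "symmetric_on (space M) g"
    and int: "(\<integral>\<^sup>+y. (\<integral>\<^sup>+x. ennreal \<bar>g (x, y)\<bar> \<partial>\<mu>) \<partial>\<mu>) < \<infinity>" and dom: "dominated (hoeff_snd \<mu> g)"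
  shows "canonical (hoeff_snd \<mu> g)"
proof -
  interpret mu: prob_space \<mu> by (rule prob_mu)
  interpret mm: pair_prob_space \<mu> \<mu> ..
  have st: "sets (\<mu> \<Otimes>\<^sub>M \<mu>) = sets (M \<Otimes>\<^sub>M M)" by (auto intro!: sets_pair_measure_cong)
  have gm: "g \<in> borel_measurable (\<mu> \<Otimes>\<^sub>M \<mu>)" using g by (simp add: measurable_cong_sets[OF st refl])
  have gi: "integrable (\<mu> \<Otimes>\<^sub>M \<mu>) g"
  proof (rule integrableI_bounded[OF gm])
    have "(\<lambda>z. ennreal (norm (g z))) \<in> borel_measurable (\<mu> \<Otimes>\<^sub>M \<mu>)" using gm by measurable
    from mm.nn_integral_snd[OF this] int show "(\<integral>\<^sup>+z. ennreal (norm (g z)) \<partial>(\<mu> \<Otimes>\<^sub>M \<mu>)) < \<infinity>" by simp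
  qed
  let ?h1 = "hoeff_fst \<mu> g" and ?\<theta> = "hoeff_mean \<mu> g"
  have i1: "integrable \<mu> (\<lambda>x. \<integral>z. g (x, z) \<partial>\<mu>)" by (rule mm.integrable_fst'[OF gi])
  have th: "(\<integral>x. (\<integral>z. g (x, z) \<partial>\<mu>) \<partial>\<mu>) = ?\<theta>"
    unfolding hoeff_mean_def mm.integral_fst'[OF gi] using mm.integral_snd[of "\<lambda>x y. g (x, y)"] gi by simp
  have h1i: "integrable \<mu> ?h1" unfolding hoeff_fst_def[abs_def] using i1 by simp
  have h10: "(\<integral>x. ?h1 x \<partial>\<mu>) = 0"
    unfolding hoeff_fst_def using i1 th mu.prob_space by simp
  have symh: "hoeff_snd \<mu> g (x, y) = hoeff_snd \<mu> g (y, x)" if "x \<in> space M" "y \<in> space M" for x y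
    using sym that unfolding symmetric_on_def hoeff_snd_def by simp
  have z: "(\<integral>w. hoeff_snd \<mu> g (x, w) \<partial>\<mu>) = 0" if x: "x \<in> space M" for x
  proof -
    have i2: "integrable \<mu> (\<lambda>w. hoeff_snd \<mu> g (x, w))" by (rule dominated_integrable_mu(1)[OF dom x])
    have "(\<integral>w. g (x, w) \<partial>\<mu>) = (\<integral>w. hoeff_snd \<mu> g (x, w) + (?h1 x + ?h1 w + ?\<theta>) \<partial>\<mu>)"
      by (intro Bochner_Integration.integral_cong) (auto simp: hoeff_snd_def)
    also have "\<dots> = (\<integral>w. hoeff_snd \<mu> g (x, w) \<partial>\<mu>) + (?h1 x + 0 + ?\<theta>)"
      using i2 h1i h10 mu.prob_space by simp
    finally show ?thesis by (simp add: hoeff_fst_def)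
  qed
  have "(\<integral>w. hoeff_snd \<mu> g (w, x) \<partial>\<mu>) = 0" if x: "x \<in> space M" for x
  proof -
    have "(\<integral>w. hoeff_snd \<mu> g (w, x) \<partial>\<mu>) = (\<integral>w. hoeff_snd \<mu> g (x, w) \<partial>\<mu>)"
      using x by (intro Bochner_Integration.integral_cong) (auto simp: symh)
    then show ?thesis using z[OF x] by simp
  qed
  with z show ?thesis by (simp add: canonical_def)
qed

end

theorem theorem4p1:
  fixes M :: "'a measure" and P :: "'a \<Rightarrow> 'a measure" and \<mu> \<rho> :: "'a measure"
    and \<Omega> :: "'w measure" and X :: "nat \<Rightarrow> 'w \<Rightarrow> 'a"
    and \<Omega>\<^sub>\<mu> :: "'v measure" and Y :: "nat \<Rightarrow> 'v \<Rightarrow> 'a"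
    and V\<^sub>2 W\<^sub>2 \<U>\<^sub>2 :: "'a \<times> 'a \<Rightarrow> real" and \<U>\<^sub>1 \<V>\<^sub>1 :: "'a \<Rightarrow> real"
    and c\<^sub>2 c\<^sub>3 :: real
    and h :: "nat \<Rightarrow> 'a \<times> 'a \<Rightarrow> real" and \<sigma>\<^sub>1 \<sigma> :: "nat \<Rightarrow> real"
  defines "\<theta> \<equiv> (\<lambda>n. hoeff_mean \<mu> (h n))"
    and "h1 \<equiv> (\<lambda>n. hoeff_fst \<mu> (h n))"
    and "h2 \<equiv> (\<lambda>n. hoeff_snd \<mu> (h n))"
  assumes "countably_generated_space M"
    and "P \<in> M \<rightarrow>\<^sub>M prob_algebra M"
    and "invariant_distribution M P \<mu>"
    and "\<rho> \<in> space (prob_algebra M)"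
    and "markov_chain \<Omega> M P \<rho> X"
    and "markov_chain \<Omega>\<^sub>\<mu> M P \<mu> Y"
    and "V\<^sub>2 \<in> borel_measurable (M \<Otimes>\<^sub>M M)" and "W\<^sub>2 \<in> borel_measurable (M \<Otimes>\<^sub>M M)"
    and "symmetric_on (space M) V\<^sub>2" and "symmetric_on (space M) W\<^sub>2"
    and "\<forall>x\<in>space M. \<forall>y\<in>space M. 1 \<le> V\<^sub>2 (x, y) \<and> V\<^sub>2 (x, y) \<le> W\<^sub>2 (x, y)"
    \<comment> \<open>(i)\<close>
    and "cond_C2 M P \<mu> V\<^sub>2 W\<^sub>2"
    and "\<forall>x\<in>space M. \<forall>y\<in>space M. kernel_fst P (\<lambda>z. ennreal (W\<^sub>2 z)) (x, y) < \<infinity>"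
    and "\<forall>x\<in>space M. \<forall>y\<in>space M. kernel_both P (\<lambda>z. ennreal (W\<^sub>2 z)) (x, y) < \<infinity>"
    \<comment> \<open>(ii)\<close>
    and "\<forall>x\<in>space M. \<forall>y\<in>space M.
           kernel_fst P (\<lambda>z. ennreal (V\<^sub>2 z)) (x, y) \<le> ennreal (c\<^sub>2 * V\<^sub>2 (x, y))"
    and "\<forall>x\<in>space M. \<forall>y\<in>space M.
           kernel_fst P (\<lambda>z. ennreal ((W\<^sub>2 z)\<^sup>2)) (x, y) \<le> ennreal (c\<^sub>2 * (W\<^sub>2 (x, y))\<^sup>2)"
    and "(SUP l. SUP j. \<integral>\<^sup>+ \<omega>. ennreal ((W\<^sub>2 (X l \<omega>, X j \<omega>))\<^sup>2) \<partial>\<Omega>) < \<infinity>"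
    \<comment> \<open>(iii)\<close>
    and "\<U>\<^sub>1 \<in> borel_measurable M" and "\<V>\<^sub>1 \<in> borel_measurable M"
    and "\<forall>x\<in>space M. 1 \<le> \<U>\<^sub>1 x \<and> \<U>\<^sub>1 x \<le> \<V>\<^sub>1 x"
    and "\<U>\<^sub>2 \<in> borel_measurable (M \<Otimes>\<^sub>M M)" and "symmetric_on (space M) \<U>\<^sub>2"
    and "\<forall>x\<in>space M. \<forall>y\<in>space M. 1 \<le> \<U>\<^sub>2 (x, y)"
    and "cond_C1 M P \<mu> \<U>\<^sub>1 \<V>\<^sub>1"
    and "\<forall>m. \<forall>x\<^sub>1\<in>space M. \<forall>x\<^sub>2\<in>space M. \<forall>x\<^sub>3\<in>space M.
           (\<integral>\<^sup>+ z\<^sub>1. (\<integral>\<^sup>+ z\<^sub>2. ennreal ((W\<^sub>2 (z\<^sub>2, z\<^sub>1) + W\<^sub>2 (z\<^sub>2, x\<^sub>1)) * (W\<^sub>2 (z\<^sub>2, x\<^sub>2) + W\<^sub>2 (z\<^sub>2, x\<^sub>3)))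
              \<partial>kernel_power M P m z\<^sub>1) \<partial>P x\<^sub>1)
           \<le> ennreal (c\<^sub>3 * \<U>\<^sub>1 x\<^sub>1 * \<U>\<^sub>2 (x\<^sub>2, x\<^sub>3))"
    and "(SUP l\<in>{1..}. \<integral>\<^sup>+ \<omega>. ennreal (\<V>\<^sub>1 (X l \<omega>) * \<U>\<^sub>2 (X l \<omega>, X (l - 1) \<omega>)) \<partial>\<Omega>) < \<infinity>"
    \<comment> \<open>the kernels and the normalizations\<close>
    and "\<forall>n\<ge>1. h n \<in> borel_measurable (M \<Otimes>\<^sub>M M) \<and> symmetric_on (space M) (h n)"
    and "\<forall>n\<ge>1. (\<integral>\<^sup>+ y. (\<integral>\<^sup>+ x. ennreal \<bar>h n (x, y)\<bar> \<partial>\<mu>) \<partial>\<mu>) < \<infinity>"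
    and "\<forall>n\<ge>1. h2 n \<in> weighted_space (M \<Otimes>\<^sub>M M) V\<^sub>2"
    and "\<forall>n\<ge>1. \<sigma>\<^sub>1 n > 0 \<and> has_asymptotic_variance \<Omega>\<^sub>\<mu> Y (h1 n) ((\<sigma>\<^sub>1 n)\<^sup>2)"
    and "\<forall>n\<ge>2. \<sigma> n > 0 \<and> (\<sigma> n)\<^sup>2 = real n * (real n - 1)\<^sup>2 * (\<sigma>\<^sub>1 n)\<^sup>2"
    and "(\<lambda>n. triple_norm M P 2 V\<^sub>2 (h2 n) / ennreal (sqrt (real n) * \<sigma>\<^sub>1 n)) \<longlonglongrightarrow> 0"
  shows "tendsto_in_prob \<Omega>
           (\<lambda>n \<omega>. 1 / \<sigma> n * (U_stat n (h n) X \<omega> - \<theta> n * real (n choose 2))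
                  - 1 / (\<sigma>\<^sub>1 n * sqrt (real n)) * (\<Sum>l=1..n. h1 n (X l \<omega>))) 0"
proof -
  note asm = assms(4-)
  note M_gen = asm(1) and P = asm(2) and inv = asm(3) and chain = asm(5)
    and V_meas = asm(7) and W_meas = asm(8) and V_sym = asm(9) and VW = asm(11) and C2 = asm(12)
    and PV = asm(15) and moment = asm(17)
    and h_meas = asm(27) and h_int = asm(28) and h2_V = asm(29) and \<sigma>\<^sub>1 = asm(30) and \<sigma> = asm(31) and lim = asm(32)
  obtain c :: real where c: "\<forall>x\<in>space M. \<forall>y\<in>space M.
      (\<Sum>k. \<Sum>i. signed_measure_norm (M \<Otimes>\<^sub>M M) V\<^sub>2 (diff_signed_prod (kernel_power M P k x) \<mu> (kernel_power M P i y) \<mu>)) \<le> ennreal (c * W\<^sub>2 (x, y))"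
    using C2 unfolding cond_C2_def by blast
  \<comment> \<open>A constant of at least 1 keeps \<open>cc\<close> times \<open>W\<close> above 1,
    so that it may be replaced by its square in \<open>ergodic_rate'\<close>.\<close>
  define cc where "cc = max 1 c"
  obtain r where r: "(SUP l. SUP j. \<integral>\<^sup>+ \<omega>. ennreal ((W\<^sub>2 (X l \<omega>, X j \<omega>))\<^sup>2) \<partial>\<Omega>) = ennreal r" "0 \<le> r"
    using moment by (cases "SUP l. SUP j. \<integral>\<^sup>+ \<omega>. ennreal ((W\<^sub>2 (X l \<omega>, X j \<omega>))\<^sup>2) \<partial>\<Omega>") auto
  define C0 where "C0 = max 1 r"
  interpret ergodic_chain M P \<mu> V\<^sub>2 W\<^sub>2 cc c\<^sub>2 \<Omega> \<rho> X C0
  proof unfold_locales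
    show "P \<in> M \<rightarrow>\<^sub>M prob_algebra M" "invariant_distribution M P \<mu>" "countably_generated_space M"
      "V\<^sub>2 \<in> borel_measurable (M \<Otimes>\<^sub>M M)" "W\<^sub>2 \<in> borel_measurable (M \<Otimes>\<^sub>M M)" "markov_chain \<Omega> M P \<rho> X"
      by (fact P inv M_gen V_meas W_meas chain)+
    show "1 \<le> cc" "1 \<le> C0" by (simp_all add: cc_def C0_def)
    show "(\<integral>\<^sup>+ \<omega>. ennreal ((W\<^sub>2 (X l \<omega>, X j \<omega>))\<^sup>2) \<partial>\<Omega>) \<le> ennreal C0" for l j
    proof -
      have "(\<integral>\<^sup>+ \<omega>. ennreal ((W\<^sub>2 (X l \<omega>, X j \<omega>))\<^sup>2) \<partial>\<Omega>) \<le> ennreal r"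
        unfolding r(1)[symmetric] by (rule SUP_upper2[of l], simp, rule SUP_upper[of j], simp)
      also have "\<dots> \<le> ennreal C0" by (rule ennreal_leI) (simp add: C0_def)
      finally show ?thesis .
    qed
    fix x y assume xy: "x \<in> space M" "y \<in> space M"
    show "V\<^sub>2 (x, y) = V\<^sub>2 (y, x)" using V_sym xy by (auto simp: symmetric_on_def)
    show "1 \<le> V\<^sub>2 (x, y)" "V\<^sub>2 (x, y) \<le> W\<^sub>2 (x, y)" using VW xy by auto
    show "(\<integral>\<^sup>+ z. ennreal (V\<^sub>2 (z, y)) \<partial>P x) \<le> ennreal (c\<^sub>2 * V\<^sub>2 (x, y))"
      using PV xy by (simp add: kernel_fst_def)
    have "1 \<le> V\<^sub>2 (x, y)" "V\<^sub>2 (x, y) \<le> W\<^sub>2 (x, y)" using VW xy by auto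
    then have "c * W\<^sub>2 (x, y) \<le> cc * W\<^sub>2 (x, y)" by (intro mult_right_mono) (auto simp: cc_def)
    then show "(\<Sum>k. \<Sum>i. signed_measure_norm (M \<Otimes>\<^sub>M M) V\<^sub>2 (diff_signed_prod (kernel_power M P k x) \<mu> (kernel_power M P i y) \<mu>)) \<le> ennreal (cc * W\<^sub>2 (x, y))"
      using c xy by (meson ennreal_leI order_trans)
  qed
  define T where "T n = triple_norm M P 2 V\<^sub>2 (h2 n)" for n
  define U where "U n \<omega> = (\<Sum>t<n. \<Sum>s<t. h2 n (X (Suc t) \<omega>, X (Suc s) \<omega>))" for n \<omega>
  let ?\<tau> = "\<lambda>n. enn2real (T n) / (sqrt (real n) * \<sigma>\<^sub>1 n)"
  have T_lim: "(\<lambda>n. T n / ennreal (sqrt (real n) * \<sigma>\<^sub>1 n)) \<longlonglongrightarrow> 0" using lim by (simp add: T_def)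
  have s_pos: "0 < sqrt (real n) * \<sigma>\<^sub>1 n" if "1 \<le> n" for n using \<sigma>\<^sub>1 that by simp
  \<comment> \<open>An infinite triple norm makes the quotient infinite; convergence rules this out
    for all large \<open>n\<close>, but not for the first ones.\<close>
  have T_fin: "eventually (\<lambda>n. T n < top) sequentially"
  proof -
    have "eventually (\<lambda>n. T n / ennreal (sqrt (real n) * \<sigma>\<^sub>1 n) < 1) sequentially"
      using order_tendstoD(2)[OF T_lim, of 1] by simp
    then show ?thesis using eventually_ge_at_top[of 1]
    proof eventually_elim
      case (elim n)
      show ?case
      proof (rule ccontr)
        assume "\<not> T n < top"
        then have "T n / ennreal (sqrt (real n) * \<sigma>\<^sub>1 n) = top" by (simp add: not_less top_unique ennreal_top_divide)
        then show False using elim(1) by simp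
      qed
    qed
  qed
  have \<tau>_lim: "?\<tau> \<longlonglongrightarrow> 0"
  proof -
    have "(\<lambda>n. enn2real (T n / ennreal (sqrt (real n) * \<sigma>\<^sub>1 n))) \<longlonglongrightarrow> 0"
      by (rule tendsto_enn2real) (use T_lim in simp_all)
    moreover have "eventually (\<lambda>n. enn2real (T n / ennreal (sqrt (real n) * \<sigma>\<^sub>1 n)) = ?\<tau> n) sequentially"
      using T_fin eventually_ge_at_top[of 1]
    proof eventually_elim
      case (elim n)
      then obtain t where t: "T n = ennreal t" "0 \<le> t" by (cases "T n") auto
      then show ?case using s_pos[OF elim(2)] by (simp add: divide_ennreal)
    qed
    ultimately show ?thesis by (simp cong: tendsto_cong)
  qed
  have \<sigma>_eq: "\<sigma> n = sqrt (real n) * (real n - 1) * \<sigma>\<^sub>1 n" if n: "2 \<le> n" for n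
  proof -
    have "(\<sigma> n)\<^sup>2 = (sqrt (real n) * (real n - 1) * \<sigma>\<^sub>1 n)\<^sup>2"
      using \<sigma> n by (simp add: power_mult_distrib)
    moreover have "0 \<le> \<sigma> n" "0 \<le> sqrt (real n) * (real n - 1) * \<sigma>\<^sub>1 n"
      using \<sigma> \<sigma>\<^sub>1 n by (auto intro!: mult_nonneg_nonneg less_imp_le)
    ultimately show ?thesis using power2_eq_imp_eq by blast
  qed
  have Z: "1 / \<sigma> n * (U_stat n (h n) X \<omega> - \<theta> n * real (n choose 2)) - 1 / (\<sigma>\<^sub>1 n * sqrt (real n)) * (\<Sum>l=1..n. h1 n (X l \<omega>)) = U n \<omega> / \<sigma> n"
    if n: "2 \<le> n" for n \<omega>
  proof -
    \<comment> \<open>This identity makes the linear part of Hoeffding's decomposition cancel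
      exactly.\<close>
    have "1 / \<sigma> n * (real n - 1) = 1 / (\<sigma>\<^sub>1 n * sqrt (real n))"
      using n \<sigma>\<^sub>1 by (simp add: \<sigma>_eq)
    moreover have "U_stat n (h n) X \<omega> - \<theta> n * real (n choose 2) = U n \<omega> + (real n - 1) * (\<Sum>l=1..n. h1 n (X l \<omega>))"
      unfolding U_def assms(1,2,3) by (rule U_stat_hoeffding)
    ultimately show ?thesis by (simp add: distrib_left mult.assoc[symmetric])
  qed
  show ?thesis
    unfolding tendsto_in_prob_def
  proof (intro allI impI)
    fix \<epsilon> :: real assume e: "0 < \<epsilon>"
    define C1 where "C1 = (4 + 7 * cc\<^sup>2) * C0 + 16 / \<epsilon>\<^sup>2 * (2 * (2 * C0 + 2 * cc\<^sup>2 * C0) + 2 * ((4 + 7 * cc\<^sup>2) * C0) + cc\<^sup>2 * C0)"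
    define C2 where "C2 = (1 + 32 / \<epsilon>\<^sup>2) * (512 * (65536 * cc\<^sup>2 * C0))"
    have bound: "eventually (\<lambda>n. measure \<Omega> {\<omega> \<in> space \<Omega>. \<bar>1 / \<sigma> n * (U_stat n (h n) X \<omega> - \<theta> n * real (n choose 2))
        - 1 / (\<sigma>\<^sub>1 n * sqrt (real n)) * (\<Sum>l=1..n. h1 n (X l \<omega>)) - 0\<bar> > \<epsilon>} \<le> C1 * (?\<tau> n)\<^sup>2 + C2 / sqrt (real n)) sequentially"
      using T_fin eventually_ge_at_top[of 2]
    proof eventually_elim
      case (elim n)
      have n1: "1 \<le> n" using elim(2) by simp
      have dom: "dominated (h2 n)" using h2_V n1 by (intro dominated_weighted_space) simp
      \<comment> \<open>The locale is entered for each large \<open>n\<close> separately, while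
        \<open>C1\<close> and \<open>C2\<close> depend neither on \<open>n\<close> nor on the
        kernel.\<close>
      interpret degenerate_kernel_chain M P \<mu> V\<^sub>2 W\<^sub>2 cc c\<^sub>2 \<Omega> \<rho> X C0 "h2 n" "enn2real (T n)"
      proof unfold_locales
        show "dominated (h2 n)" by (rule dom)
        show "canonical (h2 n)"
          using h_meas h_int n1 dom unfolding assms(3) by (intro canonical_hoeff_snd) auto
        show "0 \<le> enn2real (T n)" by simp
        fix x y assume xy: "x \<in> space M" "y \<in> space M"
        then show "h2 n (x, y) = h2 n (y, x)"
          using h_meas n1 unfolding assms(3) hoeff_snd_def symmetric_on_def by simp
        show "(\<integral>\<^sup>+z. ennreal ((h2 n (z, y))\<^sup>2) \<partial>P x) \<le> ennreal ((enn2real (T n))\<^sup>2 * (V\<^sub>2 (x, y))\<^sup>2)"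
          using V_ge_1[OF xy] elim(1) by (intro triple_norm_second_moment[OF _ _ xy]) (auto simp: T_def)
      qed
      have \<sigma>n: "0 < \<sigma> n" using \<sigma> elim(2) by simp
      have "{\<omega> \<in> space \<Omega>. \<bar>1 / \<sigma> n * (U_stat n (h n) X \<omega> - \<theta> n * real (n choose 2))
        - 1 / (\<sigma>\<^sub>1 n * sqrt (real n)) * (\<Sum>l=1..n. h1 n (X l \<omega>)) - 0\<bar> > \<epsilon>}
        = {\<omega> \<in> space \<Omega>. \<epsilon> * (sqrt (real n) * (real n - 1) * \<sigma>\<^sub>1 n) < \<bar>U n \<omega>\<bar>}"
        unfolding Z[OF elim(2)] \<sigma>_eq[OF elim(2), symmetric] using \<sigma>n
        by (simp add: pos_less_divide_eq)
      then show ?case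
        using U_prob_le[OF elim(2) _ e, of "\<sigma>\<^sub>1 n"] \<sigma>\<^sub>1 n1 unfolding U_def C1_def C2_def by simp
    qed
    have "(\<lambda>n. C1 * (?\<tau> n)\<^sup>2 + C2 / sqrt (real n)) \<longlonglongrightarrow> C1 * 0\<^sup>2 + 0"
    proof (intro tendsto_add tendsto_mult tendsto_const tendsto_power \<tau>_lim)
      have "filterlim (\<lambda>n. sqrt (real n)) at_top sequentially"
        by (rule filterlim_compose[OF sqrt_at_top filterlim_real_sequentially])
      then show "(\<lambda>n. C2 / sqrt (real n)) \<longlonglongrightarrow> 0"
        by (rule real_tendsto_divide_at_top[OF tendsto_const])
    qed
    then have lim0: "(\<lambda>n. C1 * (?\<tau> n)\<^sup>2 + C2 / sqrt (real n)) \<longlonglongrightarrow> 0" by simp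
    show "(\<lambda>n. measure \<Omega> {\<omega> \<in> space \<Omega>. \<bar>1 / \<sigma> n * (U_stat n (h n) X \<omega> - \<theta> n * real (n choose 2))
        - 1 / (\<sigma>\<^sub>1 n * sqrt (real n)) * (\<Sum>l=1..n. h1 n (X l \<omega>)) - 0\<bar> > \<epsilon>}) \<longlonglongrightarrow> 0"
      by (rule tendsto_sandwich[OF _ bound tendsto_const lim0]) simp
  qed
qed

end
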